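(* Let $m$ be a positive integer, let $K \subseteq \mathbb{R}$ be compact with finitely many isolated points, and let $\gamma=(f,g,h): K \to \mathbb{H}$ be continuous. Then $\gamma \in C^m_{\mathbb{H}}(K)$ if and only if (1) the $m$th divided differences of $\gamma$ converge uniformly on $K$, and (2) $\gamma$ satisfies the discrete $A/V$ condition on $K$.
   Context: The Heisenberg group $\mathbb{H}$ is $\mathbb{R}^3$ with group law $(x,y,z)*(x',y',z') = (x+x',\,y+y',\,z+z'+2(yx'-xy'))$. An absolutely continuous curve $\Gamma=(f,g,h):\mathbb{R}\to\mathbb{R}^3$ is horizontal if $h' = 2(f'g - fg')$ almost everywhere. $C^m(\mathbb{R})$ denotes the $m$-times continuously differentiable real functions $f$ with $\sup_{x}|f^{(m)}(x)|<\infty$; $C^m(\mathbb{R},\mathbb{R}^3)$ the curves whose components lie in $C^m(\mathbb{R})$. For compact $K$ and $\gamma:K\to\mathbb{H}$, $\gamma\in C^m_{\mathbb{H}}(K)$ means there is a horizontal $\Gamma\in C^m(\mathbb{R},\mathbb{R}^3)$ with $\Gamma|_K=\gamma$. Divided differences: for $\phi:A\to\mathbb{R}$ and distinct points $x_0,\dots,x_k\in A$, $\phi[x_0]=\phi(x_0)$ and $\phi[x_0,\dots,x_k] = (\phi[x_1,\dots,x_k]-\phi[x_0,\dots,x_{k-1}])/(x_k-x_0)$. For a set $X$ of $m+1$ distinct points, $\phi[X]$ is an $m$th divided difference. The $m$th divided differences of $\phi$ converge uniformly on $K$ if for every $\varepsilon>0$ there is $\delta>0$ with $|\phi[X]-\phi[Y]|<\varepsilon$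 whenever $X,Y$ are sets of $m+1$ distinct points of $K$ with $\operatorname{diam}(X\cup Y)<\delta$. For $\gamma=(f,g,h)$ this means it holds for each of $f,g,h$. For $X=\{x_0,\dots,x_m\}$, $P(X;\phi)$ denotes the Newton interpolation polynomial $\phi[x_0]+(x-x_0)\phi[x_0,x_1]+\cdots+(x-x_0)\cdots(x-x_{m-1})\phi[x_0,\dots,x_m]$, the unique polynomial of degree $\le m$ agreeing with $\phi$ on $X$. Discrete $A/V$ quantities: for $E\subseteq\mathbb{R}$, $\gamma=(f,g,h):E\to\mathbb{R}^3$, $X\subseteq E$ with $\#X=m+1$, $P_f=P(X;f)$, $P_g=P(X;g)$ and $a,b\in X$: $A[X,\gamma;a,b] = h(b)-h(a) - 2\int_a^b (P_f'P_g - P_g'P_f)$, $V[X,\gamma;a,b] = \operatorname{diam}(X)^{2m} + \operatorname{diam}(X)^m\int_a^b(|P_f'|+|P_g'|)$. $\gamma$ satisfies the discrete $A/V$ condition on $E$ if $A[X,\gamma;a,b]/V[X,\gamma;a,b]\to 0$ as $\operatorname{diam}X\to0$, over all $X\subseteq E$ with $\#X=m+1$ and $a,b\in X$ with $a<b$ (i.e. for every $\varepsilon>0$ there is $\delta>0$ such that $|A[X,\gamma;a,b]/V[X,\gamma;a,b]|<\varepsilon$ for all such $X,a,b$ with $\operatorname{diam}X<\delta$). *)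

theory Defs
  imports "HOL-Analysis.Analysis"
begin

definition Cm :: "nat \<Rightarrow> (real \<Rightarrow> real) \<Rightarrow> bool" where
  "Cm m f \<longleftrightarrow> (\<exists>D :: nat \<Rightarrow> real \<Rightarrow> real.
      D 0 = f \<and>
      (\<forall>k<m. \<forall>x. (D k has_real_derivative D (Suc k) x) (at x)) \<and>
      continuous_on UNIV (D m) \<and>
      bounded (range (D m)))"

definition abs_cont_on_interval :: "(real \<Rightarrow> real) \<Rightarrow> real \<Rightarrow> real \<Rightarrow> bool" where
  "abs_cont_on_interval \<phi> s t \<longleftrightarrow>
     (\<forall>\<epsilon>>0. \<exists>\<delta>>0. \<forall>(n::nat) (a::nat \<Rightarrow> real) b.
        (\<forall>i<n. s \<le> a i \<and> a i \<le> b i \<and> b i \<le> t) \<and>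
        (\<forall>i<n. \<forall>j<n. i \<noteq> j \<longrightarrow> b i \<le> a j \<or> b j \<le> a i) \<and>
        (\<Sum>i<n. b i - a i) < \<delta>
        \<longrightarrow> (\<Sum>i<n. \<bar>\<phi> (b i) - \<phi> (a i)\<bar>) < \<epsilon>)"

definition abs_cont :: "(real \<Rightarrow> real) \<Rightarrow> bool" where
  "abs_cont \<phi> \<longleftrightarrow> (\<forall>s t. s \<le> t \<longrightarrow> abs_cont_on_interval \<phi> s t)"

definition horizontal :: "(real \<Rightarrow> real) \<Rightarrow> (real \<Rightarrow> real) \<Rightarrow> (real \<Rightarrow> real) \<Rightarrow> bool" where
  "horizontal f g h \<longleftrightarrow> abs_cont f \<and> abs_cont g \<and> abs_cont h \<and>
     (AE x in lborel. f differentiable (at x) \<and> g differentiable (at x) \<and> h differentiable (at x) \<and>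
        deriv h x = 2 * (deriv f x * g x - f x * deriv g x))"

definition CmH :: "nat \<Rightarrow> real set \<Rightarrow> (real \<Rightarrow> real) \<Rightarrow> (real \<Rightarrow> real) \<Rightarrow> (real \<Rightarrow> real) \<Rightarrow> bool" where
  "CmH m K f g h \<longleftrightarrow> (\<exists>F G H. Cm m F \<and> Cm m G \<and> Cm m H \<and> horizontal F G H \<and>
      (\<forall>x\<in>K. F x = f x \<and> G x = g x \<and> H x = h x))"

fun divdiff :: "(real \<Rightarrow> real) \<Rightarrow> real list \<Rightarrow> real" where
  "divdiff \<phi> [] = 0"
| "divdiff \<phi> [x] = \<phi> x"
| "divdiff \<phi> (x # y # xs) =
     (divdiff \<phi> (y # xs) - divdiff \<phi> (butlast (x # y # xs))) / (last (y # xs) - x)"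

definition divdiff_set :: "(real \<Rightarrow> real) \<Rightarrow> real set \<Rightarrow> real" where
  "divdiff_set \<phi> X = divdiff \<phi> (sorted_list_of_set X)"

definition dd_unif_conv :: "nat \<Rightarrow> real set \<Rightarrow> (real \<Rightarrow> real) \<Rightarrow> bool" where
  "dd_unif_conv m K \<phi> \<longleftrightarrow>
     (\<forall>\<epsilon>>0. \<exists>\<delta>>0. \<forall>X Y. X \<subseteq> K \<and> Y \<subseteq> K \<and> finite X \<and> finite Y \<and>
        card X = m + 1 \<and> card Y = m + 1 \<and> diameter (X \<union> Y) < \<delta>
        \<longrightarrow> \<bar>divdiff_set \<phi> X - divdiff_set \<phi> Y\<bar> < \<epsilon>)"

definition newton_poly :: "real set \<Rightarrow> (real \<Rightarrow> real) \<Rightarrow> real \<Rightarrow> real" where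
  "newton_poly X \<phi> x =
     (let xs = sorted_list_of_set X in
      \<Sum>i<length xs. (\<Prod>j<i. (x - xs ! j)) * divdiff \<phi> (take (Suc i) xs))"

definition A_disc :: "real set \<Rightarrow> (real \<Rightarrow> real) \<Rightarrow> (real \<Rightarrow> real) \<Rightarrow> (real \<Rightarrow> real) \<Rightarrow> real \<Rightarrow> real \<Rightarrow> real" where
  "A_disc X f g h a b =
     h b - h a - 2 * integral {a..b}
       (\<lambda>t. deriv (newton_poly X f) t * newton_poly X g t - deriv (newton_poly X g) t * newton_poly X f t)"

definition V_disc :: "nat \<Rightarrow> real set \<Rightarrow> (real \<Rightarrow> real) \<Rightarrow> (real \<Rightarrow> real) \<Rightarrow> real \<Rightarrow> real \<Rightarrow> real" where
  "V_disc m X f g a b =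
     diameter X ^ (2 * m) + diameter X ^ m *
       integral {a..b} (\<lambda>t. \<bar>deriv (newton_poly X f) t\<bar> + \<bar>deriv (newton_poly X g) t\<bar>)"

definition discrete_AV :: "nat \<Rightarrow> real set \<Rightarrow> (real \<Rightarrow> real) \<Rightarrow> (real \<Rightarrow> real) \<Rightarrow> (real \<Rightarrow> real) \<Rightarrow> bool" where
  "discrete_AV m E f g h \<longleftrightarrow>
     (\<forall>\<epsilon>>0. \<exists>\<delta>>0. \<forall>X a b. X \<subseteq> E \<and> finite X \<and> card X = m + 1 \<and> a \<in> X \<and> b \<in> X \<and> a < b \<and>
        diameter X < \<delta> \<longrightarrow> \<bar>A_disc X f g h a b / V_disc m X f g a b\<bar> < \<epsilon>)"

end

theory Submission
  imports Defs "HOL-Computational_Algebra.Polynomial"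
begin

text \<open>
  For the necessity, \<open>f\<close> minus its interpolation polynomial on \<open>X\<close> has \<open>m + 1\<close> zeros, so by Rolle all its
  derivatives up to order \<open>m\<close> vanish somewhere in the hull of \<open>X\<close> and are controlled by the modulus of
  continuity of \<open>f\<^sup>(\<^sup>m\<^sup>)\<close>; integrating by parts then bounds the difference of the two areas by \<open>V\<close>.

  For the sufficiency, let \<open>N\<close> be the perfect part of \<open>K\<close>. Exchanging one node changes an interpolation
  polynomial by a product of linear factors times a difference of divided differences, so the
  interpolation polynomials converge to Whitney jets on \<open>N\<close>. On a gap \<open>(a, b)\<close> of \<open>K\<close> the jets of \<open>f\<close> and \<open>g\<close>
  are first joined by polynomials \<open>p\<close> and \<open>q\<close>. The discrete \<open>A/V\<close> condition says that the lift of \<open>(p, q)\<close>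
  misses \<open>h b - h a\<close> by at most \<open>\<epsilon> * (b - a)\<^sup>m * ((b - a)\<^sup>m + \<integral>(\<bar>p'\<bar> + \<bar>q'\<bar>))\<close>. If the integral dominates, the error
  is removed by adding to \<open>q\<close> a multiple of \<open>p'\<close> times a bump (or vice versa), which acts linearly on the
  area; otherwise by two fixed bumps of height \<open>\<surd>\<epsilon> * (b - a)\<^sup>m\<close>, which act quadratically. Either way the
  \<open>m\<close>-th derivatives change by a quantity tending to zero with the length of the gap.
\<close>

section \<open>Newton interpolation\<close>

text \<open>Rescaling a gap of length d to the unit interval multiplies m-th derivatives by d^m, so
  a correction with small m-th derivative on the gap must be small compared with l = d^m on the unit
  interval. A correction of relative size \<eta> changes the area by about \<eta> * l times the
  variation in the linear term and by \<eta>^2 * l^2 in the quadratic one. Up to the ratio of node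
  diameter to gap length these are the two summands of \<open>V_disc\<close>, so an error \<epsilon>
  * V can be removed at cost \<epsilon> in one regime and sqrt \<epsilon> in the other. No constant
  may depend on the gap. The constants come from compactness in spaces of polynomials of bounded
  degree, so each gap is first filled by polynomials whose degree is bounded in terms of m.
  Finiteness of the set of isolated points enters twice: every point of the perfect part stays a
  limit point of that part, and isolated points keep a uniform distance from the rest of K, so that
  short gaps have both ends in the perfect part.\<close>

abbreviation polyder :: "nat \<Rightarrow> real poly \<Rightarrow> real \<Rightarrow> real" where
  "polyder k p \<equiv> poly ((pderiv ^^ k) p)"

text \<open>Half of the height gained along [a, b] by a horizontal lift of the plane curve (p,
  q).\<close>

abbreviation area :: "real \<Rightarrow> real \<Rightarrow> real poly \<Rightarrow> real poly \<Rightarrow> real" where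
  "area a b p q \<equiv> integral {a..b} (\<lambda>t. poly (pderiv p) t * poly q t - poly (pderiv q) t * poly p t)"

abbreviation variation :: "real \<Rightarrow> real \<Rightarrow> real poly \<Rightarrow> real poly \<Rightarrow> real" where
  "variation a b p q \<equiv> integral {a..b} (\<lambda>t. \<bar>poly (pderiv p) t\<bar> + \<bar>poly (pderiv q) t\<bar>)"

text \<open>For \<open>u\<close> and \<open>v\<close> vanishing at \<open>a\<close> and \<open>b\<close>, half of the change of area from \<open>(p, q)\<close> to \<open>(p + u, q + v)\<close>.\<close>
abbreviation area_increment :: "real \<Rightarrow> real \<Rightarrow> real poly \<Rightarrow> real poly \<Rightarrow> real poly \<Rightarrow> real poly \<Rightarrow> real" where
  "area_increment a b p q u v \<equiv>
     integral {a..b} (\<lambda>t. poly (pderiv p) t * poly v t - poly u t * poly (pderiv q) t + poly (pderiv u) t * poly v t)"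

text \<open>The interpolant as an object of type \<open>poly\<close>, which gives access to degrees,
  coefficients and algebraic derivatives.\<close>

definition interp :: "real set \<Rightarrow> (real \<Rightarrow> real) \<Rightarrow> real poly" where
  "interp X \<phi> = (let xs = sorted_list_of_set X in
     \<Sum>i<length xs. smult (divdiff \<phi> (take (Suc i) xs)) (\<Prod>j<i. [:- xs ! j, 1:]))"

lemma newton_poly_eq_interp: "newton_poly X \<phi> = poly (interp X \<phi>)"
  by (rule ext) (simp add: newton_poly_def interp_def Let_def poly_sum poly_prod algebra_simps)

text \<open>Aitken-Neville recursion: if p interpolates on all entries but the first entry x, and q
  on all but the last entry l, then ((t - x) p - (t - l) q) / (l - x) interpolates on the whole
  list, and its coefficient of top degree obeys the recurrence that defines
  \<open>divdiff\<close>.\<close>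

lemma divdiff_leading_coeff:
  assumes "distinct xs" "xs \<noteq> []"
  shows "\<exists>p. degree p < length xs \<and> (\<forall>x\<in>set xs. poly p x = \<phi> x) \<and>
           coeff p (length xs - 1) = divdiff \<phi> xs"
  using assms
proof (induction \<phi> xs rule: divdiff.induct)
  case (1 \<phi>)
  then show ?case by simp
next
  case (2 \<phi> x)
  show ?case by (intro exI[of _ "[:\<phi> x:]"]) simp
next
  case (3 \<phi> x y xs)
  let ?zs = "x # y # xs"
  define l where "l = last (y # xs)"
  define n where "n = length xs"
  have app: "?zs = butlast ?zs @ [l]"
    unfolding l_def by (metis append_butlast_last_id last_ConsR list.distinct(1))
  have "distinct (butlast ?zs @ [l])" by (subst app[symmetric]) (rule 3(3))
  then have dbl: "distinct (butlast ?zs)" and lnot: "l \<notin> set (butlast ?zs)"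
    by (simp_all only: distinct_append) auto
  have lb: "length (butlast ?zs) = Suc n" by (simp add: n_def)
  have lx: "l \<noteq> x" using 3(3) unfolding l_def by (metis distinct.simps(2) last_in_set list.distinct(1))
  have "\<exists>p. degree p < length (y # xs) \<and> (\<forall>t\<in>set (y # xs). poly p t = \<phi> t) \<and>
      coeff p (length (y # xs) - 1) = divdiff \<phi> (y # xs)"
    using 3(1) 3(3) by simp
  then obtain p where p: "degree p \<le> n" "\<And>t. t \<in> set (y # xs) \<Longrightarrow> poly p t = \<phi> t"
     "coeff p n = divdiff \<phi> (y # xs)" unfolding n_def by (auto simp: less_Suc_eq_le)
  have "butlast ?zs \<noteq> []" by simp
  from 3(2)[OF dbl this, unfolded lb diff_Suc_1] obtain q where
    q: "degree q \<le> n" "\<And>t. t \<in> set (butlast ?zs) \<Longrightarrow> poly q t = \<phi> t"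
     "coeff q n = divdiff \<phi> (butlast ?zs)"
    using less_Suc_eq_le by blast
  define r where "r = smult (1 / (l - x)) ([:- x, 1:] * p - [:- l, 1:] * q)"
  have "degree ([:- x, 1:] * p) \<le> Suc n" using p(1) degree_mult_le[of "[:- x, 1:]" p] by simp
  moreover have "degree ([:- l, 1:] * q) \<le> Suc n" using q(1) degree_mult_le[of "[:- l, 1:]" q] by simp
  ultimately have dr: "degree r \<le> Suc n" unfolding r_def
    by (intro order_trans[OF degree_smult_le] degree_diff_le)
  have cr: "coeff r (Suc n) = divdiff \<phi> ?zs"
  proof -
    have "coeff p (Suc n) = 0" "coeff q (Suc n) = 0" using p(1) q(1) by (simp_all add: coeff_eq_0)
    then have "coeff r (Suc n) = (coeff p n - coeff q n) / (l - x)" by (simp add: r_def)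
    then show ?thesis by (simp only: divdiff.simps p(3) q(3) l_def)
  qed
  have "poly r t = \<phi> t" if "t \<in> set ?zs" for t
  proof -
    have rt: "poly r t = ((t - x) * poly p t - (t - l) * poly q t) / (l - x)"
      by (simp add: r_def add_divide_distrib diff_divide_distrib algebra_simps)
    have "t \<in> set (butlast ?zs @ [l])" using that by (subst app[symmetric])
    then have "t \<in> set (butlast ?zs) \<or> t = l" by (simp only: set_append) auto
    moreover have "t = x \<or> t \<in> set (y # xs)" using that by simp
    ultimately consider "t = x" | "t = l" | "t \<in> set (y # xs)" "t \<in> set (butlast ?zs)"
      by blast
    then show ?thesis
    proof cases
      case 1
      have "poly q x = \<phi> x" using q(2)[of x] by simp
      then have "(t - x) * poly p t - (t - l) * poly q t = (l - x) * \<phi> x"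
        using 1 by (simp add: algebra_simps)
      then show ?thesis unfolding rt using 1 lx by simp
    next
      case 2
      have "poly p l = \<phi> l" using p(2)[of l] unfolding l_def by (metis last_in_set list.distinct(1))
      then show ?thesis using rt 2 lx by simp
    next
      case 3
      show ?thesis unfolding rt p(2)[OF 3(1)] q(2)[OF 3(2)] using lx by (simp add: field_simps)
    qed
  qed
  then show ?case using dr cr unfolding n_def by (intro exI[of _ r]) auto
qed

text \<open>Take an interpolant q on one node more whose top coefficient is the divided difference.
  Subtracting the last Newton term kills that coefficient and keeps the values at the earlier nodes,
  so by uniqueness the previous partial sum remains.\<close>

lemma newton_interpolates:
  fixes \<phi> :: "real \<Rightarrow> real"
  assumes "distinct xs" "n < length xs"
  defines "P \<equiv> \<lambda>n. \<Sum>i<n. smult (divdiff \<phi> (take (Suc i) xs)) (\<Prod>j<i. [:- xs ! j, 1:])"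
  shows "degree (P (Suc n)) \<le> n \<and> (\<forall>x\<in>set (take (Suc n) xs). poly (P (Suc n)) x = \<phi> x) \<and>
    coeff (P (Suc n)) n = divdiff \<phi> (take (Suc n) xs)"
  using assms(2)
proof (induction n)
  case 0
  then obtain x ys where "xs = x # ys" by (cases xs) auto
  then show ?case by (simp add: P_def)
next
  case (Suc n)
  let ?ys = "take (Suc (Suc n)) xs"
  let ?M = "\<Prod>j<Suc n. [:- xs ! j, 1:]"
  have len: "length ?ys = Suc (Suc n)" using Suc.prems by simp
  have "distinct ?ys" "?ys \<noteq> []" using assms(1) Suc.prems by auto
  from divdiff_leading_coeff[OF this, of \<phi>] obtain q where
    q: "degree q \<le> Suc n" "\<And>x. x \<in> set ?ys \<Longrightarrow> poly q x = \<phi> x" "coeff q (Suc n) = divdiff \<phi> ?ys"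
    unfolding len by (auto simp: less_Suc_eq_le)
  have dM: "degree ?M = Suc n" by (subst degree_prod_eq_sum_degree) auto
  have "lead_coeff ?M = 1" by (simp add: lead_coeff_prod del: prod.lessThan_Suc)
  then have cM: "coeff ?M (Suc n) = 1" using dM by simp
  define r where "r = q - smult (divdiff \<phi> ?ys) ?M"
  have "degree r \<le> Suc n" unfolding r_def
    using q(1) dM by (intro degree_diff_le order_trans[OF degree_smult_le]) auto
  moreover have "coeff r (Suc n) = 0" using q(3) cM by (simp add: r_def)
  ultimately have dr: "degree r \<le> n"
    by (metis coeff_0_degree_minus_1 diff_Suc_1 le_SucE order_refl leading_coeff_0_iff degree_0 le0)
  have IH: "degree (P (Suc n)) \<le> n" "\<And>x. x \<in> set (take (Suc n) xs) \<Longrightarrow> poly (P (Suc n)) x = \<phi> x"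
    using Suc by auto
  have cardX: "card (set (take (Suc n) xs)) = Suc n"
    using assms(1) Suc.prems by (simp add: distinct_card)
  have "r = P (Suc n)"
  proof (rule poly_eqI_degree[of "set (take (Suc n) xs)"])
    fix x assume x: "x \<in> set (take (Suc n) xs)"
    then obtain j where j: "j < Suc n" "x = xs ! j" by (auto simp: in_set_conv_nth)
    have "poly ?M x = 0" using j by (auto simp: poly_prod simp del: prod.lessThan_Suc)
    moreover have "x \<in> set ?ys" using x set_take_subset_set_take[of "Suc n" "Suc (Suc n)" xs] by auto
    ultimately show "poly r x = poly (P (Suc n)) x" using q(2) IH(2)[OF x] by (simp add: r_def)
  qed (use dr IH(1) cardX in auto)
  then have "q = P (Suc (Suc n))" unfolding r_def P_def by (simp add: algebra_simps)
  then show ?case using q by simp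
qed

lemma interp_props:
  assumes "finite X" "X \<noteq> {}"
  shows degree_interp: "degree (interp X \<phi>) < card X"
    and poly_interp: "x \<in> X \<Longrightarrow> poly (interp X \<phi>) x = \<phi> x"
    and coeff_interp: "coeff (interp X \<phi>) (card X - 1) = divdiff_set \<phi> X"
proof -
  let ?xs = "sorted_list_of_set X"
  have c: "card X > 0" using assms by (simp add: card_gt_0_iff)
  have "interp X \<phi> = (\<Sum>i<Suc (card X - 1). smult (divdiff \<phi> (take (Suc i) ?xs)) (\<Prod>j<i. [:- ?xs ! j, 1:]))"
    using c by (simp add: interp_def Let_def)
  moreover have "card X - 1 < length ?xs" using c by simp
  ultimately have *: "degree (interp X \<phi>) \<le> card X - 1 \<and> (\<forall>x\<in>set (take (Suc (card X - 1)) ?xs). poly (interp X \<phi>) x = \<phi> x) \<and>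
    coeff (interp X \<phi>) (card X - 1) = divdiff \<phi> (take (Suc (card X - 1)) ?xs)"
    using newton_interpolates[of ?xs "card X - 1" \<phi>] by (simp del: sum.lessThan_Suc)
  have "take (Suc (card X - 1)) ?xs = ?xs" using c by simp
  then show "degree (interp X \<phi>) < card X" "x \<in> X \<Longrightarrow> poly (interp X \<phi>) x = \<phi> x"
    "coeff (interp X \<phi>) (card X - 1) = divdiff_set \<phi> X"
    using * c assms(1) unfolding divdiff_set_def by auto
qed

lemma interp_unique:
  assumes "finite X" "X \<noteq> {}" "degree p < card X" "\<And>x. x \<in> X \<Longrightarrow> poly p x = \<phi> x"
  shows "p = interp X \<phi>"
  using assms by (intro poly_eqI_degree[of X]) (auto simp: poly_interp degree_interp)

lemma interp_cong:
  assumes "finite X" "X \<noteq> {}" "\<And>x. x \<in> X \<Longrightarrow> \<phi> x = \<psi> x"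
  shows "interp X \<phi> = interp X \<psi>"
  using assms by (intro interp_unique) (auto simp: poly_interp degree_interp)

lemma higher_pderiv_diff: "(pderiv ^^ n) (p - q) = (pderiv ^^ n) p - (pderiv ^^ n) (q :: real poly)"
  by (induction n arbitrary: p q) (simp_all add: pderiv_diff del: funpow.simps add: funpow_Suc_right)

text \<open>Leibniz rule for a factor whose second derivative vanishes. At k = 0 the truncated
  \<open>k - 1\<close> is harmless because of the factor \<open>of_nat k\<close>.\<close>

lemma higher_pderiv_linear_mult:
  "(pderiv ^^ k) ([:- z, 1:] * q) = [:- z, 1:] * (pderiv ^^ k) q + of_nat k * (pderiv ^^ (k - 1)) (q :: real poly)"
proof (induction k)
  case (Suc k)
  have lin: "pderiv ([:- z, 1:] * r) = [:- z, 1:] * pderiv r + r" for r :: "real poly"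
    by (simp only: pderiv_mult) (simp add: pderiv_pCons)
  have "pderiv (of_nat k * (pderiv ^^ (k - 1)) q) = of_nat k * (pderiv ^^ k) q"
    by (cases k) (simp_all only: of_nat_poly, simp_all add: pderiv_smult)
  then show ?case using Suc.IH lin[of "(pderiv ^^ k) q"]
    by (simp only: funpow.simps o_apply pderiv_add) (simp add: algebra_simps)
qed simp

text \<open>Each factor contributes at most \<open>d\<close> and each derivative at most the number of factors over \<open>d\<close>.\<close>
lemma higher_pderiv_prod_bound:
  assumes "finite Z" "\<And>z. z \<in> Z \<Longrightarrow> \<bar>t - z\<bar> \<le> d" "k \<le> card Z"
  shows "\<bar>polyder k (\<Prod>z\<in>Z. [:- z, 1:]) t\<bar> \<le> real (card Z) ^ k * d ^ (card Z - k)"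
  using assms
proof (induction Z arbitrary: k rule: finite_induct)
  case empty
  then show ?case by simp
next
  case (insert z Z)
  let ?q = "\<Prod>z\<in>Z. [:- z, 1:]" and ?n = "card Z"
  have d: "0 \<le> d" "\<bar>t - z\<bar> \<le> d" using insert.prems(1)[of z] by (auto intro: order_trans[OF abs_ge_zero])
  have dq: "degree ?q = ?n" by (subst degree_prod_eq_sum_degree) auto
  \<comment> \<open>For k = n + 1 the induction hypothesis says nothing, but there the derivative of
    the shorter product is zero.\<close>
  have 1: "\<bar>polyder k ?q t\<bar> * d \<le> real ?n ^ k * d ^ (Suc ?n - k)"
  proof (cases "k \<le> ?n")
    case True
    then have "\<bar>polyder k ?q t\<bar> \<le> real ?n ^ k * d ^ (?n - k)" using insert by auto
    then have "\<bar>polyder k ?q t\<bar> * d \<le> real ?n ^ k * d ^ (?n - k) * d" using d by (intro mult_right_mono)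
    then show ?thesis using True by (simp add: Suc_diff_le mult_ac)
  next
    case False
    then have "k > degree ?q" using dq by simp
    then have "(pderiv ^^ k) ?q = 0"
      by (intro poly_eqI) (simp add: coeff_higher_pderiv coeff_eq_0 )
    then show ?thesis using d by simp
  qed
  have 2: "real k * \<bar>polyder (k - 1) ?q t\<bar> \<le> real k * real ?n ^ (k - 1) * d ^ (Suc ?n - k)"
  proof (cases k)
    case (Suc l)
    then have "l \<le> ?n" using insert by auto
    then have "\<bar>polyder l ?q t\<bar> \<le> real ?n ^ l * d ^ (?n - l)" using insert by auto
    then show ?thesis using Suc by (simp add: mult_left_mono mult.assoc)
  qed simp
  \<comment> \<open>The first two terms of the binomial expansion of (n + 1)^k.\<close>
  have 3: "real ?n ^ k + real k * real ?n ^ (k - 1) \<le> real (Suc ?n) ^ k"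
  proof (cases k)
    case (Suc l)
    show ?thesis unfolding Suc
    proof (induction l)
      case (Suc l)
      have "real ?n ^ Suc (Suc l) + real (Suc (Suc l)) * real ?n ^ Suc l \<le>
          real ?n * (real ?n ^ Suc l + real (Suc l) * real ?n ^ l) + real ?n ^ Suc l"
        by (simp add: algebra_simps)
      also have "\<dots> \<le> real ?n * real (Suc ?n) ^ Suc l + real (Suc ?n) ^ Suc l"
        using Suc by (intro add_mono mult_left_mono power_mono) auto
      finally show ?case by (simp add: algebra_simps)
    qed simp
  qed simp
  have "\<bar>polyder k (\<Prod>z\<in>insert z Z. [:- z, 1:]) t\<bar> =
      \<bar>(t - z) * polyder k ?q t + real k * polyder (k - 1) ?q t\<bar>"
    using insert by (simp add: higher_pderiv_linear_mult[simplified] of_nat_poly algebra_simps)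
  also have "\<dots> \<le> \<bar>t - z\<bar> * \<bar>polyder k ?q t\<bar> + real k * \<bar>polyder (k - 1) ?q t\<bar>"
    by (rule order_trans[OF abs_triangle_ineq]) (simp add: abs_mult)
  also have "\<dots> \<le> d * \<bar>polyder k ?q t\<bar> + real k * \<bar>polyder (k - 1) ?q t\<bar>"
    using d by (intro add_right_mono mult_right_mono) auto
  also have "\<dots> \<le> real ?n ^ k * d ^ (Suc ?n - k) + real k * real ?n ^ (k - 1) * d ^ (Suc ?n - k)"
    using 1 2 by (simp add: mult.commute)
  also have "\<dots> = (real ?n ^ k + real k * real ?n ^ (k - 1)) * d ^ (Suc ?n - k)" by (simp add: algebra_simps)
  also have "\<dots> \<le> real (Suc ?n) ^ k * d ^ (Suc ?n - k)" using 3 d by (intro mult_right_mono) auto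
  finally show ?case using insert by simp
qed

section \<open>Whitney jets as limits of interpolation polynomials\<close>

lemma higher_pderiv_pcompose_linear:
  "(pderiv ^^ k) (pcompose p [:b, c:]) = smult (c ^ k) (pcompose ((pderiv ^^ k) p) [:b, c :: real:])"
proof (induction k)
  case (Suc k)
  have "pderiv (pcompose q [:b, c:]) = smult c (pcompose (pderiv q) [:b, c:])" for q
    unfolding pderiv_pcompose by (simp add: pderiv_pCons)
  then show ?case using Suc by (simp add: pderiv_smult mult.commute)
qed simp

text \<open>A polynomial of degree at most m is determined by its jet at x, so jet bounds of the
  scale e * d^(m - k) persist up to distance d. Each use of the mean value theorem adds one more
  copy of the bound, which produces the factor m + 1.\<close>

lemma poly_taylor_bound:
  fixes q :: "real poly"
  assumes "degree q \<le> m" "\<And>k. k \<le> m \<Longrightarrow> \<bar>polyder k q x\<bar> \<le> e * d ^ (m - k)"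
    and "\<bar>t - x\<bar> \<le> d" "k \<le> m"
  shows "\<bar>polyder k q t\<bar> \<le> real (m + 1) * e * d ^ (m - k)"
  using assms
proof (induction m arbitrary: q k t)
  case 0
  from 0(1) obtain c where "q = [:c:]" using degree_eq_zeroE by blast
  then show ?case using 0(2)[of 0] 0(4) by simp
next
  case (Suc m)
  have d: "0 \<le> d" using Suc.prems(3) by linarith
  have IH: "\<bar>polyder l (pderiv q) s\<bar> \<le> real (m + 1) * e * d ^ (m - l)"
    if "l \<le> m" "\<bar>s - x\<bar> \<le> d" for l s
  proof (rule Suc.IH[OF _ _ that(2) that(1)])
    show "degree (pderiv q) \<le> m" using Suc.prems(1) by (simp add: degree_pderiv)
    show "\<bar>polyder j (pderiv q) x\<bar> \<le> e * d ^ (m - j)" if "j \<le> m" for j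
      using Suc.prems(2)[of "Suc j"] that by (simp add: funpow_swap1)
  qed
  have e: "0 \<le> e" using Suc.prems(2)[of "Suc m"] by (auto intro: order_trans[OF abs_ge_zero])
  show ?case
  proof (cases k)
    case 0
    have "\<exists>\<xi>. \<bar>\<xi> - x\<bar> \<le> d \<and> \<bar>poly q t - poly q x\<bar> = \<bar>t - x\<bar> * \<bar>poly (pderiv q) \<xi>\<bar>"
    proof (cases "t = x")
      case True
      then show ?thesis using d by (intro exI[of _ x]) simp
    next
      case False
      then consider "t < x" | "x < t" by linarith
      then show ?thesis
      proof cases
        case 1
        then obtain \<xi> where \<xi>: "t < \<xi>" "\<xi> < x" "poly q x - poly q t = (x - t) * poly (pderiv q) \<xi>"
          using poly_MVT by blast
        have "\<bar>poly q t - poly q x\<bar> = \<bar>(x - t) * poly (pderiv q) \<xi>\<bar>"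
          unfolding \<xi>(3)[symmetric] by (rule abs_minus_commute)
        then show ?thesis using \<xi>(1,2) 1 Suc.prems(3) by (intro exI[of _ \<xi>]) (simp add: abs_mult)
      next
        case 2
        then obtain \<xi> where \<xi>: "x < \<xi>" "\<xi> < t" "poly q t - poly q x = (t - x) * poly (pderiv q) \<xi>"
          using poly_MVT by blast
        then show ?thesis using 2 Suc.prems(3) by (intro exI[of _ \<xi>]) (simp add: abs_mult)
      qed
    qed
    then obtain \<xi> where \<xi>: "\<bar>\<xi> - x\<bar> \<le> d" "\<bar>poly q t - poly q x\<bar> = \<bar>t - x\<bar> * \<bar>poly (pderiv q) \<xi>\<bar>" by blast
    have "\<bar>poly q t\<bar> \<le> \<bar>poly q x\<bar> + \<bar>t - x\<bar> * \<bar>poly (pderiv q) \<xi>\<bar>" using \<xi>(2) by linarith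
    also have "\<dots> \<le> e * d ^ Suc m + d * (real (m + 1) * e * d ^ m)"
      using Suc.prems(2)[of 0] Suc.prems(3) IH[OF _ \<xi>(1), of 0] d by (intro add_mono mult_mono) auto
    finally show ?thesis using 0 by (simp add: algebra_simps)
  next
    case k: (Suc l)
    have "\<bar>polyder k q t\<bar> \<le> real (m + 1) * e * d ^ (Suc m - k)"
      using IH[of l t] Suc.prems(3,4) k by (simp add: funpow_swap1)
    also have "\<dots> \<le> real (Suc m + 1) * e * d ^ (Suc m - k)"
      using d e by (intro mult_right_mono) auto
    finally show ?thesis .
  qed
qed

section \<open>Exchange of interpolation nodes\<close>

lemma abs_diff_le_diameter:
  "finite X \<Longrightarrow> x \<in> X \<Longrightarrow> y \<in> X \<Longrightarrow> \<bar>x - y :: real\<bar> \<le> diameter X"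
  by (metis diameter_bounded_bound dist_real_def finite_imp_bounded)

lemma diameter_le_twice_radius:
  fixes X :: "real set"
  assumes "x \<in> X" "\<And>z. z \<in> X \<Longrightarrow> \<bar>x - z\<bar> \<le> d"
  shows "diameter X \<le> 2 * d"
proof (rule diameter_le)
  fix y z assume "y \<in> X" "z \<in> X"
  then show "norm (y - z) \<le> 2 * d" using assms(2)[of y] assms(2)[of z] by simp
qed (use assms(1) in auto)

lemma diameter_pos:
  assumes "finite X" "card X = Suc m" "m > 0"
  shows "diameter (X :: real set) > 0"
proof -
  obtain x y where "x \<in> X" "y \<in> X" "x \<noteq> y"
    using assms by (metis card_le_Suc0_iff_eq not_less_eq_eq Suc_leI le_0_eq less_numeral_extra(3) Suc_le_mono)
  then show ?thesis using abs_diff_le_diameter[OF assms(1), of x y] by auto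
qed

text \<open>The difference has degree at most m and vanishes at the m shared nodes, so it is a
  multiple of their node polynomial; comparing coefficients of degree m identifies the
  factor.\<close>

lemma interp_swap:
  assumes "finite X" "card X = Suc m" "finite Y" "card Y = Suc m" "card (X \<inter> Y) = m"
    and "\<And>z. z \<in> X \<inter> Y \<Longrightarrow> \<bar>t - z\<bar> \<le> d" "\<bar>divdiff_set \<phi> X - divdiff_set \<phi> Y\<bar> \<le> e" "k \<le> m"
  shows "\<bar>polyder k (interp X \<phi>) t - polyder k (interp Y \<phi>) t\<bar> \<le> e * (real m ^ k * d ^ (m - k))"
proof -
  have ne: "X \<noteq> {}" "Y \<noteq> {}" using assms by auto
  define D where "D = interp X \<phi> - interp Y \<phi>"
  define c where "c = divdiff_set \<phi> X - divdiff_set \<phi> Y"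
  let ?M = "\<Prod>z\<in>X \<inter> Y. [:- z, 1:]"
  have dM: "degree ?M = m" by (subst degree_prod_eq_sum_degree) (auto simp: assms)
  have "lead_coeff ?M = 1" by (simp add: lead_coeff_prod)
  then have cM: "coeff ?M m = 1" using dM by simp
  have cD: "coeff D m = c" using coeff_interp[OF assms(1) ne(1), of \<phi>] coeff_interp[OF assms(3) ne(2), of \<phi>] assms
    by (simp add: D_def c_def)
  have dD: "degree D \<le> m" unfolding D_def
    using degree_interp[OF assms(1) ne(1), of \<phi>] degree_interp[OF assms(3) ne(2), of \<phi>] assms
    by (intro degree_diff_le) auto
  define r where "r = D - smult c ?M"
  have "degree r \<le> m" unfolding r_def using dD dM by (intro degree_diff_le order_trans[OF degree_smult_le]) auto
  moreover have "coeff r m = 0" by (simp add: r_def cD cM)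
  \<comment> \<open>For m = 0 no polynomial has degree below m, hence the alternative
    \<open>r = 0\<close>.\<close>
  ultimately have dr: "degree r < m \<or> r = 0" by (metis le_neq_implies_less leading_coeff_0_iff)
  have rz: "poly r z = 0" if "z \<in> X \<inter> Y" for z
    using that poly_interp[OF assms(1) ne(1)] poly_interp[OF assms(3) ne(2)] assms(1)
    by (auto simp: r_def D_def poly_prod)
  have "r = 0"
  proof (rule ccontr)
    assume "r \<noteq> 0"
    then have "degree r < m" using dr by simp
    then have "r = 0" using rz assms(5) by (intro poly_eqI_degree[of "X \<inter> Y"]) auto
    then show False using \<open>r \<noteq> 0\<close> by simp
  qed
  then have "D = smult c ?M" by (simp add: r_def)
  then have "\<bar>polyder k D t\<bar> = \<bar>c\<bar> * \<bar>polyder k ?M t\<bar>"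
    by (simp add: higher_pderiv_smult abs_mult)
  also have "\<dots> \<le> e * (real m ^ k * d ^ (m - k))"
    using higher_pderiv_prod_bound[of "X \<inter> Y" t d k] assms by (intro mult_mono) (auto simp: c_def)
  finally show ?thesis by (simp add: D_def higher_pderiv_diff)
qed

text \<open>Nodes of X are exchanged for nodes of Y one at a time, at most m + 1 times. The
  intermediate node sets mix X and Y, so \<open>close\<close> has to range over all (m + 1)-subsets
  of the union.\<close>

lemma interp_close:
  assumes "finite X" "card X = Suc m" "finite Y" "card Y = Suc m" "k \<le> m" "0 \<le> e"
    and "\<And>z. z \<in> X \<union> Y \<Longrightarrow> \<bar>t - z\<bar> \<le> d"
    and close: "\<And>Z W. Z \<subseteq> X \<union> Y \<Longrightarrow> W \<subseteq> X \<union> Y \<Longrightarrow> card Z = Suc m \<Longrightarrow> card W = Suc m \<Longrightarrow>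
           \<bar>divdiff_set \<phi> Z - divdiff_set \<phi> W\<bar> \<le> e"
  shows "\<bar>polyder k (interp X \<phi>) t - polyder k (interp Y \<phi>) t\<bar> \<le>
     real (Suc m) * (e * (real m ^ k * d ^ (m - k)))"
proof -
  let ?B = "e * (real m ^ k * d ^ (m - k))"
  obtain x where "x \<in> X" using assms(2) by fastforce
  then have d: "0 \<le> d" using assms(7)[of x] by auto
  have B: "0 \<le> ?B" using d assms by simp
  have main: "\<bar>polyder k (interp Z \<phi>) t - polyder k (interp Y \<phi>) t\<bar> \<le> real (card (Z - Y)) * ?B"
    if "Z \<subseteq> X \<union> Y" "card Z = Suc m" for Z
    using that
  proof (induction "card (Z - Y)" arbitrary: Z)
    case 0
    have fin: "finite Z" using 0(2) assms finite_subset by blast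
    then have "Z \<subseteq> Y" using 0 by simp
    then have "Z = Y" using 0 assms by (simp add: card_subset_eq)
    then show ?case by simp
  next
    case (Suc n)
    have fin: "finite Z" using Suc(3) assms finite_subset by blast
    from Suc(2) obtain z where z: "z \<in> Z" "z \<notin> Y"
      by (metis DiffE card_gt_0_iff ex_in_conv zero_less_Suc)
    \<comment> \<open>Equal cardinalities guarantee a node of Y to bring in for the one that is
      removed.\<close>
    have "card (Y - Z) = card (Z - Y)" using fin assms Suc.prems
      by (simp add: card_Diff_subset_Int Int_commute)
    then obtain y where y: "y \<in> Y" "y \<notin> Z" using Suc(2)
      by (metis DiffE card_gt_0_iff ex_in_conv zero_less_Suc)
    define W where "W = insert y (Z - {z})"
    have W: "W \<subseteq> X \<union> Y" "card W = Suc m" "finite W" using fin y z Suc.prems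
      by (auto simp: W_def)
    have WY: "W - Y = (Z - Y) - {z}" using y by (auto simp: W_def)
    then have cW: "card (W - Y) = n" using Suc(2) z fin by simp
    have ZW: "Z \<inter> W = Z - {z}" using y z by (auto simp: W_def)
    have "\<bar>polyder k (interp Z \<phi>) t - polyder k (interp W \<phi>) t\<bar> \<le> ?B"
      by (rule interp_swap) (use fin W Suc.prems assms close ZW z in auto)
    moreover have "\<bar>polyder k (interp W \<phi>) t - polyder k (interp Y \<phi>) t\<bar> \<le> real n * ?B"
      using Suc(1)[of W] cW W by simp
    moreover have "real (card (Z - Y)) * ?B = ?B + real n * ?B" unfolding Suc(2)[symmetric] by (simp add: algebra_simps)
    ultimately show ?case by linarith
  qed
  have "card (X - Y) \<le> Suc m" using assms by (metis Diff_subset card_mono)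
  then have "real (card (X - Y)) * ?B \<le> real (Suc m) * ?B" using B by (intro mult_right_mono) auto
  then show ?thesis using main[of X] assms by (meson Un_upper1 order_trans)
qed

section \<open>Node sets near limit points, and jets\<close>

lemma islimpt_superset_card:
  fixes x :: real
  assumes "x islimpt N" "0 < r" "F \<subseteq> N \<inter> ball x r" "finite F" "card F \<le> n"
  obtains X where "F \<subseteq> X" "X \<subseteq> N \<inter> ball x r" "finite X" "card X = n"
proof -
  have "infinite (N \<inter> ball x r)" using assms(1,2) by (simp add: islimpt_eq_infinite_ball)
  then have "infinite (N \<inter> ball x r - F)" using assms(4) by simp
  then obtain T where T: "finite T" "card T = n - card F" "T \<subseteq> N \<inter> ball x r - F"
    using infinite_arbitrarily_large by blast
  show thesis
  proof (rule that[of "F \<union> T"])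
    have "F \<inter> T = {}" using T by auto
    then show "card (F \<union> T) = n" using T assms by (simp add: card_Un_disjoint)
  qed (use T assms in auto)
qed

text \<open>The remaining nodes are taken from the ball of radius 2 d about x, where d is the
  distance of x and y. Jets at x and y can then be compared through a single interpolant at the
  scale d.\<close>

lemma common_nodes:
  assumes m: "m > 0" and lim: "\<And>x. x \<in> N \<Longrightarrow> x islimpt N" and xy: "x \<in> N" "y \<in> N" "x \<noteq> y"
  obtains X where "X \<subseteq> N" "finite X" "card X = Suc m" "x \<in> X" "y \<in> X" "\<bar>x - y\<bar> \<le> diameter X" "diameter X \<le> 4 * \<bar>x - y\<bar>"
proof -
  define d where "d = \<bar>x - y\<bar>"
  have d: "d > 0" using xy by (simp add: d_def)
  have "{x, y} \<subseteq> N \<inter> ball x (2 * d)" using xy d by (auto simp: d_def dist_real_def)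
  moreover have "card {x, y} \<le> Suc m" using m by (simp add: card_insert_if)
  ultimately obtain X where X: "{x, y} \<subseteq> X" "X \<subseteq> N \<inter> ball x (2 * d)" "finite X" "card X = Suc m"
    using islimpt_superset_card[OF lim[OF xy(1)], of "2 * d" "{x, y}" "Suc m"] d by auto
  have "\<bar>x - z\<bar> \<le> 2 * d" if "z \<in> X" for z using subsetD[OF X(2) that] by (simp add: dist_real_def)
  then have "diameter X \<le> 4 * d" using diameter_le_twice_radius[of x X "2 * d"] X(1) by simp
  moreover have "d \<le> diameter X" unfolding d_def using abs_diff_le_diameter[OF X(3), of x y] X(1) by auto
  ultimately show thesis using X by (intro that[of X]) (auto simp: d_def)
qed

text \<open>Expanded at 0 and then shifted, so that derivatives at x can be read off from
  coefficients.\<close>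

definition taylor_poly :: "nat \<Rightarrow> (nat \<Rightarrow> real \<Rightarrow> real) \<Rightarrow> real \<Rightarrow> real poly" where
  "taylor_poly m J x = pcompose (\<Sum>j\<le>m. monom (J j x / fact j) j) [:- x, 1:]"

lemma poly_higher_pderiv_taylor_poly:
  assumes "k \<le> m"
  shows "polyder k (taylor_poly m J x) x = J k x"
proof -
  have "coeff (\<Sum>j\<le>m. monom (J j x / fact j) j) k = J k x / fact k"
    using assms by (simp add: coeff_sum if_distrib cong: if_cong)
  then have "coeff ((pderiv ^^ k) (\<Sum>j\<le>m. monom (J j x / fact j) j)) 0 = J k x"
    by (simp add: coeff_higher_pderiv pochhammer_fact[symmetric])
  then show ?thesis
    by (simp add: taylor_poly_def higher_pderiv_pcompose_linear poly_pcompose poly_0_coeff_0)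
qed

lemma degree_taylor_poly: "degree (taylor_poly m J x) \<le> m"
proof -
  have "degree (\<Sum>j\<le>m. monom (J j x / fact j) j) \<le> m"
    by (intro degree_sum_le) (auto intro: order_trans[OF degree_monom_le])
  then show ?thesis unfolding taylor_poly_def
    by (intro order_trans[OF degree_pcompose_le]) simp
qed

lemma top_pderiv_taylor_poly: "polyder m (taylor_poly m J a) t = J m a"
proof -
  have "degree ((pderiv ^^ m) (taylor_poly m J a)) = 0"
    using degree_taylor_poly[of m J a] by (simp add: degree_higher_pderiv)
  then obtain c where "(pderiv ^^ m) (taylor_poly m J a) = [:c:]" using degree_eq_zeroE by blast
  then show ?thesis using poly_higher_pderiv_taylor_poly[of m m J a] by simp
qed

abbreviation jet_close :: "nat \<Rightarrow> real set \<Rightarrow> (real \<Rightarrow> real) \<Rightarrow> (nat \<Rightarrow> real \<Rightarrow> real) \<Rightarrow> real \<Rightarrow> real \<Rightarrow> bool" where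
  "jet_close m N \<phi> J e \<delta> \<equiv> \<forall>X x t k. X \<subseteq> N \<and> finite X \<and> card X = Suc m \<and> diameter X < \<delta> \<and> x \<in> X \<and> k \<le> m \<and>
     \<bar>t - x\<bar> \<le> diameter X \<longrightarrow>
     \<bar>polyder k (interp X \<phi>) t - polyder k (taylor_poly m J x) t\<bar> \<le> e * diameter X ^ (m - k)"

text \<open>Stated through interpolants on small node sets containing x, because this form leads
  both to Whitney's compatibility condition (\<open>jet_whitney\<close>) and to the polynomials that
  occur in \<open>A_disc\<close>. The remainder e * diam^(m - k) has the scale of Whitney's
  extension theorem.\<close>

definition jet_of :: "nat \<Rightarrow> real set \<Rightarrow> (real \<Rightarrow> real) \<Rightarrow> (nat \<Rightarrow> real \<Rightarrow> real) \<Rightarrow> bool" where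
  "jet_of m N \<phi> J \<longleftrightarrow> (\<forall>x\<in>N. J 0 x = \<phi> x) \<and>
     (\<forall>e>0. \<exists>\<delta>>0. jet_close m N \<phi> J e \<delta>)"

text \<open>For node sets containing x and shrinking to x, the derivatives of the interpolants at x
  are Cauchy, and their limits form the jet. Letting only one of two node sets shrink in the Cauchy
  estimate compares a fixed interpolant with the Taylor polynomial.\<close>

lemma jet_of_exists:
  assumes m: "m > 0" and lim: "\<And>x. x \<in> N \<Longrightarrow> x islimpt N" and dd: "dd_unif_conv m N \<phi>"
  obtains J where "jet_of m N \<phi> J"
proof -
  have "\<exists>X. X \<subseteq> N \<inter> ball x (1 / Suc n) \<and> x \<in> X \<and> finite X \<and> card X = Suc m" if "x \<in> N" for x n
    using islimpt_superset_card[OF lim[OF that], of "1 / Suc n" "{x}" "Suc m"] that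
    by (metis IntI One_nat_def Suc_le_mono card.empty card.insert centre_in_ball empty_iff empty_subsetI finite.emptyI
        finite.insertI insert_subset le0 of_nat_0_less_iff zero_less_Suc zero_less_divide_1_iff)
  then obtain S where S: "\<And>x n. x \<in> N \<Longrightarrow> S x n \<subseteq> N \<inter> ball x (1 / Suc n) \<and> x \<in> S x n \<and> finite (S x n) \<and> card (S x n) = Suc m"
    by metis
  define a where "a k x n = polyder k (interp (S x n) \<phi>) x" for k x n
  \<comment> \<open>Absorbs the m + 1 exchanges and the factor m^k <= (m + 1)^m of
    \<open>interp_close\<close>.\<close>
  define C where "C = real (Suc m) * real (Suc m) ^ m"
  have C: "C > 0" by (simp add: C_def)
  have key: "\<exists>\<delta>>0. \<forall>x\<in>N. \<forall>X Y d. \<forall>k\<le>m. X \<subseteq> N \<inter> cball x d \<and> Y \<subseteq> N \<inter> cball x d \<and> finite X \<and> finite Y \<and>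
       card X = Suc m \<and> card Y = Suc m \<and> x \<in> X \<and> x \<in> Y \<and> d < \<delta> \<longrightarrow>
       \<bar>polyder k (interp X \<phi>) x - polyder k (interp Y \<phi>) x\<bar> \<le> e * d ^ (m - k)"
    if "e > 0" for e
  proof -
    have "e / C > 0" using that C by simp
    then have "\<exists>\<delta>>0. \<forall>X Y. X \<subseteq> N \<and> Y \<subseteq> N \<and> finite X \<and> finite Y \<and>
        card X = m + 1 \<and> card Y = m + 1 \<and> diameter (X \<union> Y) < \<delta> \<longrightarrow> \<bar>divdiff_set \<phi> X - divdiff_set \<phi> Y\<bar> < e / C"
      using dd unfolding dd_unif_conv_def by blast
    then obtain \<delta> where \<delta>: "\<delta> > 0" and dd': "\<forall>X Y. X \<subseteq> N \<and> Y \<subseteq> N \<and> finite X \<and> finite Y \<and>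
        card X = m + 1 \<and> card Y = m + 1 \<and> diameter (X \<union> Y) < \<delta> \<longrightarrow> \<bar>divdiff_set \<phi> X - divdiff_set \<phi> Y\<bar> < e / C"
      by blast
    show ?thesis
    \<comment> \<open>All mixed node sets lie within distance d of x, so their unions have diameter
      at most 2 d.\<close>
    proof (intro exI[of _ "\<delta> / 2"] conjI ballI allI impI)
      fix x X Y d k
      assume x: "x \<in> N" and k: "k \<le> m" and XY: "X \<subseteq> N \<inter> cball x d \<and> Y \<subseteq> N \<inter> cball x d \<and> finite X \<and> finite Y \<and>
       card X = Suc m \<and> card Y = Suc m \<and> x \<in> X \<and> x \<in> Y \<and> d < \<delta> / 2"
      have d0: "0 \<le> d" using XY by auto
      have dist: "\<bar>x - z\<bar> \<le> d" if "z \<in> X \<union> Y" for z using XY that by (auto simp: dist_real_def)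
      have "\<bar>polyder k (interp X \<phi>) x - polyder k (interp Y \<phi>) x\<bar> \<le>
         real (Suc m) * (e / C * (real m ^ k * d ^ (m - k)))"
      proof (rule interp_close)
        fix Z W assume ZW: "Z \<subseteq> X \<union> Y" "W \<subseteq> X \<union> Y" "card Z = Suc m" "card W = Suc m"
        have fin: "finite Z" "finite W" using ZW XY by (meson finite_Un finite_subset)+
        obtain z where z: "z \<in> Z" using ZW by fastforce
        have "diameter (Z \<union> W) \<le> 2 * d"
        proof (rule diameter_le)
          fix y z assume "y \<in> Z \<union> W" "z \<in> Z \<union> W"
          then have "y \<in> X \<union> Y" "z \<in> X \<union> Y" using ZW by blast+
          then show "norm (y - z) \<le> 2 * d" using dist[of y] dist[of z] by simp
        qed (use z in auto)
        then have "diameter (Z \<union> W) < \<delta>" using XY by linarith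
        moreover have "Z \<subseteq> N" "W \<subseteq> N" using ZW XY by blast+
        ultimately show "\<bar>divdiff_set \<phi> Z - divdiff_set \<phi> W\<bar> \<le> e / C"
          using ZW fin dd' by (simp add: less_imp_le)
      qed (use XY k that C dist in auto)
      also have "\<dots> \<le> real (Suc m) * (e / C * (real (Suc m) ^ m * d ^ (m - k)))"
      proof -
        have "real m ^ k \<le> real (Suc m) ^ k" by (intro power_mono) auto
        also have "\<dots> \<le> real (Suc m) ^ m" using k by (intro power_increasing) auto
        finally show ?thesis using that C d0 by (intro mult_left_mono mult_right_mono) auto
      qed
      also have "\<dots> = e * d ^ (m - k)" using C by (simp add: C_def field_simps)
      finally show "\<bar>polyder k (interp X \<phi>) x - polyder k (interp Y \<phi>) x\<bar> \<le> e * d ^ (m - k)" .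
    qed (use \<delta> in auto)
  qed
  have small: "\<exists>n0. \<forall>n\<ge>n0. S x n \<subseteq> N \<inter> cball x d" if "d > 0" "x \<in> N" for d x
  proof -
    obtain n0 where n0: "1 / Suc n0 < d" using \<open>d > 0\<close> nat_approx_posE by metis
    show ?thesis
    proof (intro exI[of _ n0] allI impI)
      fix n assume "n \<ge> n0"
      then have "1 / Suc n \<le> 1 / Suc n0" by (simp add: frac_le)
      then have "ball x (1 / Suc n) \<subseteq> cball x d" using n0 by (auto simp: dist_real_def)
      then show "S x n \<subseteq> N \<inter> cball x d" using S[OF \<open>x \<in> N\<close>, of n] by blast
    qed
  qed
  define J where "J k x = lim (a k x)" for k x
  have lim_a: "a k x \<longlonglongrightarrow> J k x" if x: "x \<in> N" and k: "k \<le> m" for k x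
  proof -
    have "Cauchy (a k x)"
    proof (rule metric_CauchyI)
      fix e :: real assume "e > 0"
      then obtain \<delta> where \<delta>: "\<delta> > 0" and \<delta>': "\<forall>x\<in>N. \<forall>X Y d. \<forall>k\<le>m. X \<subseteq> N \<inter> cball x d \<and> Y \<subseteq> N \<inter> cball x d \<and> finite X \<and> finite Y \<and>
       card X = Suc m \<and> card Y = Suc m \<and> x \<in> X \<and> x \<in> Y \<and> d < \<delta> \<longrightarrow>
       \<bar>polyder k (interp X \<phi>) x - polyder k (interp Y \<phi>) x\<bar> \<le> e / 2 * d ^ (m - k)"
        using key[of "e / 2"] by auto
      define d where "d = min 1 (\<delta> / 2)"
      have d: "0 < d" "d \<le> 1" "d < \<delta>" using \<delta> by (auto simp: d_def)
      obtain n0 where n0: "\<And>n. n \<ge> n0 \<Longrightarrow> S x n \<subseteq> N \<inter> cball x d" using small[OF d(1) x] by blast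
      show "\<exists>M. \<forall>n\<ge>M. \<forall>n'\<ge>M. dist (a k x n) (a k x n') < e"
      proof (intro exI[of _ n0] allI impI)
        fix n n' assume "n \<ge> n0" "n' \<ge> n0"
        then have "\<bar>a k x n - a k x n'\<bar> \<le> e / 2 * d ^ (m - k)" unfolding a_def
          using n0 S[OF x] d x k by (intro \<delta>'[rule_format, OF x k]) blast
        also have "\<dots> \<le> e / 2 * 1" using d \<open>e > 0\<close> by (intro mult_left_mono power_le_one) auto
        also have "\<dots> < e" using \<open>e > 0\<close> by simp
        finally show "dist (a k x n) (a k x n') < e" by (simp add: dist_real_def)
      qed
    qed
    then show ?thesis unfolding J_def by (simp add: Cauchy_convergent convergent_LIMSEQ_iff[symmetric])
  qed
  have J0: "J 0 x = \<phi> x" if "x \<in> N" for x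
  proof -
    have "a 0 x n = \<phi> x" for n using S[OF that, of n] by (auto simp: a_def intro!: poly_interp)
    then have "a 0 x = (\<lambda>_. \<phi> x)" by (rule ext)
    then show ?thesis unfolding J_def by (simp add: limI)
  qed
  have "\<exists>\<delta>>0. jet_close m N \<phi> J e \<delta>"
    if "e > 0" for e
  proof -
    \<comment> \<open>\<open>poly_taylor_bound\<close> costs a factor m + 1 when passing from x to
      t.\<close>
    let ?e = "e / real (m + 1)"
    have "?e > 0" using that by simp
    from key[OF this] obtain \<delta> where \<delta>: "\<delta> > 0" and \<delta>': "\<forall>x\<in>N. \<forall>X Y d. \<forall>k\<le>m. X \<subseteq> N \<inter> cball x d \<and> Y \<subseteq> N \<inter> cball x d \<and> finite X \<and> finite Y \<and>
       card X = Suc m \<and> card Y = Suc m \<and> x \<in> X \<and> x \<in> Y \<and> d < \<delta> \<longrightarrow>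
       \<bar>polyder k (interp X \<phi>) x - polyder k (interp Y \<phi>) x\<bar> \<le> ?e * d ^ (m - k)"
      by (elim exE conjE) (rule that)
    show ?thesis
    proof (intro exI[of _ \<delta>] conjI allI impI)
      fix X x t k
      assume H: "X \<subseteq> N \<and> finite X \<and> card X = Suc m \<and> diameter X < \<delta> \<and> x \<in> X \<and> k \<le> m \<and> \<bar>t - x\<bar> \<le> diameter X"
      define d where "d = diameter X"
      have d: "d > 0" using diameter_pos H m by (auto simp: d_def)
      have x: "x \<in> N" using H by auto
      have Xd: "X \<subseteq> N \<inter> cball x d" using H abs_diff_le_diameter[of X] by (auto simp: dist_real_def d_def)
      obtain n0 where n0: "\<And>n. n \<ge> n0 \<Longrightarrow> S x n \<subseteq> N \<inter> cball x d" using small[OF d x] by blast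
      have der: "\<bar>polyder j (interp X \<phi>) x - J j x\<bar> \<le> ?e * d ^ (m - j)" if j: "j \<le> m" for j
      proof (rule tendsto_upperbound)
        show "(\<lambda>n. \<bar>polyder j (interp X \<phi>) x - a j x n\<bar>) \<longlonglongrightarrow> \<bar>polyder j (interp X \<phi>) x - J j x\<bar>"
          by (intro tendsto_intros lim_a x j)
        show "\<forall>\<^sub>F n in sequentially. \<bar>polyder j (interp X \<phi>) x - a j x n\<bar> \<le> ?e * d ^ (m - j)"
          unfolding eventually_sequentially
        proof (intro exI[of _ n0] allI impI)
          fix n assume "n \<ge> n0"
          then show "\<bar>polyder j (interp X \<phi>) x - a j x n\<bar> \<le> ?e * d ^ (m - j)" unfolding a_def
            using n0 S[OF x] H Xd by (intro \<delta>'[rule_format, OF x j]) (auto simp: d_def)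
        qed
      qed simp
      have "\<bar>polyder k (interp X \<phi> - taylor_poly m J x) t\<bar> \<le> real (m + 1) * ?e * d ^ (m - k)"
      proof (rule poly_taylor_bound[where x = x])
        have "degree (interp X \<phi>) \<le> m" using degree_interp[of X \<phi>] H by fastforce
        then show "degree (interp X \<phi> - taylor_poly m J x) \<le> m" using degree_taylor_poly by (intro degree_diff_le)
        show "\<bar>polyder j (interp X \<phi> - taylor_poly m J x) x\<bar> \<le> ?e * d ^ (m - j)" if "j \<le> m" for j
          using der[OF that] by (simp add: higher_pderiv_diff poly_higher_pderiv_taylor_poly that)
      qed (use H d_def in auto)
      then show "\<bar>polyder k (interp X \<phi>) t - polyder k (taylor_poly m J x) t\<bar> \<le> e * diameter X ^ (m - k)"
        by (simp add: higher_pderiv_diff d_def)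
    qed (use \<delta> in auto)
  qed
  then have "jet_of m N \<phi> J" unfolding jet_of_def using J0 by blast
  then show thesis by (rule that)
qed

section \<open>Polynomial perturbations correcting the area\<close>

text \<open>Differentiation lowers the multiplicity of a zero by at most one.\<close>

lemma higher_pderiv_flat:
  fixes p :: "real poly"
  assumes "[:- c, 1:] ^ Suc n dvd p" "k \<le> n"
  shows "polyder k p c = 0"
  using assms
proof (induction k arbitrary: n p)
  case 0
  then show ?case by (auto simp: dvd_def)
next
  case (Suc k)
  then obtain n' where n: "n = Suc n'" by (cases n) auto
  obtain q where "p = [:- c, 1:] ^ Suc n * q" using Suc.prems(1) by (auto simp: dvd_def)
  then have "pderiv p = [:- c, 1:] ^ n * (smult (of_nat (Suc n)) (pderiv [:- c, 1:]) * q + [:- c, 1:] * pderiv q)"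
    by (simp add: pderiv_mult pderiv_power_Suc algebra_simps del: power_Suc)
      (simp add: algebra_simps)
  then have "[:- c, 1:] ^ Suc n' dvd pderiv p" unfolding n by (rule dvdI)
  then show ?case using Suc.IH[of n' "pderiv p"] Suc.prems(2) n by (simp add: funpow_swap1)
qed

section \<open>Uniform estimates for polynomials of bounded degree on the unit interval\<close>

lemma poly_eq_sum_bound:
  fixes p :: "real poly"
  assumes "degree p \<le> n"
  shows "poly p t = (\<Sum>i\<le>n. coeff p i * t ^ i)"
proof -
  have "(\<Sum>i\<le>degree p. coeff p i * t ^ i) = (\<Sum>i\<le>n. coeff p i * t ^ i)"
    using assms by (intro sum.mono_neutral_left) (auto simp: coeff_eq_0)
  then show ?thesis by (simp add: poly_altdef)
qed

text \<open>A positive definite quadratic form on a finite-dimensional space has a positive minimum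
  on the unit sphere, here that of the coefficient norm; homogeneity extends the bound to all
  polynomials.\<close>

lemma weighted_square_integral_ge:
  fixes w :: "real poly"
  assumes w: "\<And>t. 0 \<le> t \<Longrightarrow> t \<le> 1 \<Longrightarrow> 0 \<le> poly w t" "\<And>t. 0 < t \<Longrightarrow> t < 1 \<Longrightarrow> 0 < poly w t"
  shows "\<exists>c>0. \<forall>p. degree p \<le> n \<longrightarrow>
    c * (\<Sum>i\<le>n. \<bar>coeff p i\<bar>)\<^sup>2 \<le> integral {0..1} (\<lambda>t. poly w t * (poly p t)\<^sup>2)"
proof -
  define pol where "pol v t = (\<Sum>i\<le>n. v i * t ^ i)" for v :: "nat \<Rightarrow> real" and t :: real
  define Q where "Q v = integral {0..1} (\<lambda>t. poly w t * (pol v t)\<^sup>2)" for v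
  \<comment> \<open>Coefficient vectors are functions on nat that vanish beyond n, so the sphere is
    a closed subset of a product of compact sets.\<close>
  define S where "S = PiE UNIV (\<lambda>i. if i \<le> n then {-1..1} else {0::real}) \<inter> {v. (\<Sum>i\<le>n. \<bar>v i\<bar>) = 1}"
  have cont: "continuous_on UNIV (\<lambda>v::nat \<Rightarrow> real. v i)" for i
    by (rule continuous_on_product_coordinates)
  have "compact (PiE UNIV (\<lambda>i. if i \<le> n then {-1..1} else {0::real}))"
  proof -
    have "compactin (product_topology (\<lambda>_. euclidean) UNIV) (PiE UNIV (\<lambda>i. if i \<le> n then {-1..1} else {0::real}))"
      by (subst compactin_PiE) auto
    then show ?thesis by (simp add: euclidean_product_topology)
  qed
  moreover have "closed {v :: nat \<Rightarrow> real. (\<Sum>i\<le>n. \<bar>v i\<bar>) = 1}"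
    by (intro closed_Collect_eq continuous_intros cont)
  ultimately have compS: "compact S" unfolding S_def by (rule compact_Int_closed)
  have "(\<lambda>i. if i = 0 then 1 else 0) \<in> S" by (auto simp: S_def)
  then have neS: "S \<noteq> {}" by blast
  \<comment> \<open>In this form continuity in v is that of a finite polynomial expression in the
    coordinates.\<close>
  have Qsum: "Q v = (\<Sum>i\<le>n. \<Sum>j\<le>n. v i * v j * integral {0..1} (\<lambda>t. poly w t * t ^ (i + j)))" for v
  proof -
    have "poly w t * (pol v t)\<^sup>2 = (\<Sum>i\<le>n. \<Sum>j\<le>n. v i * v j * (poly w t * t ^ (i + j)))" for t
      by (simp add: pol_def power2_eq_square sum_product sum_distrib_left power_add mult_ac)
    then have "Q v = integral {0..1} (\<lambda>t. \<Sum>i\<le>n. \<Sum>j\<le>n. v i * v j * (poly w t * t ^ (i + j)))"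
      by (simp add: Q_def)
    also have "\<dots> = (\<Sum>i\<le>n. \<Sum>j\<le>n. v i * v j * integral {0..1} (\<lambda>t. poly w t * t ^ (i + j)))"
      by (subst integral_sum; (intro integrable_continuous_real continuous_intros)?) (auto intro!: sum.cong simp: integral_sum continuous_intros integrable_continuous_real)
    finally show ?thesis .
  qed
  have "continuous_on S Q" unfolding Qsum
    by (intro continuous_intros continuous_on_subset[OF cont]) auto
  then obtain v0 where v0: "v0 \<in> S" "\<And>v. v \<in> S \<Longrightarrow> Q v0 \<le> Q v"
    using continuous_attains_inf[OF compS neS] by blast
  define P where "P v = (\<Sum>i\<le>n. monom (v i) i)" for v :: "nat \<Rightarrow> real"
  have polP: "pol v t = poly (P v) t" for v t by (simp add: pol_def P_def poly_sum poly_monom)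
  have cP: "coeff (P v) i = v i" if "i \<le> n" for v i using that by (simp add: P_def coeff_sum)
  have nonneg: "0 \<le> poly w t * (pol v t)\<^sup>2" if "t \<in> {0..1}" for v t using w(1) that by simp
  have contQ: "continuous_on {0..1} (\<lambda>t. poly w t * (pol v t)\<^sup>2)" for v
    unfolding pol_def by (intro continuous_intros)
  have Qnn: "0 \<le> Q v" for v unfolding Q_def by (intro integral_nonneg integrable_continuous_real contQ nonneg)
  \<comment> \<open>Otherwise the polynomial with coefficients \<open>v0\<close> would have
    infinitely many roots in (0, 1), hence \<open>v0\<close> would vanish and not lie on the
    sphere.\<close>
  have "Q v0 \<noteq> 0"
  proof
    assume "Q v0 = 0"
    then have z: "\<forall>t\<in>{0..1}. poly w t * (pol v0 t)\<^sup>2 = 0" unfolding Q_def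
      using integral_cbox_eq_0_iff[of 0 "1::real" "\<lambda>t. poly w t * (pol v0 t)\<^sup>2"] contQ nonneg by auto
    have "poly (P v0) t = 0" if "t \<in> {0<..<1}" for t
    proof -
      have "poly w t > 0" using that w(2) by simp
      then show ?thesis using bspec[OF z, of t] that polP by auto
    qed
    then have "{0<..<1} \<subseteq> {t. poly (P v0) t = 0}" by blast
    moreover have "infinite {0<..<1::real}" by (rule infinite_Ioo) simp
    ultimately have "infinite {t. poly (P v0) t = 0}" using finite_subset by blast
    then have "P v0 = 0" using poly_roots_finite by blast
    then have "\<And>i. i \<le> n \<Longrightarrow> v0 i = 0" using cP by (metis coeff_0)
    then have "(\<Sum>i\<le>n. \<bar>v0 i\<bar>) = 0" by simp
    then show False using v0(1) by (simp add: S_def)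
  qed
  then have Q0: "Q v0 > 0" using Qnn[of v0] by linarith
  show ?thesis
  proof (intro exI[of _ "Q v0"] conjI Q0 allI impI)
    fix p :: "real poly" assume dp: "degree p \<le> n"
    define s where "s = (\<Sum>i\<le>n. \<bar>coeff p i\<bar>)"
    have pp: "poly p t = pol (coeff p) t" for t unfolding pol_def by (rule poly_eq_sum_bound[OF dp])
    show "Q v0 * (\<Sum>i\<le>n. \<bar>coeff p i\<bar>)\<^sup>2 \<le> integral {0..1} (\<lambda>t. poly w t * (poly p t)\<^sup>2)"
    proof (cases "s = 0")
      case True
      then show ?thesis using Qnn[of "coeff p"] by (simp add: s_def[symmetric] Q_def pp)
    next
      case False
      then have s: "s > 0" by (simp add: s_def less_le sum_nonneg)
      define v where "v i = coeff p i / s" for i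
      have "v \<in> S"
      proof -
        have "\<bar>coeff p i\<bar> \<le> s" if "i \<le> n" for i
          unfolding s_def using that by (intro member_le_sum) auto
        then have "\<bar>v i\<bar> \<le> 1" if "i \<le> n" for i
          using that s by (simp add: v_def)
        then have "v i \<in> {-1..1}" if "i \<le> n" for i
          using that by (simp add: abs_le_iff)
        moreover have "v i = 0" if "\<not> i \<le> n" for i using that dp by (simp add: v_def coeff_eq_0)
        moreover have "(\<Sum>i\<le>n. \<bar>v i\<bar>) = 1"
          using s by (simp add: v_def sum_divide_distrib[symmetric] s_def[symmetric])
        ultimately show ?thesis by (auto simp: S_def)
      qed
      then have "Q v0 * s\<^sup>2 \<le> Q v * s\<^sup>2" using v0(2) by (intro mult_right_mono) auto
      also have "Q v * s\<^sup>2 = Q (coeff p)"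
      proof -
        have "pol (coeff p) t = s * pol v t" for t
          using s by (simp add: pol_def v_def sum_distrib_left)
        then have "Q (coeff p) = integral {0..1} (\<lambda>t. (poly w t * (pol v t)\<^sup>2) * s\<^sup>2)"
          by (simp add: Q_def power_mult_distrib mult_ac)
        then show ?thesis by (simp add: Q_def)
      qed
      finally show ?thesis by (simp add: Q_def pp s_def)
    qed
  qed
qed

text \<open>Expansion in monomials: each k-th derivative of r * t^i is bounded on [0, 1], and only
  finitely many i occur.\<close>

lemma higher_pderiv_coeff_bound:
  fixes r :: "real poly"
  shows "\<exists>C>0. \<forall>p t. degree p \<le> n \<longrightarrow> t \<in> {0..1} \<longrightarrow>
    \<bar>polyder k (r * p) t\<bar> \<le> C * (\<Sum>i\<le>n. \<bar>coeff p i\<bar>)"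
proof -
  have "\<exists>B. \<forall>t\<in>{0..1}. \<bar>polyder k (r * monom 1 i) t\<bar> \<le> B" for i
  proof -
    have "compact ((\<lambda>t. polyder k (r * monom 1 i) t) ` {0..1::real})"
      by (intro compact_continuous_image continuous_intros) auto
    then show ?thesis by (auto dest!: compact_imp_bounded simp: bounded_iff)
  qed
  then obtain B where B: "\<And>i t. t \<in> {0..1} \<Longrightarrow> \<bar>polyder k (r * monom 1 i) t\<bar> \<le> B i" by metis
  have B0: "0 \<le> B i" for i using B[of 0 i] by (auto intro: order_trans[OF abs_ge_zero])
  define C where "C = 1 + (\<Sum>i\<le>n. B i)"
  have C: "C > 0" using B0 by (simp add: C_def add_pos_nonneg sum_nonneg)
  have BC: "B i \<le> C" if "i \<le> n" for i
    unfolding C_def using that B0 member_le_sum[of i "{..n}" B] by auto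
  show ?thesis
  proof (intro exI[of _ C] conjI C allI impI)
    fix p :: "real poly" and t :: real assume dp: "degree p \<le> n" and t: "t \<in> {0..1}"
    have "p = (\<Sum>i\<le>n. smult (coeff p i) (monom 1 i))"
      using dp poly_as_sum_of_monoms'[of p n] by (simp add: smult_monom)
    then have "r * p = (\<Sum>i\<le>n. smult (coeff p i) (r * monom 1 i))"
      by (metis (no_types, lifting) mult_smult_right sum.cong sum_distrib_left)
    then have "polyder k (r * p) t = (\<Sum>i\<le>n. coeff p i * polyder k (r * monom 1 i) t)"
      by (simp add: higher_pderiv_sum higher_pderiv_smult poly_sum)
    also have "\<bar>\<dots>\<bar> \<le> (\<Sum>i\<le>n. \<bar>coeff p i\<bar> * C)"
      by (rule order_trans[OF sum_abs], rule sum_mono)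
        (auto simp: abs_mult intro!: mult_left_mono order_trans[OF B[OF t] BC])
    finally show "\<bar>polyder k (r * p) t\<bar> \<le> C * (\<Sum>i\<le>n. \<bar>coeff p i\<bar>)"
      by (simp add: sum_distrib_left mult.commute)
  qed
qed

section \<open>Corrections of the area by polynomials flat at both ends of the unit interval\<close>

definition bump :: "nat \<Rightarrow> real poly" where "bump m = [:0, 1, -1:] ^ Suc m"

lemma poly_bump: "poly (bump m) t = (t * (1 - t)) ^ Suc m"
  by (simp add: bump_def algebra_simps)

text \<open>Adding a flat polynomial changes no derivative of order at most m at 0 or 1. Expressed
  by divisibility, this property passes to products at once; the factor is written
  \<open>[:- 0, 1:]\<close> to match \<open>higher_pderiv_flat\<close>.\<close>

definition flat :: "nat \<Rightarrow> real poly \<Rightarrow> bool" where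
  "flat m u \<longleftrightarrow> [:- 0, 1:] ^ Suc m dvd u \<and> [:- 1, 1:] ^ Suc m dvd u"

lemma flat_bump: "flat m (bump m)"
proof -
  have "[:- 0, 1:] dvd [:0, 1, -1 :: real:]" by (rule dvdI[of _ _ "[:1, -1:]"]) simp
  moreover have "[:- 1, 1:] dvd [:0, 1, -1 :: real:]" by (rule dvdI[of _ _ "[:0, -1:]"]) simp
  ultimately show ?thesis unfolding flat_def bump_def by (metis dvd_power_same)
qed

lemma flat_mult: "flat m u \<Longrightarrow> flat m (u * v)" and flat_mult': "flat m u \<Longrightarrow> flat m (v * u)"
  by (auto simp: flat_def)

lemma flat_smult: "flat m u \<Longrightarrow> flat m (smult c u)"
  by (auto simp: flat_def intro: dvd_smult)

lemma flat_0: "flat m 0" by (simp add: flat_def)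

text \<open>Take v = s * bump * p'. The integral of p' v is then s * J with J >= c * M^2, where M is
  the coefficient norm of p', whereas the integral of |p'| is at most C2 * M. So s is of size e * l
  / M, and M cancels in the bound for v. The factor 4 arises because height is twice the area and
  the area changes by twice \<open>area_increment\<close>.\<close>

lemma linear_area_correction:
  "\<exists>C>0. \<forall>p l e \<Delta>. degree p \<le> n \<longrightarrow> 0 \<le> e \<longrightarrow> 0 \<le> l \<longrightarrow> 0 < integral {0..1} (\<lambda>t. \<bar>poly (pderiv p) t\<bar>) \<longrightarrow>
      \<bar>\<Delta>\<bar> \<le> 4 * e * l * integral {0..1} (\<lambda>t. \<bar>poly (pderiv p) t\<bar>) \<longrightarrow>
      (\<exists>v. flat m v \<and> 4 * integral {0..1} (\<lambda>t. poly (pderiv p) t * poly v t) = \<Delta> \<and>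
        (\<forall>t\<in>{0..1}. \<bar>polyder m v t\<bar> \<le> C * e * l))"
proof -
  have "0 \<le> poly (bump m) t" if "0 \<le> t" "t \<le> 1" for t using that by (simp add: poly_bump)
  moreover have "0 < poly (bump m) t" if "0 < t" "t < 1" for t using that by (simp add: poly_bump)
  ultimately obtain c where c: "c > 0" "\<And>p. degree p \<le> n \<Longrightarrow>
    c * (\<Sum>i\<le>n. \<bar>coeff p i\<bar>)\<^sup>2 \<le> integral {0..1} (\<lambda>t. poly (bump m) t * (poly p t)\<^sup>2)"
    using weighted_square_integral_ge[of "bump m" n] by blast
  obtain C1 where C1: "C1 > 0" "\<And>p t. degree p \<le> n \<Longrightarrow> t \<in> {0..1} \<Longrightarrow>
    \<bar>polyder m (bump m * p) t\<bar> \<le> C1 * (\<Sum>i\<le>n. \<bar>coeff p i\<bar>)"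
    using higher_pderiv_coeff_bound[of n m "bump m"] by blast
  obtain C2 where C2: "C2 > 0" "\<And>p t. degree p \<le> n \<Longrightarrow> t \<in> {0..1} \<Longrightarrow>
    \<bar>polyder 0 ((1::real poly) * p) t\<bar> \<le> C2 * (\<Sum>i\<le>n. \<bar>coeff p i\<bar>)"
    using higher_pderiv_coeff_bound[of n 0 1] by blast
  show ?thesis
  proof (intro exI[of _ "C2 * C1 / c"] conjI allI impI)
    show "C2 * C1 / c > 0" using C1 C2 c by simp
    fix p :: "real poly" and l e \<Delta> :: real
    define I where "I = integral {0..1} (\<lambda>t. \<bar>poly (pderiv p) t\<bar>)"
    assume dp: "degree p \<le> n" and e: "0 \<le> e" and l: "0 \<le> l" and I0: "0 < integral {0..1} (\<lambda>t. \<bar>poly (pderiv p) t\<bar>)"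
      and \<Delta>: "\<bar>\<Delta>\<bar> \<le> 4 * e * l * integral {0..1} (\<lambda>t. \<bar>poly (pderiv p) t\<bar>)"
    note I = I0[folded I_def] and \<Delta> = \<Delta>[folded I_def]
    define P where "P = pderiv p"
    have dP: "degree P \<le> n" using dp by (simp add: P_def degree_pderiv)
    define M where "M = (\<Sum>i\<le>n. \<bar>coeff P i\<bar>)"
    define J where "J = integral {0..1} (\<lambda>t. poly (bump m) t * (poly P t)\<^sup>2)"
    have "I \<le> integral {0..1} (\<lambda>t::real. C2 * M)" unfolding I_def
      using C2(2)[OF dP] by (intro integral_le integrable_continuous_real continuous_intros) (auto simp: M_def P_def)
    then have IM: "I \<le> C2 * M" by simp
    then have M: "M > 0" using I C2(1) by (metis dual_order.strict_trans1 zero_less_mult_pos)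
    have J: "c * M\<^sup>2 \<le> J" unfolding M_def J_def by (rule c(2)[OF dP])
    have "0 < c * M\<^sup>2" using c(1) M by simp
    then have J0: "J > 0" using J by linarith
    define s where "s = \<Delta> / (4 * J)"
    have "\<bar>s\<bar> = \<bar>\<Delta>\<bar> / (4 * J)" using J0 by (simp add: s_def)
    also have "\<dots> \<le> (4 * e * l * (C2 * M)) / (4 * (c * M\<^sup>2))"
    proof (rule frac_le)
      show "\<bar>\<Delta>\<bar> \<le> 4 * e * l * (C2 * M)"
        by (rule order_trans[OF \<Delta>]) (use e l IM in \<open>intro mult_left_mono, auto\<close>)
    qed (use c M J e l C2 in auto)
    also have "\<dots> = e * l * C2 / (c * M)" using M c by (simp add: power2_eq_square field_simps)
    finally have s: "\<bar>s\<bar> \<le> e * l * C2 / (c * M)" .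
    show "\<exists>v. flat m v \<and> 4 * integral {0..1} (\<lambda>t. poly (pderiv p) t * poly v t) = \<Delta> \<and>
        (\<forall>t\<in>{0..1}. \<bar>polyder m v t\<bar> \<le> C2 * C1 / c * e * l)"
    proof (intro exI[of _ "smult s (bump m * P)"] conjI ballI)
      show "flat m (smult s (bump m * P))" by (intro flat_smult flat_mult flat_bump)
      have "(\<lambda>t. poly (pderiv p) t * poly (smult s (bump m * P)) t) = (\<lambda>t. s * (poly (bump m) t * (poly P t)\<^sup>2))"
        by (auto simp: P_def power2_eq_square)
      then have "integral {0..1} (\<lambda>t. poly (pderiv p) t * poly (smult s (bump m * P)) t) = s * J"
        by (simp add: J_def)
      then show "4 * integral {0..1} (\<lambda>t. poly (pderiv p) t * poly (smult s (bump m * P)) t) = \<Delta>"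
        using J0 by (simp add: s_def)
    next
      fix t :: real assume t: "t \<in> {0..1}"
      have "\<bar>polyder m (smult s (bump m * P)) t\<bar> = \<bar>s\<bar> * \<bar>polyder m (bump m * P) t\<bar>"
        by (simp add: higher_pderiv_smult abs_mult)
      also have "\<dots> \<le> (e * l * C2 / (c * M)) * (C1 * M)"
        using s C1(2)[OF dP t] by (intro mult_mono) (auto simp: M_def)
      also have "\<dots> = C2 * C1 / c * e * l" using M by simp
      finally show "\<bar>polyder m (smult s (bump m * P)) t\<bar> \<le> C2 * C1 / c * e * l" .
    qed
  qed
qed

lemma integral_pderiv:
  fixes p :: "real poly"
  assumes "a \<le> b"
  shows "integral {a..b} (\<lambda>t. poly (pderiv p) t) = poly p b - poly p a"
proof (rule integral_unique, rule fundamental_theorem_of_calculus[OF assms])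
  fix x assume "x \<in> {a..b}"
  show "(poly p has_vector_derivative poly (pderiv p) x) (at x within {a..b})"
    unfolding has_real_derivative_iff_has_vector_derivative[symmetric]
    by (rule DERIV_subset[OF poly_DERIV]) simp
qed

text \<open>Since (t w^2)' = w^2 + 2 t w w' and t w^2 vanishes at 0 and 1, the integral is minus
  half that of w^2. Hence w and t w have a nonzero cross term and can serve as the two bumps of the
  quadratic correction.\<close>

lemma integral_bump_cross_neg:
  "integral {0..1} (\<lambda>t. poly (pderiv (bump m)) t * poly ([:0, 1:] * bump m) t) < 0"
proof -
  let ?w = "bump m"
  have 0: "integral {0..1} (\<lambda>t. poly (pderiv ([:0, 1:] * ?w\<^sup>2)) t) = (0::real)"
    by (subst integral_pderiv) (simp_all add: poly_bump)
  have "poly (pderiv ([:0, 1:] * ?w\<^sup>2)) t =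
     2 * (poly (pderiv ?w) t * poly ([:0, 1:] * ?w) t) + (poly ?w t)\<^sup>2" for t
    by (simp add: pderiv_mult pderiv_pCons power2_eq_square algebra_simps)
  then have "0 = integral {0..1} (\<lambda>t. 2 * (poly (pderiv ?w) t * poly ([:0, 1:] * ?w) t) + (poly ?w t)\<^sup>2)"
    using 0 by simp
  also have "\<dots> = 2 * integral {0..1} (\<lambda>t. poly (pderiv ?w) t * poly ([:0, 1:] * ?w) t) + integral {0..1} (\<lambda>t. (poly ?w t)\<^sup>2)"
    by (subst integral_add) (auto intro!: integrable_continuous_real continuous_intros)
  finally have *: "2 * integral {0..1} (\<lambda>t. poly (pderiv ?w) t * poly ([:0, 1:] * ?w) t) = - integral {0..1} (\<lambda>t. (poly ?w t)\<^sup>2)"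
    by linarith
  have "integral {0..1} (\<lambda>t. (poly ?w t)\<^sup>2) \<noteq> 0"
  proof
    assume "integral {0..1} (\<lambda>t. (poly ?w t)\<^sup>2) = 0"
    then have "\<forall>t\<in>{0..1}. (poly ?w t)\<^sup>2 = 0"
      by (subst (asm) integral_eq_0_iff) (auto intro!: continuous_intros)
    from bspec[OF this, of "1/2"] show False by (simp add: poly_bump)
  qed
  moreover have "integral {0..1} (\<lambda>t. (poly ?w t)\<^sup>2) \<ge> 0"
    by (intro integral_nonneg integrable_continuous_real continuous_intros) auto
  ultimately show ?thesis using * by linarith
qed

text \<open>The sign of the perturbation is free in the quadratic term of the enclosed area, so it can be
  chosen such that the linear term does not work against the quadratic one.\<close>
lemma quadratic_area_correction:
  "\<exists>C>0. \<forall>p q l e \<Delta>. 0 \<le> e \<longrightarrow> 0 < l \<longrightarrow> \<bar>\<Delta>\<bar> \<le> 2 * e * l\<^sup>2 \<longrightarrow>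
      (\<exists>u v. flat m u \<and> flat m v \<and>
        4 * area_increment 0 1 p q u v = \<Delta> \<and>
        (\<forall>t\<in>{0..1}. \<bar>polyder m u t\<bar> \<le> C * sqrt e * l \<and> \<bar>polyder m v t\<bar> \<le> C * sqrt e * l))"
proof -
  define w where "w = bump m"
  define z where "z = [:0, 1:] * bump m"
  define \<kappa> where "\<kappa> = integral {0..1} (\<lambda>t. poly (pderiv w) t * poly z t)"
  have \<kappa>: "\<kappa> < 0" unfolding \<kappa>_def w_def z_def by (rule integral_bump_cross_neg)
  obtain Cw where Cw: "Cw > 0" "\<And>p t. degree p \<le> 1 \<Longrightarrow> t \<in> {0..1} \<Longrightarrow>
    \<bar>polyder m (bump m * p) t\<bar> \<le> Cw * (\<Sum>i\<le>1. \<bar>coeff p i\<bar>)"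
    using higher_pderiv_coeff_bound[of 1 m "bump m"] by blast
  have bw: "\<bar>polyder m w t\<bar> \<le> Cw" if "t \<in> {0..1}" for t
    using Cw(2)[of 1 t] that by (simp add: w_def)
  have bz: "\<bar>polyder m z t\<bar> \<le> Cw" if "t \<in> {0..1}" for t
    using Cw(2)[of "[:0, 1:]" t] that by (simp add: z_def)
  \<comment> \<open>Makes s * Cw <= C * sqrt e for all s up to sqrt (e / (2 * |\<kappa>|)).\<close>
  define C where "C = Cw / sqrt (2 * \<bar>\<kappa>\<bar>)"
  have C: "C > 0" using Cw(1) \<kappa> by (simp add: C_def)
  show ?thesis
  proof (intro exI[of _ C] conjI C allI impI)
    fix p q :: "real poly" and l e \<Delta> :: real
    assume e: "0 \<le> e" and l: "0 < l" and \<Delta>: "\<bar>\<Delta>\<bar> \<le> 2 * e * l\<^sup>2"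
    define A where "A = integral {0..1} (\<lambda>t. poly (pderiv p) t * poly z t)"
    define B where "B = integral {0..1} (\<lambda>t. poly w t * poly (pderiv q) t)"
    \<comment> \<open>The sign of \<Delta>, which will be realised by the relative sign of the two
      bumps.\<close>
    define d where "d = (if \<Delta> \<ge> 0 then 1 else - 1 :: real)"
    have d: "d * d = 1" "d * \<bar>\<Delta>\<bar> = \<Delta>" "\<bar>d\<bar> = 1" by (auto simp: d_def)
    \<comment> \<open>A common sign of both bumps, invisible to their product.\<close>
    define \<tau> where "\<tau> = (if d * (- A - d * B) \<ge> 0 then 1 else - 1 :: real)"
    have \<tau>: "\<tau> * \<tau> = 1" "\<bar>\<tau>\<bar> = 1" "0 \<le> \<tau> * (d * (- A - d * B))" by (auto simp: \<tau>_def)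
    define L where "L = 4 * l * (\<tau> * (d * (- A - d * B)))"
    have L: "0 \<le> L" using l \<tau> by (simp add: L_def)
    have area: "4 * integral {0..1} (\<lambda>t. poly (pderiv p) t * poly (smult b z) t - poly (smult a w) t * poly (pderiv q) t
         + poly (pderiv (smult a w)) t * poly (smult b z) t) = 4 * (b * A - a * B) + 4 * a * b * \<kappa>" for a b
    proof -
      have "integral {0..1} (\<lambda>t. poly (pderiv p) t * poly (smult b z) t - poly (smult a w) t * poly (pderiv q) t
         + poly (pderiv (smult a w)) t * poly (smult b z) t) =
        integral {0..1} (\<lambda>t. b * (poly (pderiv p) t * poly z t) - a * (poly w t * poly (pderiv q) t)
         + a * b * (poly (pderiv w) t * poly z t))"
        by (simp add: pderiv_smult mult_ac)
      also have "\<dots> = integral {0..1} (\<lambda>t. b * (poly (pderiv p) t * poly z t) - a * (poly w t * poly (pderiv q) t))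
         + integral {0..1} (\<lambda>t. a * b * (poly (pderiv w) t * poly z t))"
        by (intro integral_add integrable_continuous_real continuous_intros)
      also have "integral {0..1} (\<lambda>t. b * (poly (pderiv p) t * poly z t) - a * (poly w t * poly (pderiv q) t)) =
         integral {0..1} (\<lambda>t. b * (poly (pderiv p) t * poly z t)) - integral {0..1} (\<lambda>t. a * (poly w t * poly (pderiv q) t))"
        by (intro integral_diff integrable_continuous_real continuous_intros)
      finally show ?thesis by (simp add: A_def B_def \<kappa>_def)
    qed
    \<comment> \<open>The amplitude at which the quadratic term alone reaches |\<Delta>|. Since L >=
      0, the intermediate value theorem finds the actual amplitude at or below it.\<close>
    define s0 where "s0 = sqrt (\<bar>\<Delta>\<bar> / (4 * l\<^sup>2 * \<bar>\<kappa>\<bar>))"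
    have "0 \<le> \<bar>\<Delta>\<bar> / (4 * l\<^sup>2 * \<bar>\<kappa>\<bar>)" by simp
    then have s0: "0 \<le> s0" "s0\<^sup>2 = \<bar>\<Delta>\<bar> / (4 * l\<^sup>2 * \<bar>\<kappa>\<bar>)" by (simp_all only: s0_def real_sqrt_ge_zero real_sqrt_pow2)
    then have s0': "4 * l\<^sup>2 * \<bar>\<kappa>\<bar> * s0\<^sup>2 = \<bar>\<Delta>\<bar>" using l \<kappa> by simp
    have "\<exists>s\<ge>0. s \<le> s0 \<and> L * s + 4 * l\<^sup>2 * \<bar>\<kappa>\<bar> * s\<^sup>2 = \<bar>\<Delta>\<bar>"
      by (rule IVT') (use s0(1) s0' L in \<open>auto intro!: continuous_intros\<close>)
    then obtain s where s: "0 \<le> s" "s \<le> s0" "L * s + 4 * l\<^sup>2 * \<bar>\<kappa>\<bar> * s\<^sup>2 = \<bar>\<Delta>\<bar>" by blast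
    have "s0 \<le> sqrt (e / (2 * \<bar>\<kappa>\<bar>))" unfolding s0_def
    proof (rule real_sqrt_le_mono)
      have "\<bar>\<Delta>\<bar> / (4 * l\<^sup>2 * \<bar>\<kappa>\<bar>) \<le> 2 * e * l\<^sup>2 / (4 * l\<^sup>2 * \<bar>\<kappa>\<bar>)"
        using \<Delta> by (intro divide_right_mono) auto
      then show "\<bar>\<Delta>\<bar> / (4 * l\<^sup>2 * \<bar>\<kappa>\<bar>) \<le> e / (2 * \<bar>\<kappa>\<bar>)" using l by simp
    qed
    then have "s * Cw \<le> sqrt (e / (2 * \<bar>\<kappa>\<bar>)) * Cw" using s Cw(1) by (intro mult_right_mono) auto
    also have "\<dots> = C * sqrt e" by (simp add: C_def real_sqrt_divide)
    finally have sC: "s * Cw \<le> C * sqrt e" .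
    have bound: "\<bar>a\<bar> * x \<le> C * sqrt e * l" if "\<bar>a\<bar> = s * l" "x \<le> Cw" for a x
    proof -
      have "\<bar>a\<bar> * x \<le> (s * Cw) * l" using that l s(1) by (simp add: mult.assoc mult_left_mono mult.commute[of l])
      also have "\<dots> \<le> C * sqrt e * l" using sC l by (intro mult_right_mono) auto
      finally show ?thesis .
    qed
    \<comment> \<open>The product of the coefficients is -d * s^2 * l^2, and \<kappa> is negative,
      so the quadratic term has the sign of \<Delta>.\<close>
    let ?a = "\<tau> * d * (s * l)" and ?b = "- (\<tau> * (s * l))"
    have ab: "\<bar>?a\<bar> = s * l" "\<bar>?b\<bar> = s * l" using \<tau> d s(1) l by (simp_all add: abs_mult)
    show "\<exists>u v. flat m u \<and> flat m v \<and>
        4 * area_increment 0 1 p q u v = \<Delta> \<and>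
        (\<forall>t\<in>{0..1}. \<bar>polyder m u t\<bar> \<le> C * sqrt e * l \<and> \<bar>polyder m v t\<bar> \<le> C * sqrt e * l)"
    proof (rule exI[of _ "smult ?a w"], rule exI[of _ "smult ?b z"], intro conjI ballI)
      show "flat m (smult ?a w)" "flat m (smult ?b z)" unfolding w_def z_def
        by (intro flat_smult flat_mult' flat_bump)+
      have "4 * (?b * A - ?a * B) + 4 * ?a * ?b * \<kappa> = d * (L * s) - 4 * (\<tau> * \<tau>) * d * s\<^sup>2 * l\<^sup>2 * \<kappa>"
      proof -
        have "d * (L * s) = (d * d) * (4 * l * s * \<tau> * (- A - d * B))" by (simp add: L_def algebra_simps)
        then have "d * (L * s) = 4 * l * s * \<tau> * (- A - d * B)" using d(1) by simp
        then show ?thesis by (simp add: algebra_simps power2_eq_square)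
      qed
      also have "\<dots> = d * (L * s + 4 * l\<^sup>2 * \<bar>\<kappa>\<bar> * s\<^sup>2)" using \<tau>(1) \<kappa> by (simp add: algebra_simps)
      also have "\<dots> = \<Delta>" using s(3) d(2) by simp
      finally show "4 * integral {0..1} (\<lambda>t. poly (pderiv p) t * poly (smult ?b z) t - poly (smult ?a w) t * poly (pderiv q) t
         + poly (pderiv (smult ?a w)) t * poly (smult ?b z) t) = \<Delta>" unfolding area .
    next
      fix t :: real assume t: "t \<in> {0..1}"
      show "\<bar>polyder m (smult ?a w) t\<bar> \<le> C * sqrt e * l"
        unfolding higher_pderiv_smult using bound[OF ab(1) bw[OF t]] by (simp add: abs_mult)
      show "\<bar>polyder m (smult ?b z) t\<bar> \<le> C * sqrt e * l"
        unfolding higher_pderiv_smult poly_smult abs_mult by (rule bound[OF ab(2) bz[OF t]])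
    qed
  qed
qed

text \<open>The linear corrections cost e and the quadratic one sqrt e; the sum e + sqrt e serves
  every case.\<close>

lemma area_correction:
  "\<exists>C>0. \<forall>p q l e \<Delta>. degree p \<le> n \<longrightarrow> degree q \<le> n \<longrightarrow> 0 \<le> e \<longrightarrow> 0 < l \<longrightarrow>
      \<bar>\<Delta>\<bar> \<le> e * l * (l + variation 0 1 p q) \<longrightarrow>
      (\<exists>u v. flat m u \<and> flat m v \<and>
        4 * area_increment 0 1 p q u v = \<Delta> \<and>
        (\<forall>t\<in>{0..1}. \<bar>polyder m u t\<bar> \<le> C * (e + sqrt e) * l \<and> \<bar>polyder m v t\<bar> \<le> C * (e + sqrt e) * l))"
proof -
  obtain C1 where C1: "C1 > 0" and lin: "\<forall>p l e \<Delta>. degree p \<le> n \<longrightarrow> 0 \<le> e \<longrightarrow> 0 \<le> l \<longrightarrow> 0 < integral {0..1} (\<lambda>t. \<bar>poly (pderiv p) t\<bar>) \<longrightarrow>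
      \<bar>\<Delta>\<bar> \<le> 4 * e * l * integral {0..1} (\<lambda>t. \<bar>poly (pderiv p) t\<bar>) \<longrightarrow>
      (\<exists>v. flat m v \<and> 4 * integral {0..1} (\<lambda>t. poly (pderiv p) t * poly v t) = \<Delta> \<and>
        (\<forall>t\<in>{0..1}. \<bar>polyder m v t\<bar> \<le> C1 * e * l))"
    using linear_area_correction[of n m] by (elim exE conjE) (rule that)
  obtain C2 where C2: "C2 > 0" and quad: "\<forall>p q l e \<Delta>. 0 \<le> e \<longrightarrow> 0 < l \<longrightarrow> \<bar>\<Delta>\<bar> \<le> 2 * e * l\<^sup>2 \<longrightarrow>
      (\<exists>u v. flat m u \<and> flat m v \<and>
        4 * area_increment 0 1 p q u v = \<Delta> \<and>
        (\<forall>t\<in>{0..1}. \<bar>polyder m u t\<bar> \<le> C2 * sqrt e * l \<and> \<bar>polyder m v t\<bar> \<le> C2 * sqrt e * l))"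
    using quadratic_area_correction[of m] by (elim exE conjE) (rule that)
  define C where "C = C1 + C2"
  have C: "C > 0" using C1 C2 by (simp add: C_def)
  show ?thesis
  proof (intro exI[of _ C] conjI C allI impI)
    fix p q :: "real poly" and l e \<Delta> :: real
    assume dp: "degree p \<le> n" and dq: "degree q \<le> n" and e: "0 \<le> e" and l: "0 < l"
      and \<Delta>: "\<bar>\<Delta>\<bar> \<le> e * l * (l + variation 0 1 p q)"
    define Ip where "Ip = integral {0..1} (\<lambda>t. \<bar>poly (pderiv p) t\<bar>)"
    define Iq where "Iq = integral {0..1} (\<lambda>t. \<bar>poly (pderiv q) t\<bar>)"
    have I0: "0 \<le> Ip" "0 \<le> Iq" unfolding Ip_def Iq_def
      by (intro integral_nonneg integrable_continuous_real continuous_intros; simp)+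
    have "variation 0 1 p q = Ip + Iq"
      unfolding Ip_def Iq_def by (intro integral_add integrable_continuous_real continuous_intros)
    then have \<Delta>: "\<bar>\<Delta>\<bar> \<le> e * l * (l + (Ip + Iq))" using \<Delta> by simp
    have b1: "C1 * e * l \<le> C * (e + sqrt e) * l" and b2: "C2 * sqrt e * l \<le> C * (e + sqrt e) * l"
      and b0: "0 \<le> C * (e + sqrt e) * l"
      using C1 C2 e l by (auto simp: C_def intro!: mult_mono mult_right_mono add_nonneg_nonneg)
    \<comment> \<open>In the last two cases the larger integral is at least half of the sum, so l +
      Ip + Iq is at most four times the larger integral.\<close>
    consider "Ip + Iq < l" | "l \<le> Ip + Iq" "Iq \<le> Ip" | "l \<le> Ip + Iq" "Ip \<le> Iq" by linarith
    then show "\<exists>u v. flat m u \<and> flat m v \<and>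
        4 * area_increment 0 1 p q u v = \<Delta> \<and>
        (\<forall>t\<in>{0..1}. \<bar>polyder m u t\<bar> \<le> C * (e + sqrt e) * l \<and> \<bar>polyder m v t\<bar> \<le> C * (e + sqrt e) * l)"
    proof cases
      case 1
      have "\<bar>\<Delta>\<bar> \<le> e * l * (l + l)" by (rule order_trans[OF \<Delta>]) (use 1 e l in \<open>intro mult_left_mono, auto\<close>)
      then have "\<bar>\<Delta>\<bar> \<le> 2 * e * l\<^sup>2" by (simp add: power2_eq_square algebra_simps)
      from quad[rule_format, OF e l this, of p q] obtain u v where uv: "flat m u" "flat m v"
        "4 * area_increment 0 1 p q u v = \<Delta>"
        "\<forall>t\<in>{0..1}. \<bar>polyder m u t\<bar> \<le> C2 * sqrt e * l \<and> \<bar>polyder m v t\<bar> \<le> C2 * sqrt e * l"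
        by (elim exE conjE) (rule that)
      show ?thesis
        by (rule exI[of _ u], rule exI[of _ v], intro conjI uv(1-3)) (use uv(4) b2 in \<open>blast intro: order_trans\<close>)
    next
      case 2
      have "\<bar>\<Delta>\<bar> \<le> e * l * (4 * Ip)" by (rule order_trans[OF \<Delta>]) (use 2 e l in \<open>intro mult_left_mono, auto\<close>)
      then have "\<bar>\<Delta>\<bar> \<le> 4 * e * l * Ip" by (simp add: mult_ac)
      moreover have "0 < Ip" using 2 l by linarith
      ultimately obtain v where v: "flat m v" "4 * integral {0..1} (\<lambda>t. poly (pderiv p) t * poly v t) = \<Delta>"
        "\<forall>t\<in>{0..1}. \<bar>polyder m v t\<bar> \<le> C1 * e * l"
        using lin[rule_format, OF dp e less_imp_le[OF l], of \<Delta>] unfolding Ip_def by blast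
      show ?thesis
        by (rule exI[of _ 0], rule exI[of _ v]) (use v b0 b1 in \<open>auto simp: flat_0 intro: order_trans\<close>)
    next
      case 3
      \<comment> \<open>With v = 0 only -u q' remains of the increment, hence the sign.\<close>
      have "\<bar>- \<Delta>\<bar> \<le> e * l * (4 * Iq)" unfolding abs_minus_cancel by (rule order_trans[OF \<Delta>]) (use 3 e l in \<open>intro mult_left_mono, auto\<close>)
      then have "\<bar>- \<Delta>\<bar> \<le> 4 * e * l * Iq" by (simp add: mult_ac)
      moreover have "0 < Iq" using 3 l by linarith
      ultimately obtain u where u: "flat m u" "4 * integral {0..1} (\<lambda>t. poly (pderiv q) t * poly u t) = - \<Delta>"
        "\<forall>t\<in>{0..1}. \<bar>polyder m u t\<bar> \<le> C1 * e * l"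
        using lin[rule_format, OF dq e less_imp_le[OF l], of "- \<Delta>"] unfolding Iq_def by blast
      have eq: "4 * area_increment 0 1 p q u 0 = \<Delta>"
        using u(2) by (simp add: mult.commute)
      show ?thesis
        by (rule exI[of _ u], rule exI[of _ 0], intro conjI u(1) flat_0 eq)
          (use u(3) b0 b1 in \<open>auto intro: order_trans\<close>)
    qed
  qed
qed

text \<open>The integrands differ by W' + R, where W = (F - P) Q - (G - Q) P vanishes at the end
  points. In R every P' or Q' is multiplied by an error, and every derivative of an error by another
  error. So the bound involves |P'| + |Q'| but not the size of P and Q, which matches the form of
  \<open>V_disc\<close>.\<close>

lemma area_diff_bound:
  fixes F G P Q :: "real \<Rightarrow> real"
  assumes ab: "a \<le> b"
    and F: "\<And>t. t \<in> {a..b} \<Longrightarrow> (F has_real_derivative F' t) (at t within {a..b})" "continuous_on {a..b} F'"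
    and G: "\<And>t. t \<in> {a..b} \<Longrightarrow> (G has_real_derivative G' t) (at t within {a..b})" "continuous_on {a..b} G'"
    and P: "\<And>t. t \<in> {a..b} \<Longrightarrow> (P has_real_derivative P' t) (at t within {a..b})" "continuous_on {a..b} P'"
    and Q: "\<And>t. t \<in> {a..b} \<Longrightarrow> (Q has_real_derivative Q' t) (at t within {a..b})" "continuous_on {a..b} Q'"
    and ends: "F a = P a" "F b = P b" "G a = Q a" "G b = Q b"
    and \<alpha>: "\<And>t. t \<in> {a..b} \<Longrightarrow> \<bar>F t - P t\<bar> \<le> \<alpha>" "\<And>t. t \<in> {a..b} \<Longrightarrow> \<bar>G t - Q t\<bar> \<le> \<alpha>"
    and \<beta>: "\<And>t. t \<in> {a..b} \<Longrightarrow> \<bar>F' t - P' t\<bar> \<le> \<beta>" "\<And>t. t \<in> {a..b} \<Longrightarrow> \<bar>G' t - Q' t\<bar> \<le> \<beta>"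
  shows "\<bar>integral {a..b} (\<lambda>t. F' t * G t - G' t * F t) - integral {a..b} (\<lambda>t. P' t * Q t - Q' t * P t)\<bar>
     \<le> 2 * \<alpha> * integral {a..b} (\<lambda>t. \<bar>P' t\<bar> + \<bar>Q' t\<bar>) + 2 * \<alpha> * \<beta> * (b - a)"
proof -
  have cont: "continuous_on {a..b} F" "continuous_on {a..b} G" "continuous_on {a..b} P" "continuous_on {a..b} Q"
    using F(1) G(1) P(1) Q(1) by (meson DERIV_continuous_on)+
  note conts = cont F(2) G(2) P(2) Q(2)
  define W where "W t = (F t - P t) * Q t - (G t - Q t) * P t" for t
  define W' where "W' t = (F' t - P' t) * Q t + (F t - P t) * Q' t - ((G' t - Q' t) * P t + (G t - Q t) * P' t)" for t
  define R where "R t = 2 * (P' t * (G t - Q t) - Q' t * (F t - P t)) + ((F' t - P' t) * (G t - Q t) - (G' t - Q' t) * (F t - P t))" for t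
  have "(W has_vector_derivative W' t) (at t within {a..b})" if "t \<in> {a..b}" for t
    unfolding W_def[abs_def] W'_def has_real_derivative_iff_has_vector_derivative[symmetric]
    using F(1)[OF that] G(1)[OF that] P(1)[OF that] Q(1)[OF that]
    by (auto intro!: derivative_eq_intros simp: algebra_simps)
  then have "(W' has_integral W b - W a) {a..b}" by (intro fundamental_theorem_of_calculus ab)
  then have W0: "(W' has_integral 0) {a..b}" using ends by (simp add: W_def)
  have cW: "continuous_on {a..b} W'" and cR: "continuous_on {a..b} R"
    unfolding W'_def[abs_def] R_def[abs_def] by (intro continuous_intros conts)+
  have "integral {a..b} (\<lambda>t. F' t * G t - G' t * F t) - integral {a..b} (\<lambda>t. P' t * Q t - Q' t * P t) =
     integral {a..b} (\<lambda>t. (F' t * G t - G' t * F t) - (P' t * Q t - Q' t * P t))"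
    by (intro integral_diff[symmetric] integrable_continuous_real continuous_intros conts)
  also have "(\<lambda>t. (F' t * G t - G' t * F t) - (P' t * Q t - Q' t * P t)) = (\<lambda>t. W' t + R t)"
    by (rule ext) (simp add: W'_def R_def algebra_simps)
  also have "integral {a..b} (\<lambda>t. W' t + R t) = integral {a..b} W' + integral {a..b} R"
    by (intro integral_add integrable_continuous_real cW cR)
  also have "integral {a..b} W' = 0" using W0 by (rule integral_unique)
  finally have eq: "integral {a..b} (\<lambda>t. F' t * G t - G' t * F t) - integral {a..b} (\<lambda>t. P' t * Q t - Q' t * P t) = integral {a..b} R"
    by simp
  have "\<bar>R t\<bar> \<le> 2 * \<alpha> * (\<bar>P' t\<bar> + \<bar>Q' t\<bar>) + 2 * \<alpha> * \<beta>" if t: "t \<in> {a..b}" for t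
  proof -
    have 1: "\<bar>P' t * (G t - Q t)\<bar> \<le> \<bar>P' t\<bar> * \<alpha>" "\<bar>Q' t * (F t - P t)\<bar> \<le> \<bar>Q' t\<bar> * \<alpha>"
      unfolding abs_mult using \<alpha>[OF t] by (auto intro!: mult_left_mono)
    have "0 \<le> \<beta>" using \<beta>(1)[OF t] by linarith
    then have 2: "\<bar>(F' t - P' t) * (G t - Q t)\<bar> \<le> \<beta> * \<alpha>" "\<bar>(G' t - Q' t) * (F t - P t)\<bar> \<le> \<beta> * \<alpha>"
      unfolding abs_mult using \<alpha>[OF t] \<beta>[OF t] by (auto intro!: mult_mono)
    have "\<bar>R t\<bar> \<le> 2 * (\<bar>P' t\<bar> * \<alpha> + \<bar>Q' t\<bar> * \<alpha>) + (\<beta> * \<alpha> + \<beta> * \<alpha>)"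
    proof -
      have *: "\<bar>2 * (x - y) + (z - w)\<bar> \<le> 2 * (A + B) + (C + D)"
        if "\<bar>x\<bar> \<le> A" "\<bar>y\<bar> \<le> B" "\<bar>z\<bar> \<le> C" "\<bar>w\<bar> \<le> D" for x y z w A B C D :: real
        using that by (auto simp: abs_le_iff)
      show ?thesis unfolding R_def by (rule *[OF 1 2])
    qed
    then show ?thesis by (simp add: algebra_simps)
  qed
  then have "norm (integral {a..b} R) \<le> integral {a..b} (\<lambda>t. 2 * \<alpha> * (\<bar>P' t\<bar> + \<bar>Q' t\<bar>) + 2 * \<alpha> * \<beta>)"
    by (intro integral_norm_bound_integral integrable_continuous_real cR continuous_intros conts) auto
  also have "\<dots> = integral {a..b} (\<lambda>t. 2 * \<alpha> * (\<bar>P' t\<bar> + \<bar>Q' t\<bar>)) + integral {a..b} (\<lambda>t. 2 * \<alpha> * \<beta>)"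
    by (intro integral_add integrable_continuous_real continuous_intros conts)
  also have "\<dots> = 2 * \<alpha> * integral {a..b} (\<lambda>t. \<bar>P' t\<bar> + \<bar>Q' t\<bar>) + 2 * \<alpha> * \<beta> * (b - a)"
    using ab by simp
  finally show ?thesis unfolding eq by simp
qed

section \<open>Transfer between a gap and the unit interval, and blending of jets\<close>

lemma integral_affine_unit:
  fixes f :: "real \<Rightarrow> real"
  assumes "a < b" "continuous_on {a..b} f"
  shows "integral {0..1} (\<lambda>s. (b - a) * f (a + (b - a) * s)) = integral {a..b} f"
proof -
  have "(f has_integral integral {a..b} f) (cbox a b)"
    using assms(2) by (simp add: integrable_integral integrable_continuous_real)
  from has_integral_affinity'[OF this, of "b - a" a] assms(1)
  have "((\<lambda>s. f ((b - a) * s + a)) has_integral integral {a..b} f / (b - a)) {0..1}"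
    by (simp add: field_simps)
  then have "((\<lambda>s. (b - a) * f ((b - a) * s + a)) has_integral (b - a) * (integral {a..b} f / (b - a))) {0..1}"
    by (rule has_integral_mult_right)
  then have "((\<lambda>s. (b - a) * f (a + (b - a) * s)) has_integral integral {a..b} f) {0..1}"
    using assms(1) by (simp add: add.commute)
  then show ?thesis by (rule integral_unique)
qed

text \<open>Rescaling by composition with a linear polynomial does not raise degrees, on which the
  constants of the unit interval depend.\<close>

definition to_unit :: "real \<Rightarrow> real \<Rightarrow> real poly \<Rightarrow> real poly" where
  "to_unit a b p = pcompose p [:a, b - a:]"

definition of_unit :: "real \<Rightarrow> real \<Rightarrow> real poly \<Rightarrow> real poly" where
  "of_unit a b p = pcompose p [:- a / (b - a), 1 / (b - a):]"

lemma poly_higher_pderiv_of_unit: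
  "a < b \<Longrightarrow> polyder k (of_unit a b p) t = polyder k p ((t - a) / (b - a)) / (b - a) ^ k"
  by (simp add: of_unit_def higher_pderiv_pcompose_linear poly_pcompose diff_divide_distrib power_divide)

lemma poly_higher_pderiv_to_unit:
  "polyder k (to_unit a b p) s = (b - a) ^ k * polyder k p (a + (b - a) * s)"
  by (simp add: to_unit_def higher_pderiv_pcompose_linear poly_pcompose mult.commute)

lemma degree_to_unit: "degree (to_unit a b p) \<le> degree p"
  unfolding to_unit_def by (rule order_trans[OF degree_pcompose_le]) simp

lemma degree_of_unit: "degree (of_unit a b p) \<le> degree p"
  unfolding of_unit_def by (rule order_trans[OF degree_pcompose_le]) simp

text \<open>Given u' a^n + v' b = 1, multiply the term u a of u a + v b = 1 by this
  identity.\<close>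

lemma comaximal_power:
  fixes a b :: "'a :: comm_ring_1"
  assumes "u * a + v * b = 1"
  shows "\<exists>u v. u * a ^ n + v * b = 1"
proof (induction n)
  case 0
  show ?case by (intro exI[of _ 1] exI[of _ 0]) simp
next
  case (Suc n)
  then obtain u' v' where uv: "u' * a ^ n + v' * b = 1" by blast
  have "(u * u') * a ^ Suc n + (u * a * v' + v) * b = u * a * (u' * a ^ n + v' * b) + v * b"
    by (simp add: algebra_simps)
  also have "\<dots> = 1" using assms uv by simp
  finally show ?case by blast
qed

text \<open>A polynomial step: raising first one and then the other factor of t - (t - 1) = 1 to the
  power m + 1 gives a Bezout identity for t^(m+1) and (t - 1)^(m+1). Its summand divisible by
  t^(m+1) is congruent to 1 modulo the other power.\<close>

lemma transition_poly:
  obtains \<theta> :: "real poly" where "[:- 0, 1:] ^ Suc m dvd \<theta>" "[:- 1, 1:] ^ Suc m dvd \<theta> - 1"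
proof -
  let ?x = "[:- 0, 1:] :: real poly" and ?y = "[:- 1, 1:] :: real poly"
  have "1 * ?x + (- 1) * ?y = 1" by (simp add: one_pCons)
  then obtain u v where "u * ?x ^ Suc m + v * ?y = 1" using comaximal_power by blast
  then have "v * ?y + u * ?x ^ Suc m = 1" by (simp only: add.commute)
  then obtain u' v' where "u' * ?y ^ Suc m + v' * ?x ^ Suc m = 1" using comaximal_power by blast
  then have "v' * ?x ^ Suc m - 1 = ?y ^ Suc m * (- u')" by (simp add: algebra_simps del: power_Suc)
  then show thesis by (intro that[of "v' * ?x ^ Suc m"]) (simp_all del: power_Suc)
qed

text \<open>On the rescaled gap take A + \<theta> * (B - A) with the polynomial step \<theta>.
  Degree bound and constant depend on m alone, as the subsequent area correction requires.\<close>

lemma blend: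
  "\<exists>n. \<exists>C>0. \<forall>a b A B \<kappa>. a < b \<longrightarrow> degree A \<le> m \<longrightarrow> degree B \<le> m \<longrightarrow>
     (\<forall>k\<le>m. \<bar>polyder k A a - polyder k B a\<bar> \<le> \<kappa> * (b - a) ^ (m - k)) \<longrightarrow>
     (\<exists>\<phi>::real poly. degree \<phi> \<le> n \<and> (\<forall>k\<le>m. polyder k \<phi> a = polyder k A a \<and>
         polyder k \<phi> b = polyder k B b \<and>
        (\<forall>t\<in>{a..b}. \<bar>polyder k \<phi> t - polyder k A t\<bar> \<le> C * \<kappa> * (b - a) ^ (m - k))))"
proof -
  obtain \<theta> :: "real poly" where \<theta>: "[:- 0, 1:] ^ Suc m dvd \<theta>" "[:- 1, 1:] ^ Suc m dvd \<theta> - 1"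
    by (rule transition_poly)
  have "\<exists>C>0. \<forall>p t. degree p \<le> m \<longrightarrow> t \<in> {0..1} \<longrightarrow>
    \<bar>polyder k (\<theta> * p) t\<bar> \<le> C * (\<Sum>i\<le>m. \<bar>coeff p i\<bar>)" for k
    by (rule higher_pderiv_coeff_bound)
  then obtain C0 where C0: "\<And>k. C0 k > 0" "\<And>k p t. degree p \<le> m \<Longrightarrow> t \<in> {0..1} \<Longrightarrow>
    \<bar>polyder k (\<theta> * p) t\<bar> \<le> C0 k * (\<Sum>i\<le>m. \<bar>coeff p i\<bar>)" by metis
  define C1 where "C1 = (\<Sum>k\<le>m. C0 k)"
  have C1: "C1 > 0" unfolding C1_def using C0(1) by (intro sum_pos) auto
  have C1': "C0 k \<le> C1" if "k \<le> m" for k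
    unfolding C1_def using C0(1) that by (intro member_le_sum) (auto intro: less_imp_le)
  show ?thesis
  proof (rule exI[of _ "degree \<theta> + m"], rule exI[of _ "C1 * real (Suc m)"], intro conjI allI impI)
    show "C1 * real (Suc m) > 0" using C1 by simp
    fix a b \<kappa> :: real and A B :: "real poly"
    assume ab: "a < b" and dA: "degree A \<le> m" and dB: "degree B \<le> m"
      and close: "\<forall>k\<le>m. \<bar>polyder k A a - polyder k B a\<bar> \<le> \<kappa> * (b - a) ^ (m - k)"
    define d where "d = b - a"
    have d: "d > 0" using ab by (simp add: d_def)
    define q where "q = to_unit a b (B - A)"
    define \<psi> where "\<psi> = \<theta> * q"
    define \<phi> where "\<phi> = A + of_unit a b \<psi>"
    have dBA: "degree (B - A) \<le> m" by (rule degree_diff_le[OF dB dA])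
    have dq: "degree q \<le> m" unfolding q_def using degree_to_unit dBA by (rule order_trans)
    \<comment> \<open>The coefficients of q are the Taylor coefficients of B - A at a times d^i, so
      one bound \<kappa> * d^m covers all of them.\<close>
    have "\<bar>coeff q i\<bar> \<le> \<kappa> * d ^ m" if i: "i \<le> m" for i
    proof -
      have "coeff ((pderiv ^^ i) q) 0 = fact i * coeff q i"
        by (simp add: coeff_higher_pderiv pochhammer_fact[symmetric])
      then have "fact i * coeff q i = polyder i q 0" by (simp add: poly_0_coeff_0)
      also have "\<dots> = d ^ i * (polyder i B a - polyder i A a)"
        unfolding q_def poly_higher_pderiv_to_unit by (simp add: higher_pderiv_diff d_def)
      finally have eq: "fact i * coeff q i = d ^ i * (polyder i B a - polyder i A a)" .
      have "fact i * \<bar>coeff q i\<bar> = \<bar>fact i * coeff q i\<bar>" by (simp add: abs_mult)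
      also have "\<dots> = d ^ i * \<bar>polyder i A a - polyder i B a\<bar>"
        unfolding eq using d by (simp add: abs_mult abs_minus_commute)
      also have "\<dots> \<le> d ^ i * (\<kappa> * d ^ (m - i))"
        using close i d by (intro mult_left_mono) (auto simp: d_def)
      also have "\<dots> = \<kappa> * d ^ m" using i by (simp add: power_add[symmetric])
      finally have *: "fact i * \<bar>coeff q i\<bar> \<le> \<kappa> * d ^ m" .
      have "1 * \<bar>coeff q i\<bar> \<le> fact i * \<bar>coeff q i\<bar>" by (intro mult_right_mono fact_ge_1) auto
      then show ?thesis using * by simp
    qed
    then have "(\<Sum>i\<le>m. \<bar>coeff q i\<bar>) \<le> (\<Sum>i\<le>m. \<kappa> * d ^ m)" by (intro sum_mono) auto
    then have sq: "(\<Sum>i\<le>m. \<bar>coeff q i\<bar>) \<le> real (Suc m) * (\<kappa> * d ^ m)" by simp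
    have der: "polyder k \<phi> t = polyder k A t + polyder k \<psi> ((t - a) / d) / d ^ k" for k t
      by (simp add: \<phi>_def higher_pderiv_add poly_higher_pderiv_of_unit[OF ab] d_def)
    show "\<exists>\<phi>. degree \<phi> \<le> degree \<theta> + m \<and> (\<forall>k\<le>m. polyder k \<phi> a = polyder k A a \<and>
         polyder k \<phi> b = polyder k B b \<and>
        (\<forall>t\<in>{a..b}. \<bar>polyder k \<phi> t - polyder k A t\<bar> \<le> C1 * real (Suc m) * \<kappa> * (b - a) ^ (m - k)))"
    proof (intro exI[of _ \<phi>] conjI allI impI ballI)
      have "degree \<psi> \<le> degree \<theta> + m" unfolding \<psi>_def using degree_mult_le[of \<theta> q] dq by linarith
      then have "degree (of_unit a b \<psi>) \<le> degree \<theta> + m" using degree_of_unit order_trans by blast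
      then show "degree \<phi> \<le> degree \<theta> + m" unfolding \<phi>_def using dA by (intro degree_add_le) auto
    next
      fix k assume k: "k \<le> m"
      have "[:- 0, 1:] ^ Suc m dvd \<psi>" unfolding \<psi>_def using \<theta>(1) by (rule dvd_mult2)
      from higher_pderiv_flat[OF this k] show "polyder k \<phi> a = polyder k A a"
        by (simp add: der)
      have "\<psi> - q = (\<theta> - 1) * q" by (simp add: \<psi>_def algebra_simps)
      then have "[:- 1, 1:] ^ Suc m dvd \<psi> - q" using \<theta>(2) by (metis dvd_mult2)
      from higher_pderiv_flat[OF this k] have "polyder k \<psi> 1 = polyder k q 1"
        by (simp add: higher_pderiv_diff)
      also have "\<dots> = d ^ k * polyder k (B - A) b"
        unfolding q_def poly_higher_pderiv_to_unit by (simp add: d_def)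
      finally show "polyder k \<phi> b = polyder k B b"
        using d by (simp add: der d_def[symmetric] higher_pderiv_diff)
      fix t assume t: "t \<in> {a..b}"
      have "(t - a) / d \<in> {0..1}" using t d by (auto simp: d_def divide_simps)
      from C0(2)[OF dq this, of k] have "\<bar>polyder k \<psi> ((t - a) / d)\<bar> \<le> C0 k * (\<Sum>i\<le>m. \<bar>coeff q i\<bar>)"
        by (simp add: \<psi>_def)
      also have "\<dots> \<le> C1 * (real (Suc m) * (\<kappa> * d ^ m))"
        using C1 C1'[OF k] sq C0(1)[of k] by (intro mult_mono) (auto intro: sum_nonneg less_imp_le)
      finally have "\<bar>polyder k \<psi> ((t - a) / d)\<bar> / d ^ k \<le> C1 * (real (Suc m) * (\<kappa> * d ^ m)) / d ^ k"
        using d by (intro divide_right_mono) auto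
      also have "\<dots> = C1 * real (Suc m) * \<kappa> * d ^ (m - k)" using d k by (simp add: power_diff)
      finally show "\<bar>polyder k \<phi> t - polyder k A t\<bar> \<le> C1 * real (Suc m) * \<kappa> * (b - a) ^ (m - k)"
        using d by (simp add: der d_def)
    qed
  qed
qed

text \<open>Modulo the derivative of u q - v p - v u, which integrates to zero, the only remaining
  term with a derivative of u or v is u' v.\<close>

lemma area_perturb:
  fixes p q u v :: "real poly"
  assumes "a \<le> b" "poly u a = 0" "poly u b = 0" "poly v a = 0" "poly v b = 0"
  shows "area a b (p + u) (q + v) =
     area a b p q +
     2 * area_increment a b p q u v"
proof -
  let ?w = "u * q - v * p - v * u"
  have "integral {a..b} (\<lambda>t. poly (pderiv ?w) t) = 0"
    using assms by (simp only: integral_pderiv) simp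
  moreover have "(\<lambda>t. poly (pderiv (p + u)) t * poly (q + v) t - poly (pderiv (q + v)) t * poly (p + u) t) =
    (\<lambda>t. poly (pderiv ?w) t + ((poly (pderiv p) t * poly q t - poly (pderiv q) t * poly p t) +
      2 * (poly (pderiv p) t * poly v t - poly u t * poly (pderiv q) t + poly (pderiv u) t * poly v t)))"
    by (rule ext) (simp add: pderiv_add pderiv_diff pderiv_mult algebra_simps)
  moreover have "integral {a..b} (\<lambda>t. poly (pderiv ?w) t + ((poly (pderiv p) t * poly q t - poly (pderiv q) t * poly p t) +
      2 * (poly (pderiv p) t * poly v t - poly u t * poly (pderiv q) t + poly (pderiv u) t * poly v t))) =
      integral {a..b} (\<lambda>t. poly (pderiv ?w) t) + (area a b p q +
      integral {a..b} (\<lambda>t. 2 * (poly (pderiv p) t * poly v t - poly u t * poly (pderiv q) t + poly (pderiv u) t * poly v t)))"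
    by (subst integral_add, (intro integrable_continuous_real continuous_intros)+,
        subst integral_add, (intro integrable_continuous_real continuous_intros)+, rule refl)
  ultimately show ?thesis by (simp only: integral_mult_right add_0)
qed

lemma flat_ends: "flat m u \<Longrightarrow> k \<le> m \<Longrightarrow> polyder k u 0 = 0" "flat m u \<Longrightarrow> k \<le> m \<Longrightarrow> polyder k u 1 = 0"
  using higher_pderiv_flat[of 0 m u k] higher_pderiv_flat[of 1 m u k] by (auto simp: flat_def)

text \<open>Increment and variation are invariant under the affine change to [0, 1], while m-th
  derivatives acquire the factor (b - a)^m. Applying \<open>area_correction\<close> with l = (b -
  a)^m makes this factor cancel.\<close>

lemma area_correction_interval:
  "\<exists>C>0. \<forall>a b p q e \<Delta>. a < b \<longrightarrow> degree p \<le> n \<longrightarrow> degree q \<le> n \<longrightarrow> 0 \<le> e \<longrightarrow>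
      \<bar>\<Delta>\<bar> \<le> e * (b - a) ^ m * ((b - a) ^ m + variation a b p q) \<longrightarrow>
      (\<exists>F G. (\<forall>k\<le>m. polyder k F a = polyder k p a \<and> polyder k F b = polyder k p b \<and>
           polyder k G a = polyder k q a \<and> polyder k G b = polyder k q b) \<and>
        2 * area a b F G =
          2 * area a b p q + \<Delta> \<and>
        (\<forall>t\<in>{a..b}. \<bar>polyder m F t - polyder m p t\<bar> \<le> C * (e + sqrt e) \<and>
          \<bar>polyder m G t - polyder m q t\<bar> \<le> C * (e + sqrt e)))"
proof -
  obtain C where C: "C > 0" and corr: "\<forall>p q l e \<Delta>. degree p \<le> n \<longrightarrow> degree q \<le> n \<longrightarrow> 0 \<le> e \<longrightarrow> 0 < l \<longrightarrow>
      \<bar>\<Delta>\<bar> \<le> e * l * (l + variation 0 1 p q) \<longrightarrow>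
      (\<exists>u v. flat m u \<and> flat m v \<and>
        4 * area_increment 0 1 p q u v = \<Delta> \<and>
        (\<forall>t\<in>{0..1}. \<bar>polyder m u t\<bar> \<le> C * (e + sqrt e) * l \<and> \<bar>polyder m v t\<bar> \<le> C * (e + sqrt e) * l))"
    using area_correction[of n m] by (elim exE conjE) (rule that)
  show ?thesis
  proof (intro exI[of _ C] conjI C allI impI)
    fix a b e \<Delta> :: real and p q :: "real poly"
    assume ab: "a < b" and dp: "degree p \<le> n" and dq: "degree q \<le> n" and e: "0 \<le> e"
      and \<Delta>: "\<bar>\<Delta>\<bar> \<le> e * (b - a) ^ m * ((b - a) ^ m + variation a b p q)"
    define d where "d = b - a"
    have d: "d > 0" using ab by (simp add: d_def)
    define p' where "p' = to_unit a b p"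
    define q' where "q' = to_unit a b q"
    have der: "poly (pderiv p') s = d * poly (pderiv p) (a + d * s)" "poly (pderiv q') s = d * poly (pderiv q) (a + d * s)" for s
      using poly_higher_pderiv_to_unit[of 1 a b p s] poly_higher_pderiv_to_unit[of 1 a b q s] by (simp_all add: p'_def q'_def d_def)
    have "variation 0 1 p' q' =
       integral {0..1} (\<lambda>s. (b - a) * (\<bar>poly (pderiv p) (a + (b - a) * s)\<bar> + \<bar>poly (pderiv q) (a + (b - a) * s)\<bar>))"
      using d by (simp add: der abs_mult algebra_simps flip: d_def)
    also have "\<dots> = variation a b p q"
      by (rule integral_affine_unit[OF ab]) (intro continuous_intros)
    finally have I: "variation 0 1 p' q' =
       variation a b p q" .
    have "degree p' \<le> n" "degree q' \<le> n" unfolding p'_def q'_def using degree_to_unit dp dq order_trans by blast+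
    moreover have "\<bar>\<Delta>\<bar> \<le> e * d ^ m * (d ^ m + variation 0 1 p' q')"
      using \<Delta> by (simp add: I d_def)
    moreover have "0 < d ^ m" using d by simp
    ultimately obtain u v where uv: "flat m u" "flat m v"
        "4 * area_increment 0 1 p' q' u v = \<Delta>"
        and bnd: "\<forall>t\<in>{0..1}. \<bar>polyder m u t\<bar> \<le> C * (e + sqrt e) * d ^ m \<and> \<bar>polyder m v t\<bar> \<le> C * (e + sqrt e) * d ^ m"
      using corr[rule_format, of p' q' e "d ^ m" \<Delta>] e by blast
    define U where "U = of_unit a b u"
    define V where "V = of_unit a b v"
    have UV: "polyder k U t = polyder k u ((t - a) / d) / d ^ k"
      "polyder k V t = polyder k v ((t - a) / d) / d ^ k" for k t
      by (simp_all add: U_def V_def poly_higher_pderiv_of_unit[OF ab] d_def)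
    have ends: "polyder k U a = 0" "polyder k U b = 0"
      "polyder k V a = 0" "polyder k V b = 0" if "k \<le> m" for k
      using flat_ends[OF uv(1) that] flat_ends[OF uv(2) that] d by (simp_all add: UV d_def)
    have "area_increment a b p q U V =
      integral {0..1} (\<lambda>s. (b - a) * (poly (pderiv p) (a + (b - a) * s) * poly V (a + (b - a) * s)
        - poly U (a + (b - a) * s) * poly (pderiv q) (a + (b - a) * s) + poly (pderiv U) (a + (b - a) * s) * poly V (a + (b - a) * s)))"
      by (rule integral_affine_unit[OF ab, symmetric]) (intro continuous_intros)
    also have "(\<lambda>s. (b - a) * (poly (pderiv p) (a + (b - a) * s) * poly V (a + (b - a) * s)
        - poly U (a + (b - a) * s) * poly (pderiv q) (a + (b - a) * s) + poly (pderiv U) (a + (b - a) * s) * poly V (a + (b - a) * s))) =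
       (\<lambda>t. poly (pderiv p') t * poly v t - poly u t * poly (pderiv q') t + poly (pderiv u) t * poly v t)"
    proof
      fix s
      have "poly U (a + d * s) = poly u s" "poly V (a + d * s) = poly v s" "poly (pderiv U) (a + d * s) = poly (pderiv u) s / d"
        using UV(1)[of 0 "a + d * s"] UV(2)[of 0 "a + d * s"] UV(1)[of 1 "a + d * s"] d by simp_all
      then show "(b - a) * (poly (pderiv p) (a + (b - a) * s) * poly V (a + (b - a) * s)
        - poly U (a + (b - a) * s) * poly (pderiv q) (a + (b - a) * s) + poly (pderiv U) (a + (b - a) * s) * poly V (a + (b - a) * s)) =
         poly (pderiv p') s * poly v s - poly u s * poly (pderiv q') s + poly (pderiv u) s * poly v s"
        using d by (simp add: der algebra_simps flip: d_def)
    qed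
    finally have lin: "4 * area_increment a b p q U V = \<Delta>"
      using uv(3) by simp
    have bd: "\<bar>polyder m U t\<bar> \<le> C * (e + sqrt e)" "\<bar>polyder m V t\<bar> \<le> C * (e + sqrt e)" if t: "t \<in> {a..b}" for t
    proof -
      have "(t - a) / d \<in> {0..1}" using t d by (auto simp: d_def divide_simps)
      from bspec[OF bnd this] show "\<bar>polyder m U t\<bar> \<le> C * (e + sqrt e)" "\<bar>polyder m V t\<bar> \<le> C * (e + sqrt e)"
        using d by (simp_all add: UV divide_simps)
    qed
    show "\<exists>F G. (\<forall>k\<le>m. polyder k F a = polyder k p a \<and> polyder k F b = polyder k p b \<and>
           polyder k G a = polyder k q a \<and> polyder k G b = polyder k q b) \<and>
        2 * area a b F G =
          2 * area a b p q + \<Delta> \<and>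
        (\<forall>t\<in>{a..b}. \<bar>polyder m F t - polyder m p t\<bar> \<le> C * (e + sqrt e) \<and>
          \<bar>polyder m G t - polyder m q t\<bar> \<le> C * (e + sqrt e))"
    proof (rule exI[of _ "p + U"], rule exI[of _ "q + V"], intro conjI allI impI ballI)
      show "2 * area a b (p + U) (q + V) =
          2 * area a b p q + \<Delta>"
        using lin ends[of 0] ab by (subst area_perturb) auto
    qed (use ends bd in \<open>simp_all add: higher_pderiv_add\<close>)
  qed
qed

section \<open>Filling a gap\<close>

text \<open>The top derivatives are compared with their values at the left end because gluing needs
  their oscillation over a gap to tend to zero with its length.\<close>

definition fills :: "nat \<Rightarrow> (nat \<Rightarrow> real \<Rightarrow> real) \<Rightarrow> (nat \<Rightarrow> real \<Rightarrow> real) \<Rightarrow> (real \<Rightarrow> real) \<Rightarrow> real \<Rightarrow> real \<Rightarrow>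
    real \<Rightarrow> real poly \<Rightarrow> real poly \<Rightarrow> bool" where
  "fills m J I h a b e F G \<longleftrightarrow>
     (\<forall>k\<le>m. polyder k F a = J k a \<and> polyder k F b = J k b \<and>
       polyder k G a = I k a \<and> polyder k G b = I k b) \<and>
     h b - h a = 2 * area a b F G \<and>
     (\<forall>t\<in>{a..b}. \<bar>polyder m F t - J m a\<bar> \<le> e \<and> \<bar>polyder m G t - I m a\<bar> \<le> e)"

text \<open>No smallness is claimed, so \<kappa> and the error ratio e are read off from the data of
  the gap instead of being estimated. This serves the long gaps, for instance those next to isolated
  points.\<close>

lemma fills_exists:
  assumes ab: "a < b"
  shows "\<exists>e F G. fills m J I h a b e F G"
proof -
  define d where "d = b - a"
  have d: "d > 0" using ab by (simp add: d_def)
  obtain n C where C: "C > 0" and bl: "\<forall>a b A B \<kappa>. a < b \<longrightarrow> degree A \<le> m \<longrightarrow> degree B \<le> m \<longrightarrow>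
     (\<forall>k\<le>m. \<bar>polyder k A a - polyder k B a\<bar> \<le> \<kappa> * (b - a) ^ (m - k)) \<longrightarrow>
     (\<exists>\<phi>::real poly. degree \<phi> \<le> n \<and> (\<forall>k\<le>m. polyder k \<phi> a = polyder k A a \<and>
         polyder k \<phi> b = polyder k B b \<and>
        (\<forall>t\<in>{a..b}. \<bar>polyder k \<phi> t - polyder k A t\<bar> \<le> C * \<kappa> * (b - a) ^ (m - k))))"
    using blend[of m] by (elim exE conjE) (rule that)
  have blJ: "\<exists>\<phi>. degree \<phi> \<le> n \<and> (\<forall>k\<le>m. polyder k \<phi> a = J k a \<and> polyder k \<phi> b = J k b)" for J
  proof -
    let ?A = "taylor_poly m J a" and ?B = "taylor_poly m J b"
    define \<kappa> where "\<kappa> = (\<Sum>k\<le>m. \<bar>polyder k ?A a - polyder k ?B a\<bar> / d ^ (m - k))"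
    have "\<bar>polyder k ?A a - polyder k ?B a\<bar> \<le> \<kappa> * (b - a) ^ (m - k)" if "k \<le> m" for k
    proof -
      have "\<bar>polyder k ?A a - polyder k ?B a\<bar> / d ^ (m - k) \<le> \<kappa>"
        unfolding \<kappa>_def using d that by (intro member_le_sum) auto
      then show ?thesis using d by (simp add: pos_divide_le_eq d_def)
    qed
    then show ?thesis
      using bl[rule_format, OF ab degree_taylor_poly degree_taylor_poly, of J a J b \<kappa>]
      by (auto simp: poly_higher_pderiv_taylor_poly)
  qed
  from blJ[of J] blJ[of I] obtain p q where p: "degree p \<le> n" "\<forall>k\<le>m. polyder k p a = J k a \<and> polyder k p b = J k b"
    and q: "degree q \<le> n" "\<forall>k\<le>m. polyder k q a = I k a \<and> polyder k q b = I k b" by blast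
  define \<Delta> where "\<Delta> = h b - h a - 2 * area a b p q"
  define I' where "I' = variation a b p q"
  have I': "0 \<le> I'" unfolding I'_def by (intro integral_nonneg integrable_continuous_real continuous_intros) auto
  define Y where "Y = d ^ m * (d ^ m + I')"
  define e where "e = \<bar>\<Delta>\<bar> / Y"
  have "d ^ m > 0" using d by simp
  then have pos: "Y > 0" unfolding Y_def using I' by (intro mult_pos_pos add_pos_nonneg)
  have e: "e \<ge> 0" using pos by (simp add: e_def)
  have "e * Y = \<bar>\<Delta>\<bar>" using pos by (simp add: e_def)
  then have "\<bar>\<Delta>\<bar> \<le> e * (b - a) ^ m * ((b - a) ^ m + variation a b p q)"
    by (simp add: Y_def I'_def[symmetric] d_def[symmetric] mult.assoc)
  then obtain F G where FG: "\<forall>k\<le>m. polyder k F a = polyder k p a \<and> polyder k F b = polyder k p b \<and>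
           polyder k G a = polyder k q a \<and> polyder k G b = polyder k q b"
      "2 * area a b F G =
          2 * area a b p q + \<Delta>"
    using area_correction_interval[of n m] ab p(1) q(1) e by blast
  have bdd: "\<exists>B. \<forall>t\<in>{a..b}. \<bar>polyder m F t - c\<bar> \<le> B" for F :: "real poly" and c
  proof -
    have "compact ((\<lambda>t. polyder m F t - c) ` {a..b})"
      by (intro compact_continuous_image continuous_intros) auto
    then show ?thesis by (auto dest!: compact_imp_bounded simp: bounded_iff)
  qed
  obtain B1 B2 where B: "\<forall>t\<in>{a..b}. \<bar>polyder m F t - J m a\<bar> \<le> B1" "\<forall>t\<in>{a..b}. \<bar>polyder m G t - I m a\<bar> \<le> B2"
    using bdd by metis
  have "fills m J I h a b (max B1 B2) F G" unfolding fills_def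
    using FG p(2) q(2) B by (auto simp: \<Delta>_def le_max_iff_disj)
  then show ?thesis by blast
qed

text \<open>Positivity allows the quotient in the discrete A/V condition to be cleared.\<close>

lemma V_disc_pos:
  assumes "finite X" "card X = Suc m" "m > 0" "a \<le> b"
  shows "V_disc m X f g a b > 0"
proof -
  have "0 \<le> integral {a..b} (\<lambda>t. \<bar>deriv (newton_poly X f) t\<bar> + \<bar>deriv (newton_poly X g) t\<bar>)"
    unfolding newton_poly_eq_interp poly_DERIV[THEN DERIV_imp_deriv]
    by (intro integral_nonneg integrable_continuous_real continuous_intros) auto
  then show ?thesis unfolding V_disc_def using diameter_pos[OF assms(1-3)]
    by (intro add_pos_nonneg mult_nonneg_nonneg zero_less_power) auto
qed

lemma AV_interp:
  shows A_disc_interp: "A_disc X f g h a b = h b - h a - 2 * integral {a..b}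
       (\<lambda>t. poly (pderiv (interp X f)) t * poly (interp X g) t - poly (pderiv (interp X g)) t * poly (interp X f) t)"
    and V_disc_interp: "V_disc m X f g a b = diameter X ^ (2 * m) + diameter X ^ m *
       variation a b (interp X f) (interp X g)"
  unfolding A_disc_def V_disc_def newton_poly_eq_interp poly_DERIV[THEN DERIV_imp_deriv] by simp_all

text \<open>Use a node set containing a and b with diameter at most 4 (b - a). The blends p and q of
  the end jets stay close to the interpolants Pf and Pg, so \<open>area_diff_bound\<close> carries
  the A/V estimate from (Pf, Pg) to (p, q), and \<open>area_correction_interval\<close> removes the
  remaining defect.\<close>

lemma fills_small:
  assumes m: "m > 0" and lim: "\<And>x. x \<in> N \<Longrightarrow> x islimpt N"
    and J: "jet_of m N f J" and I: "jet_of m N g I" and AV: "discrete_AV m N f g h"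
    and e: "e > 0"
  shows "\<exists>\<delta>>0. \<forall>a\<in>N. \<forall>b\<in>N. a < b \<longrightarrow> b - a < \<delta> \<longrightarrow> (\<exists>F G. fills m J I h a b e F G)"
proof -
  obtain n CB where CB: "CB > 0" and bl: "\<forall>a b A B \<kappa>. a < b \<longrightarrow> degree A \<le> m \<longrightarrow> degree B \<le> m \<longrightarrow>
     (\<forall>k\<le>m. \<bar>polyder k A a - polyder k B a\<bar> \<le> \<kappa> * (b - a) ^ (m - k)) \<longrightarrow>
     (\<exists>\<phi>::real poly. degree \<phi> \<le> n \<and> (\<forall>k\<le>m. polyder k \<phi> a = polyder k A a \<and>
         polyder k \<phi> b = polyder k B b \<and>
        (\<forall>t\<in>{a..b}. \<bar>polyder k \<phi> t - polyder k A t\<bar> \<le> CB * \<kappa> * (b - a) ^ (m - k))))"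
    using blend[of m] by (elim exE conjE) (rule that)
  obtain CA where CA: "CA > 0" and corr: "\<forall>a b p q e \<Delta>. a < b \<longrightarrow> degree p \<le> n \<longrightarrow> degree q \<le> n \<longrightarrow> 0 \<le> e \<longrightarrow>
      \<bar>\<Delta>\<bar> \<le> e * (b - a) ^ m * ((b - a) ^ m + variation a b p q) \<longrightarrow>
      (\<exists>F G. (\<forall>k\<le>m. polyder k F a = polyder k p a \<and> polyder k F b = polyder k p b \<and>
           polyder k G a = polyder k q a \<and> polyder k G b = polyder k q b) \<and>
        2 * area a b F G =
          2 * area a b p q + \<Delta> \<and>
        (\<forall>t\<in>{a..b}. \<bar>polyder m F t - polyder m p t\<bar> \<le> CA * (e + sqrt e) \<and>
          \<bar>polyder m G t - polyder m q t\<bar> \<le> CA * (e + sqrt e)))"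
    using area_correction_interval[of n m] by (elim exE conjE) (rule that)
  \<comment> \<open>\<open>c1\<close> is the blending error for jets that differ by 2 s 4^m.
    \<open>c2\<close> adds the distance s 4^m from Taylor polynomial to interpolant. In
    \<open>c0\<close>, 16^m comes from D^(2m) <= (4d)^(2m), 4 c2 from comparing the areas, and 6
    from replacing IP by Ip.\<close>
  define c1 where "c1 = 2 * CB * 4 ^ m"
  define c2 where "c2 = (2 * CB + 1) * 4 ^ m"
  define c0 where "c0 = 6 * (16 ^ m + 4 * c2)"
  have c: "c1 > 0" "c2 > 0" "c0 > 0" using CB by (auto simp: c0_def c1_def c2_def add_pos_pos)
  \<comment> \<open>The total cost in the m-th derivative as a function of the tolerance s. It tends
    to 0 with s, which lets s be chosen for the given e.\<close>
  have "((\<lambda>s. c1 * s + CA * (c0 * s + sqrt (c0 * s))) \<longlongrightarrow> c1 * 0 + CA * (c0 * 0 + sqrt (c0 * 0))) (at_right 0)"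
    by (intro tendsto_intros)
  then have "\<forall>\<^sub>F s in at_right 0. c1 * s + CA * (c0 * s + sqrt (c0 * s)) < e"
    using e by (auto dest: order_tendstoD(2))
  moreover have "\<forall>\<^sub>F s in at_right 0. s < 1 / c2" using c by (intro eventually_at_right_real[of 0 "1/c2", THEN eventually_mono]) auto
  moreover have "\<forall>\<^sub>F s::real in at_right 0. s > 0" by (rule eventually_at_right_less)
  ultimately have "\<forall>\<^sub>F s in at_right 0. c1 * s + CA * (c0 * s + sqrt (c0 * s)) < e \<and> s < 1 / c2 \<and> s > 0"
    by eventually_elim simp
  then obtain s where s: "c1 * s + CA * (c0 * s + sqrt (c0 * s)) < e" "s < 1 / c2" "s > 0"
    using eventually_happens'[OF trivial_limit_at_right_real] by blast
  \<comment> \<open>Lets the square of c2 * s be absorbed into c2 * s, and c2 * s into 1.\<close>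
  have s1: "c2 * s \<le> 1" using s(2) c by (simp add: field_simps)
  obtain \<delta>1 where \<delta>1: "\<delta>1 > 0" and J': "jet_close m N f J s \<delta>1"
    using conjunct2[OF J[unfolded jet_of_def], THEN spec, THEN mp, OF s(3)] by (elim exE conjE) (rule that)
  obtain \<delta>2 where \<delta>2: "\<delta>2 > 0" and I': "jet_close m N g I s \<delta>2"
    using conjunct2[OF I[unfolded jet_of_def], THEN spec, THEN mp, OF s(3)] by (elim exE conjE) (rule that)
  obtain \<delta>3 where \<delta>3: "\<delta>3 > 0" and AV': "\<forall>X a b. X \<subseteq> N \<and> finite X \<and> card X = m + 1 \<and> a \<in> X \<and> b \<in> X \<and> a < b \<and>
        diameter X < \<delta>3 \<longrightarrow> \<bar>A_disc X f g h a b / V_disc m X f g a b\<bar> < s"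
    using AV[unfolded discrete_AV_def, THEN spec, THEN mp, OF s(3)] by (elim exE conjE) (rule that)
  define \<delta> where "\<delta> = min \<delta>1 (min \<delta>2 \<delta>3) / 4"
  show ?thesis
  proof (intro exI[of _ \<delta>] conjI ballI impI)
    show "\<delta> > 0" using \<delta>1 \<delta>2 \<delta>3 by (simp add: \<delta>_def)
    fix a b assume a: "a \<in> N" and b: "b \<in> N" and ab: "a < b" and ba: "b - a < \<delta>"
    define d where "d = b - a"
    have d: "d > 0" using ab by (simp add: d_def)
    have ne: "a \<noteq> b" using ab by simp
    obtain X where X: "X \<subseteq> N" "finite X" "card X = Suc m" "a \<in> X" "b \<in> X" "\<bar>a - b\<bar> \<le> diameter X" "diameter X \<le> 4 * \<bar>a - b\<bar>"
      by (rule common_nodes[OF m lim a b ne])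
    have Xne: "X \<noteq> {}" using X by auto
    define D where "D = diameter X"
    have D4: "D \<le> 4 * d" and dD: "d \<le> D" using X(6,7) ab by (simp_all add: D_def d_def)
    have D: "D > 0" using d dD by linarith
    have D\<delta>: "D < \<delta>1" "D < \<delta>2" "D < \<delta>3" using D4 ba by (auto simp: \<delta>_def d_def)
    define Pf where "Pf = interp X f"
    define Pg where "Pg = interp X g"
    have Dm: "D ^ (m - k) \<le> 4 ^ m * d ^ (m - k)" for k
    proof -
      have "D ^ (m - k) \<le> (4 * d) ^ (m - k)" using D D4 by (intro power_mono) auto
      also have "\<dots> = 4 ^ (m - k) * d ^ (m - k)" by (rule power_mult_distrib)
      also have "\<dots> \<le> 4 ^ m * d ^ (m - k)" using d by (intro mult_right_mono power_increasing) auto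
      finally show ?thesis .
    qed
    \<comment> \<open>Stated for a generic component, since it is applied to (J, f) and to (I,
      g).\<close>
    have main: "\<exists>\<phi>. degree \<phi> \<le> n \<and> (\<forall>k\<le>m. polyder k \<phi> a = J k a \<and> polyder k \<phi> b = J k b) \<and>
        (\<forall>k\<le>m. \<forall>t\<in>{a..b}. \<bar>polyder k \<phi> t - polyder k (interp X f) t\<bar> \<le> c2 * s * d ^ (m - k)) \<and>
        (\<forall>t\<in>{a..b}. \<bar>polyder m \<phi> t - J m a\<bar> \<le> c1 * s)"
      if jt: "jet_close m N f J s \<delta>'" and D': "D < \<delta>'"
      for J f \<delta>'
    proof -
      let ?A = "taylor_poly m J a" and ?B = "taylor_poly m J b"
      let ?P = "interp X f"
      have cl: "\<bar>polyder k ?P t - polyder k (taylor_poly m J x) t\<bar> \<le> s * 4 ^ m * d ^ (m - k)"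
        if "k \<le> m" "t \<in> {a..b}" "x \<in> {a, b}" for k t x
      proof -
        have "\<bar>t - x\<bar> \<le> diameter X" using that(2,3) dD by (auto simp: D_def d_def)
        then have "\<bar>polyder k ?P t - polyder k (taylor_poly m J x) t\<bar> \<le> s * D ^ (m - k)"
          using jt[rule_format, of X x k t] that X D' by (auto simp: D_def)
        also have "\<dots> \<le> s * (4 ^ m * d ^ (m - k))" using s Dm by (intro mult_left_mono) auto
        finally show ?thesis by (simp add: mult.assoc)
      qed
      have "\<bar>polyder k ?A a - polyder k ?B a\<bar> \<le> (2 * s * 4 ^ m) * (b - a) ^ (m - k)" if "k \<le> m" for k
      proof -
        have "\<bar>polyder k ?A a - polyder k ?B a\<bar> \<le> s * 4 ^ m * d ^ (m - k) + s * 4 ^ m * d ^ (m - k)"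
        proof -
          have "\<bar>polyder k ?P a - polyder k ?A a\<bar> \<le> s * 4 ^ m * d ^ (m - k)"
            "\<bar>polyder k ?P a - polyder k ?B a\<bar> \<le> s * 4 ^ m * d ^ (m - k)"
            by (rule cl[OF that]; use ab in simp)+
          then show ?thesis by linarith
        qed
        then show ?thesis by (simp add: d_def)
      qed
      then obtain \<phi> where \<phi>: "degree \<phi> \<le> n" "\<forall>k\<le>m. polyder k \<phi> a = polyder k ?A a \<and>
         polyder k \<phi> b = polyder k ?B b \<and>
        (\<forall>t\<in>{a..b}. \<bar>polyder k \<phi> t - polyder k ?A t\<bar> \<le> CB * (2 * s * 4 ^ m) * (b - a) ^ (m - k))"
        using bl[rule_format, OF ab degree_taylor_poly degree_taylor_poly, of J a J b "2 * s * 4 ^ m"] by blast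
      show ?thesis
      proof (intro exI[of _ \<phi>] conjI allI impI ballI \<phi>(1))
        fix k assume k: "k \<le> m"
        show "polyder k \<phi> a = J k a" "polyder k \<phi> b = J k b"
          using \<phi>(2) k by (auto simp: poly_higher_pderiv_taylor_poly)
        fix t assume t: "t \<in> {a..b}"
        have "\<bar>polyder k \<phi> t - polyder k ?P t\<bar> \<le> CB * (2 * s * 4 ^ m) * d ^ (m - k) + s * 4 ^ m * d ^ (m - k)"
          using \<phi>(2) k t cl[OF k t, of a] by (fastforce simp: d_def)
        then show "\<bar>polyder k \<phi> t - polyder k ?P t\<bar> \<le> c2 * s * d ^ (m - k)"
          by (simp add: c2_def algebra_simps)
      next
        fix t assume t: "t \<in> {a..b}"
        then show "\<bar>polyder m \<phi> t - J m a\<bar> \<le> c1 * s"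
          using \<phi>(2)[rule_format, OF order_refl] by (auto simp: top_pderiv_taylor_poly c1_def mult_ac)
      qed
    qed
    from main[OF J' D\<delta>(1)] obtain p where p: "degree p \<le> n"
      "\<forall>k\<le>m. polyder k p a = J k a \<and> polyder k p b = J k b"
      "\<forall>k\<le>m. \<forall>t\<in>{a..b}. \<bar>polyder k p t - polyder k Pf t\<bar> \<le> c2 * s * d ^ (m - k)"
      "\<forall>t\<in>{a..b}. \<bar>polyder m p t - J m a\<bar> \<le> c1 * s" unfolding Pf_def by blast
    from main[OF I' D\<delta>(2)] obtain q where q: "degree q \<le> n"
      "\<forall>k\<le>m. polyder k q a = I k a \<and> polyder k q b = I k b"
      "\<forall>k\<le>m. \<forall>t\<in>{a..b}. \<bar>polyder k q t - polyder k Pg t\<bar> \<le> c2 * s * d ^ (m - k)"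
      "\<forall>t\<in>{a..b}. \<bar>polyder m q t - I m a\<bar> \<le> c1 * s" unfolding Pg_def by blast
    define \<rho> where "\<rho> = s * 16 ^ m + 4 * (c2 * s)"
    define IP where "IP = variation a b Pf Pg"
    define Ip where "Ip = variation a b p q"
    have Ipos: "0 \<le> IP" "0 \<le> Ip" unfolding IP_def Ip_def
      by (intro integral_nonneg integrable_continuous_real continuous_intros; simp)+
    have dp: "\<bar>poly (pderiv p) t - poly (pderiv Pf) t\<bar> \<le> c2 * s * d ^ (m - 1)"
      "\<bar>poly (pderiv q) t - poly (pderiv Pg) t\<bar> \<le> c2 * s * d ^ (m - 1)" if "t \<in> {a..b}" for t
      using p(3)[rule_format, of 1 t] q(3)[rule_format, of 1 t] that m by auto
    have dm: "d ^ (m - 1) * d = d ^ m" using m by (metis power_minus_mult)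
    \<comment> \<open>As a and b are nodes, blends and interpolants agree there, which kills the
      boundary term in \<open>area_diff_bound\<close>.\<close>
    have ends: "poly p a = poly Pf a" "poly p b = poly Pf b" "poly q a = poly Pg a" "poly q b = poly Pg b"
    proof -
      have "J 0 a = f a" "J 0 b = f b" "I 0 a = g a" "I 0 b = g b" using J I a b by (auto simp: jet_of_def)
      moreover have "poly Pf a = f a" "poly Pf b = f b" "poly Pg a = g a" "poly Pg b = g b"
        unfolding Pf_def Pg_def using X(4,5) by (auto intro!: poly_interp X(2) Xne)
      ultimately show "poly p a = poly Pf a" "poly p b = poly Pf b" "poly q a = poly Pg a" "poly q b = poly Pg b"
        using p(2)[rule_format, of 0] q(2)[rule_format, of 0] by auto
    qed
    have "\<bar>area a b p q -
          area a b Pf Pg\<bar>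
       \<le> 2 * (c2 * s * d ^ m) * IP + 2 * (c2 * s * d ^ m) * (c2 * s * d ^ (m - 1)) * (b - a)"
      unfolding IP_def
      by (rule area_diff_bound)
        (use ab ends p(3)[rule_format, of 0] q(3)[rule_format, of 0] dp in
          \<open>auto intro!: DERIV_subset[OF poly_DERIV] continuous_intros\<close>)
    also have "2 * (c2 * s * d ^ m) * (c2 * s * d ^ (m - 1)) * (b - a) = 2 * (c2 * s)\<^sup>2 * (d ^ m * (d ^ (m - 1) * d))"
      by (simp add: d_def power2_eq_square mult_ac)
    also have "\<dots> = 2 * (c2 * s)\<^sup>2 * (d ^ m)\<^sup>2" unfolding dm by (simp add: power2_eq_square)
    also have "\<dots> \<le> 2 * (c2 * s) * (d ^ m)\<^sup>2"
    proof -
      have "(c2 * s)\<^sup>2 \<le> c2 * s" using s1 c s by (simp add: power2_eq_square mult_left_le)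
      then show ?thesis by (intro mult_right_mono) auto
    qed
    finally have dif: "\<bar>area a b p q -
          area a b Pf Pg\<bar>
       \<le> 2 * (c2 * s * d ^ m) * IP + 2 * (c2 * s) * (d ^ m)\<^sup>2" by simp
    have Vpos: "V_disc m X f g a b > 0" by (rule V_disc_pos) (use X m ab in auto)
    have "\<bar>A_disc X f g h a b / V_disc m X f g a b\<bar> < s" using AV'[rule_format, of X a b] X ab D\<delta> by (auto simp: D_def)
    then have "\<bar>A_disc X f g h a b\<bar> \<le> s * V_disc m X f g a b" using Vpos by (simp add: pos_divide_less_eq)
    also have "\<dots> = s * (D ^ (2 * m) + D ^ m * IP)"
      by (simp add: V_disc_interp D_def IP_def Pf_def Pg_def)
    also have "\<dots> \<le> s * (16 ^ m * ((d ^ m)\<^sup>2 + d ^ m * IP))"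
    proof (rule mult_left_mono)
      have 1: "D ^ m \<le> 4 ^ m * d ^ m" using Dm[of 0] by simp
      have "D ^ (2 * m) = (D ^ m)\<^sup>2" by (simp add: power_mult[symmetric] mult.commute)
      also have "\<dots> \<le> (4 ^ m * d ^ m)\<^sup>2" using 1 D by (intro power_mono) auto
      also have "\<dots> = 16 ^ m * (d ^ m)\<^sup>2"
      proof -
        have "(4 ^ m)\<^sup>2 = (16 ^ m :: real)" unfolding power2_eq_square power_mult_distrib[symmetric] by simp
        then show ?thesis by (simp add: power_mult_distrib)
      qed
      finally have 2: "D ^ (2 * m) \<le> 16 ^ m * (d ^ m)\<^sup>2" .
      have "D ^ m \<le> 16 ^ m * d ^ m" by (rule order_trans[OF 1]) (use d in \<open>auto intro!: mult_right_mono power_mono\<close>)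
      then have "D ^ m * IP \<le> 16 ^ m * d ^ m * IP" using Ipos by (intro mult_right_mono)
      then show "D ^ (2 * m) + D ^ m * IP \<le> 16 ^ m * ((d ^ m)\<^sup>2 + d ^ m * IP)" using 2 by (simp add: algebra_simps)
    qed (use s in auto)
    finally have A: "\<bar>A_disc X f g h a b\<bar> \<le> s * 16 ^ m * ((d ^ m)\<^sup>2 + d ^ m * IP)" by (simp add: mult.assoc)
    \<comment> \<open>The variation of the interpolants exceeds that of the blends by at most 2 d^m:
      first derivatives differ by at most c2 s d^(m - 1) over an interval of length d.\<close>
    have "IP \<le> integral {a..b} (\<lambda>t. (\<bar>poly (pderiv p) t\<bar> + \<bar>poly (pderiv q) t\<bar>) + 2 * (c2 * s * d ^ (m - 1)))"
      unfolding IP_def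
    proof (intro integral_le integrable_continuous_real continuous_intros)
      fix t assume "t \<in> {a..b}"
      from dp[OF this] show "\<bar>poly (pderiv Pf) t\<bar> + \<bar>poly (pderiv Pg) t\<bar> \<le> \<bar>poly (pderiv p) t\<bar> + \<bar>poly (pderiv q) t\<bar> + 2 * (c2 * s * d ^ (m - 1))"
        by linarith
    qed
    also have "\<dots> = Ip + integral {a..b} (\<lambda>t. 2 * (c2 * s * d ^ (m - 1)))" unfolding Ip_def
      by (intro integral_add integrable_continuous_real continuous_intros)
    also have "integral {a..b} (\<lambda>t. 2 * (c2 * s * d ^ (m - 1))) = 2 * (c2 * s) * (d ^ (m - 1) * d)"
      using ab by (simp add: d_def)
    also have "\<dots> \<le> 2 * 1 * d ^ m" unfolding dm using s1 d by (intro mult_right_mono) auto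
    finally have IPp: "IP \<le> Ip + 2 * d ^ m" by simp
    define \<Delta> where "\<Delta> = h b - h a - 2 * area a b p q"
    have "\<bar>\<Delta>\<bar> \<le> \<bar>A_disc X f g h a b\<bar> + 2 * (2 * (c2 * s * d ^ m) * IP + 2 * (c2 * s) * (d ^ m)\<^sup>2)"
    proof -
      have *: "\<bar>x - 2 * y\<bar> \<le> \<bar>x - 2 * z\<bar> + 2 * w" if "\<bar>y - z\<bar> \<le> w" for x y z w :: real
        using that by linarith
      show ?thesis unfolding \<Delta>_def A_disc_interp Pf_def[symmetric] Pg_def[symmetric] by (rule *[OF dif])
    qed
    also have "\<dots> \<le> \<rho> * ((d ^ m)\<^sup>2 + d ^ m * IP)"
      using A by (simp add: \<rho>_def algebra_simps)
    also have "\<dots> = \<rho> * d ^ m * (d ^ m + IP)" by (simp add: power2_eq_square algebra_simps)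
    also have "\<dots> \<le> \<rho> * d ^ m * (6 * (d ^ m + Ip))"
    proof (rule mult_left_mono)
      have "0 \<le> d ^ m" using d by simp
      then show "d ^ m + IP \<le> 6 * (d ^ m + Ip)" unfolding distrib_left using IPp Ipos by linarith
      show "0 \<le> \<rho> * d ^ m" using s c d by (simp add: \<rho>_def)
    qed
    also have "\<dots> = (c0 * s) * (b - a) ^ m * ((b - a) ^ m + variation a b p q)"
      by (simp add: \<rho>_def c0_def d_def Ip_def algebra_simps)
    finally have "\<bar>\<Delta>\<bar> \<le> (c0 * s) * (b - a) ^ m * ((b - a) ^ m + variation a b p q)" .
    moreover have "0 \<le> c0 * s" using c s by simp
    ultimately obtain F G where FG: "\<forall>k\<le>m. polyder k F a = polyder k p a \<and> polyder k F b = polyder k p b \<and>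
           polyder k G a = polyder k q a \<and> polyder k G b = polyder k q b"
        "2 * area a b F G =
          2 * area a b p q + \<Delta>"
        "\<forall>t\<in>{a..b}. \<bar>polyder m F t - polyder m p t\<bar> \<le> CA * (c0 * s + sqrt (c0 * s)) \<and>
          \<bar>polyder m G t - polyder m q t\<bar> \<le> CA * (c0 * s + sqrt (c0 * s))"
      using corr[rule_format, OF ab p(1) q(1), of "c0 * s" \<Delta>] by blast
    have "fills m J I h a b e F G" unfolding fills_def
    proof (intro conjI ballI)
      show "\<forall>k\<le>m. polyder k F a = J k a \<and> polyder k F b = J k b \<and>
       polyder k G a = I k a \<and> polyder k G b = I k b" using FG(1) p(2) q(2) by simp
      show "h b - h a = 2 * area a b F G"
        using FG(2) by (simp add: \<Delta>_def)
    next
      fix t assume t: "t \<in> {a..b}"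
      show "\<bar>polyder m F t - J m a\<bar> \<le> e" "\<bar>polyder m G t - I m a\<bar> \<le> e"
        using bspec[OF FG(3) t] bspec[OF p(4) t] bspec[OF q(4) t] s(1) by linarith+
    qed
    then show "\<exists>F G. fills m J I h a b e F G" by blast
  qed
qed

section \<open>Gluing across the gaps of a closed set\<close>

lemma has_real_derivative_within_alt:
  "(f has_real_derivative D) (at x within S) \<longleftrightarrow>
    (\<forall>e>0. \<exists>d>0. \<forall>y\<in>S. \<bar>y - x\<bar> < d \<longrightarrow> \<bar>f y - f x - D * (y - x)\<bar> \<le> e * \<bar>y - x\<bar>)"
  unfolding has_field_derivative_def has_derivative_within_alt
  by (simp add: bounded_linear_mult_right)

text \<open>For closed L these pairs are the bounded components of the complement. The hypothesis
  \<open>cover\<close> of the gluing lemmas excludes other components.\<close>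

definition gap :: "real set \<Rightarrow> real \<Rightarrow> real \<Rightarrow> bool" where
  "gap L a b \<longleftrightarrow> a \<in> L \<and> b \<in> L \<and> a < b \<and> {a<..<b} \<inter> L = {}"

lemma gap_no_interior: "gap L a b \<Longrightarrow> t \<in> L \<Longrightarrow> t \<le> a \<or> b \<le> t"
  by (force simp: gap_def)

lemma gap_exists:
  assumes "closed L" "y \<notin> L" "x \<in> L" "x < y" "z \<in> L" "y < z"
  obtains a b where "gap L a b" "a < y" "y < b"
proof -
  define a where "a = Sup (L \<inter> {..y})"
  define b where "b = Inf (L \<inter> {y..})"
  have a: "a \<in> L \<inter> {..y}" unfolding a_def
    by (rule closed_contains_Sup) (use assms in \<open>auto intro!: closed_Int\<close>)
  have b: "b \<in> L \<inter> {y..}" unfolding b_def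
    by (rule closed_contains_Inf) (use assms in \<open>auto intro!: closed_Int\<close>)
  have ab: "a < y" "y < b" using a b assms(2) by (auto simp: less_le)
  have "t \<notin> L" if t: "a < t" "t < b" for t
  proof
    assume tL: "t \<in> L"
    show False
    proof (cases "t \<le> y")
      case True
      then have "t \<le> a" unfolding a_def using tL by (intro cSup_upper) (auto intro!: bdd_aboveI[of _ y])
      then show False using t by simp
    next
      case False
      then have "b \<le> t" unfolding b_def using tL by (intro cInf_lower) (auto intro!: bdd_belowI[of _ y])
      then show False using t by simp
    qed
  qed
  then have "gap L a b" using a b ab by (auto simp: gap_def)
  then show thesis using that ab by blast
qed

lemma gap_unique:
  assumes "gap L a b" "gap L a' b'" "a < y" "y < b" "a' < y" "y < b'"
  shows "a = a'" "b = b'"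
proof -
  have *: "a \<in> L" "b \<in> L" "a' \<in> L" "b' \<in> L" "\<And>t. t \<in> L \<Longrightarrow> \<not> (a < t \<and> t < b)" "\<And>t. t \<in> L \<Longrightarrow> \<not> (a' < t \<and> t < b')"
    using assms(1,2) by (auto simp: gap_def)
  show "a = a'" using *(5)[OF *(3)] *(6)[OF *(1)] assms by linarith
  show "b = b'" using *(5)[OF *(4)] *(6)[OF *(2)] assms by linarith
qed

text \<open>The two sides of x are treated separately. If a gap ends at x on that side, continuity
  within the gap suffices. Otherwise L accumulates at x there, so each nearby point is in L or in a
  short gap whose left end is near x, and \<open>small\<close> compares it with that left
  end.\<close>

lemma gap_glue_continuous:
  fixes D :: "real \<Rightarrow> real"
  assumes cover: "\<And>y. y \<notin> L \<Longrightarrow> \<exists>a b. gap L a b \<and> a < y \<and> y < b"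
    and onL: "continuous_on L D"
    and gaps: "\<And>a b. gap L a b \<Longrightarrow> continuous_on {a..b} D"
    and small: "\<And>e. e > 0 \<Longrightarrow> \<exists>d>0. \<forall>a b y. gap L a b \<longrightarrow> b - a < d \<longrightarrow> y \<in> {a..b} \<longrightarrow> \<bar>D y - D a\<bar> \<le> e"
  shows "isCont D x"
proof (cases "x \<in> L")
  case False
  then obtain a b where ab: "gap L a b" "a < x" "x < b" using cover by blast
  then have "continuous_on {a<..<b} D" using gaps[OF ab(1)] by (auto intro: continuous_on_subset)
  then show ?thesis using ab by (auto simp: continuous_on_eq_continuous_at)
next
  case x: True
  have "\<exists>d>0. \<forall>y. \<bar>y - x\<bar> < d \<longrightarrow> \<bar>D y - D x\<bar> < e" if e: "e > 0" for e
  proof -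
    obtain d1 where d1: "d1 > 0" "\<And>y. y \<in> L \<Longrightarrow> \<bar>y - x\<bar> < d1 \<Longrightarrow> \<bar>D y - D x\<bar> < e / 3"
      using onL x e unfolding continuous_on_iff dist_real_def by (metis divide_pos_pos zero_less_numeral)
    obtain d2 where d2: "d2 > 0" "\<And>a b y. gap L a b \<Longrightarrow> b - a < d2 \<Longrightarrow> y \<in> {a..b} \<Longrightarrow> \<bar>D y - D a\<bar> \<le> e / 3"
      using small[of "e / 3"] e by auto
    define d where "d = min d1 d2"
    have d: "d > 0" "d \<le> d1" "d \<le> d2" using d1 d2 by (auto simp: d_def)
    have inside: "\<bar>D y - D x\<bar> < e"
      if "y \<in> L \<or> (\<exists>a b. gap L a b \<and> a < y \<and> y < b \<and> \<bar>a - x\<bar> < d \<and> b - a < d)" "\<bar>y - x\<bar> < d" for y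
      using that(1)
    proof (elim disjE exE conjE)
      assume "y \<in> L"
      then show ?thesis using d1(2)[of y] that(2) d e by auto
    next
      fix a b assume g: "gap L a b" "a < y" "y < b" "\<bar>a - x\<bar> < d" "b - a < d"
      then have "\<bar>D y - D a\<bar> \<le> e / 3" using d2(2)[OF g(1)] d by auto
      moreover have "\<bar>D a - D x\<bar> < e / 3" using d1(2)[of a] g d by (auto simp: gap_def)
      ultimately show ?thesis using e by linarith
    qed
    have right: "\<exists>r>0. \<forall>y. x < y \<longrightarrow> y < x + r \<longrightarrow> \<bar>D y - D x\<bar> < e"
    proof (cases "\<exists>b. gap L x b")
      case True
      then obtain b where b: "gap L x b" by blast
      then have xb: "x \<in> {x..b}" "x < b" by (auto simp: gap_def)
      then obtain r where "r > 0" "\<And>y. y \<in> {x..b} \<Longrightarrow> \<bar>y - x\<bar> < r \<Longrightarrow> \<bar>D y - D x\<bar> < e"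
        using gaps[OF b] e unfolding continuous_on_iff dist_real_def by metis
      then show ?thesis using xb by (intro exI[of _ "min r (b - x)"]) auto
    next
      case False
      \<comment> \<open>Otherwise the gap containing x + d / 2 would have to start at x.\<close>
      have "\<exists>z\<in>L. x < z \<and> z < x + d"
      proof (rule ccontr)
        assume no: "\<not> (\<exists>z\<in>L. x < z \<and> z < x + d)"
        then have "x + d / 2 \<notin> L" using d by auto
        then obtain a b where g: "gap L a b" "a < x + d / 2" "x + d / 2 < b" using cover by blast
        then have "a \<le> x" using no d by (force simp: gap_def)
        moreover have "\<not> a < x" using gap_no_interior[OF g(1) x] g d by auto
        ultimately show False using g(1) False by auto
      qed
      then obtain z where z: "z \<in> L" "x < z" "z < x + d" by blast
      have "\<bar>D y - D x\<bar> < e" if y: "x < y" "y < x + (z - x)" for y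
      proof (rule inside)
        show "y \<in> L \<or> (\<exists>a b. gap L a b \<and> a < y \<and> y < b \<and> \<bar>a - x\<bar> < d \<and> b - a < d)"
        proof (cases "y \<in> L")
          case False
          then obtain a b where g: "gap L a b" "a < y" "y < b" using cover by blast
          have "x \<le> a" "b \<le> z" using gap_no_interior[OF g(1) x] gap_no_interior[OF g(1) z(1)] g z y by auto
          then show ?thesis using g z y by (intro disjI2 exI[of _ a] exI[of _ b]) auto
        qed simp
      qed (use y z in auto)
      then show ?thesis using z by (intro exI[of _ "z - x"]) auto
    qed
    have left: "\<exists>r>0. \<forall>y. y < x \<longrightarrow> x - r < y \<longrightarrow> \<bar>D y - D x\<bar> < e"
    proof (cases "\<exists>a. gap L a x")
      case True
      then obtain a where a: "gap L a x" by blast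
      then have xa: "x \<in> {a..x}" "a < x" by (auto simp: gap_def)
      then obtain r where "r > 0" "\<And>y. y \<in> {a..x} \<Longrightarrow> \<bar>y - x\<bar> < r \<Longrightarrow> \<bar>D y - D x\<bar> < e"
        using gaps[OF a] e unfolding continuous_on_iff dist_real_def by metis
      then show ?thesis using xa by (intro exI[of _ "min r (x - a)"]) auto
    next
      case False
      have "\<exists>z\<in>L. z < x \<and> x - d < z"
      proof (rule ccontr)
        assume no: "\<not> (\<exists>z\<in>L. z < x \<and> x - d < z)"
        then have "x - d / 2 \<notin> L" using d by auto
        then obtain a b where g: "gap L a b" "a < x - d / 2" "x - d / 2 < b" using cover by blast
        then have "x \<le> b" using no d by (force simp: gap_def)
        moreover have "\<not> x < b" using gap_no_interior[OF g(1) x] g d by auto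
        ultimately show False using g(1) False by auto
      qed
      then obtain z where z: "z \<in> L" "z < x" "x - d < z" by blast
      have "\<bar>D y - D x\<bar> < e" if y: "y < x" "x - (x - z) < y" for y
      proof (rule inside)
        show "y \<in> L \<or> (\<exists>a b. gap L a b \<and> a < y \<and> y < b \<and> \<bar>a - x\<bar> < d \<and> b - a < d)"
        proof (cases "y \<in> L")
          case False
          then obtain a b where g: "gap L a b" "a < y" "y < b" using cover by blast
          have "z \<le> a" "b \<le> x" using gap_no_interior[OF g(1) x] gap_no_interior[OF g(1) z(1)] g z y by auto
          then show ?thesis using g z y by (intro disjI2 exI[of _ a] exI[of _ b]) auto
        qed simp
      qed (use y z in auto)
      then show ?thesis using z by (intro exI[of _ "x - z"]) auto
    qed
    from right left obtain r1 r2 where r: "r1 > 0" "\<And>y. x < y \<Longrightarrow> y < x + r1 \<Longrightarrow> \<bar>D y - D x\<bar> < e"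
       "r2 > 0" "\<And>y. y < x \<Longrightarrow> x - r2 < y \<Longrightarrow> \<bar>D y - D x\<bar> < e" by metis
    show ?thesis
    proof (intro exI[of _ "min r1 r2"] conjI allI impI)
      fix y assume "\<bar>y - x\<bar> < min r1 r2"
      then show "\<bar>D y - D x\<bar> < e" using r(2)[of y] r(4)[of y] e by (cases y x rule: linorder_cases) auto
    qed (use r in auto)
  qed
  then show ?thesis unfolding continuous_at_eps_delta dist_real_def by blast
qed

text \<open>To reach a point y inside a gap from x in L, go along L to the end of the gap nearer to
  x, then inside the gap by the mean value theorem. Both errors are at most e times the length
  covered, and the lengths add up to |y - x|.\<close>

lemma gap_glue_deriv:
  fixes D0 D1 :: "real \<Rightarrow> real"
  assumes cover: "\<And>y. y \<notin> L \<Longrightarrow> \<exists>a b. gap L a b \<and> a < y \<and> y < b"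
    and cont: "\<And>x. isCont D1 x"
    and gaps: "\<And>a b y. gap L a b \<Longrightarrow> y \<in> {a..b} \<Longrightarrow> (D0 has_real_derivative D1 y) (at y within {a..b})"
    and onL: "\<And>x. x \<in> L \<Longrightarrow> (D0 has_real_derivative D1 x) (at x within L)"
  shows "(D0 has_real_derivative D1 x) (at x)"
proof (cases "x \<in> L")
  case False
  then obtain a b where ab: "gap L a b" "a < x" "x < b" using cover by blast
  then have "(D0 has_real_derivative D1 x) (at x within {a..b})" using gaps[OF ab(1)] by simp
  then show ?thesis using ab by (simp add: at_within_Icc_at)
next
  case x: True
  have "\<exists>d>0. \<forall>y\<in>UNIV. \<bar>y - x\<bar> < d \<longrightarrow> \<bar>D0 y - D0 x - D1 x * (y - x)\<bar> \<le> e * \<bar>y - x\<bar>" if e: "e > 0" for e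
  proof -
    obtain d1 where d1: "d1 > 0" "\<And>y. y \<in> L \<Longrightarrow> \<bar>y - x\<bar> < d1 \<Longrightarrow> \<bar>D0 y - D0 x - D1 x * (y - x)\<bar> \<le> e * \<bar>y - x\<bar>"
      using onL[OF x] e unfolding has_real_derivative_within_alt by blast
    obtain d2 where d2: "d2 > 0" "\<And>y. \<bar>y - x\<bar> < d2 \<Longrightarrow> \<bar>D1 y - D1 x\<bar> < e"
      using cont[of x] e unfolding continuous_at_eps_delta dist_real_def by metis
    define d where "d = min d1 d2"
    have d: "d > 0" "d \<le> d1" "d \<le> d2" using d1 d2 by (auto simp: d_def)
    have step: "\<bar>D0 t - D0 s - D1 x * (t - s)\<bar> \<le> e * (t - s)"
      if st: "s < t" "gap L a b" "a \<le> s" "t \<le> b" "\<bar>s - x\<bar> < d" "\<bar>t - x\<bar> < d" for s t a b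
    proof -
      have "\<exists>\<xi>\<in>{s<..<t}. D0 t - D0 s = D1 \<xi> * (t - s)"
      proof (rule mvt_simple[OF st(1)])
        fix \<xi> assume "s \<le> \<xi>" "\<xi> \<le> t"
        then have "(D0 has_real_derivative D1 \<xi>) (at \<xi> within {a..b})" using gaps[OF st(2)] st by auto
        then have "(D0 has_real_derivative D1 \<xi>) (at \<xi> within {s..t})"
          by (rule DERIV_subset) (use st in auto)
        then show "(D0 has_derivative (*) (D1 \<xi>)) (at \<xi> within {s..t})" by (simp add: has_field_derivative_def)
      qed
      then obtain \<xi> where \<xi>: "s < \<xi>" "\<xi> < t" "D0 t - D0 s = D1 \<xi> * (t - s)" by auto
      have "\<bar>D1 \<xi> - D1 x\<bar> < e" by (rule d2(2)) (use \<xi> st d in auto)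
      moreover have "D0 t - D0 s - D1 x * (t - s) = (D1 \<xi> - D1 x) * (t - s)" using \<xi> by (simp add: algebra_simps)
      ultimately show ?thesis using st(1) by (simp add: abs_mult mult_right_mono)
    qed
    show ?thesis
    proof (intro exI[of _ d] conjI ballI impI)
      fix y :: real assume y: "\<bar>y - x\<bar> < d"
      show "\<bar>D0 y - D0 x - D1 x * (y - x)\<bar> \<le> e * \<bar>y - x\<bar>"
      proof (cases "y \<in> L")
        case True
        then show ?thesis using d1(2) y d by auto
      next
        case False
        then obtain a b where g: "gap L a b" "a < y" "y < b" using cover by blast
        have ab: "a \<in> L" "b \<in> L" using g by (auto simp: gap_def)
        have "x \<le> a \<or> b \<le> x" by (rule gap_no_interior[OF g(1) x])
        then show ?thesis
        proof
          assume xa: "x \<le> a"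
          have 1: "\<bar>D0 a - D0 x - D1 x * (a - x)\<bar> \<le> e * (a - x)" using d1(2)[OF ab(1)] xa y g d by auto
          have 2: "\<bar>D0 y - D0 a - D1 x * (y - a)\<bar> \<le> e * (y - a)" by (rule step[OF _ g(1)]) (use xa y g in auto)
          have "\<bar>D0 y - D0 x - D1 x * (y - x)\<bar> \<le> e * (a - x) + e * (y - a)"
            using 1 2 unfolding right_diff_distrib by linarith
          then show ?thesis using xa g by (simp add: algebra_simps)
        next
          assume bx: "b \<le> x"
          have 1: "\<bar>D0 b - D0 x - D1 x * (b - x)\<bar> \<le> e * (x - b)" using d1(2)[OF ab(2)] bx y g d by auto
          have 2: "\<bar>D0 b - D0 y - D1 x * (b - y)\<bar> \<le> e * (b - y)" by (rule step[OF _ g(1)]) (use bx y g in auto)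
          have "\<bar>D0 y - D0 x - D1 x * (y - x)\<bar> \<le> e * (x - b) + e * (b - y)"
            using 1 2 unfolding right_diff_distrib by linarith
          then show ?thesis using bx g by (simp add: algebra_simps)
        qed
      qed
    qed (rule d(1))
  qed
  then show ?thesis unfolding has_real_derivative_within_alt by blast
qed

text \<open>Extending \<open>\<phi>\<close> by a constant across each gap yields a function with vanishing derivative.\<close>
lemma gap_glue_constant:
  fixes \<phi> :: "real \<Rightarrow> real"
  assumes cover: "\<And>y. y \<notin> L \<Longrightarrow> \<exists>a b. gap L a b \<and> a < y \<and> y < b"
    and gaps: "\<And>a b. gap L a b \<Longrightarrow> \<phi> a = \<phi> b"
    and onL: "\<And>x. x \<in> L \<Longrightarrow> (\<phi> has_real_derivative 0) (at x within L)"
    and "x \<in> L" "y \<in> L"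
  shows "\<phi> x = \<phi> y"
proof -
  obtain la where la: "\<And>y. y \<notin> L \<Longrightarrow> \<exists>b. gap L (la y) b \<and> la y < y \<and> y < b"
    using cover by metis
  define E where "E t = (if t \<in> L then \<phi> t else \<phi> (la t))" for t
  have gapE: "E t = \<phi> a" if "gap L a b" "t \<in> {a..b}" for a b t
  proof (cases "t \<in> L")
    case True
    then have "t = a \<or> t = b" using gap_no_interior[OF that(1)] that(2) by force
    then show ?thesis using that gaps[OF that(1)] by (auto simp: E_def gap_def)
  next
    case False
    then obtain b' where b': "gap L (la t) b'" "la t < t" "t < b'" using la by blast
    have "t \<noteq> a" "t \<noteq> b" using False that by (auto simp: gap_def)
    then have "la t = a" using gap_unique[OF b'(1) that(1)] b' that(2) by auto
    then show ?thesis using False by (simp add: E_def)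
  qed
  have "(E has_real_derivative 0) (at t)" for t
  proof (rule gap_glue_deriv[where L = L and ?D1.0 = "\<lambda>_. 0", OF cover])
    fix a b s assume g: "gap L a b" "s \<in> {a..b}"
    show "(E has_real_derivative 0) (at s within {a..b})"
      unfolding has_field_derivative_def
      by (rule has_derivative_transform[OF g(2) gapE[OF g(1)]]) (auto simp flip: has_field_derivative_def)
  next
    fix s assume s: "s \<in> L"
    show "(E has_real_derivative 0) (at s within L)"
      unfolding has_field_derivative_def
      by (rule has_derivative_transform[OF s _ onL[OF s, unfolded has_field_derivative_def]]) (auto simp: E_def)
  qed auto
  then have "E x = E y" by (rule DERIV_isconst_all[rule_format])
  then show ?thesis using assms(4,5) by (simp add: E_def)
qed

text \<open>\<open>Cm\<close> without boundedness of the top derivative, which products do not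
  preserve; \<open>smooth_imp_Cm\<close> recovers it from constancy near infinity.\<close>

definition smooth :: "nat \<Rightarrow> (real \<Rightarrow> real) \<Rightarrow> bool" where
  "smooth m f \<longleftrightarrow> (\<exists>D :: nat \<Rightarrow> real \<Rightarrow> real. D 0 = f \<and>
      (\<forall>k<m. \<forall>x. (D k has_real_derivative D (Suc k) x) (at x)) \<and> continuous_on UNIV (D m))"

lemma smooth_0: "smooth 0 f \<longleftrightarrow> continuous_on UNIV f"
  by (auto simp: smooth_def)

lemma smooth_Suc: "smooth (Suc m) f \<longleftrightarrow> (\<exists>f'. (\<forall>x. (f has_real_derivative f' x) (at x)) \<and> smooth m f')"
proof
  assume "smooth (Suc m) f"
  then obtain D :: "nat \<Rightarrow> real \<Rightarrow> real" where D: "D 0 = f" "\<forall>k<Suc m. \<forall>x. (D k has_real_derivative D (Suc k) x) (at x)"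
    "continuous_on UNIV (D (Suc m))" unfolding smooth_def by blast
  have "smooth m (D 1)" unfolding smooth_def
    by (rule exI[of _ "\<lambda>k. D (Suc k)"]) (use D in auto)
  then show "\<exists>f'. (\<forall>x. (f has_real_derivative f' x) (at x)) \<and> smooth m f'" using D by (intro exI[of _ "D 1"]) auto
next
  assume "\<exists>f'. (\<forall>x. (f has_real_derivative f' x) (at x)) \<and> smooth m f'"
  then obtain f' D where f': "\<forall>x. (f has_real_derivative f' x) (at x)" and D: "D 0 = f'"
    "\<forall>k<m. \<forall>x. (D k has_real_derivative D (Suc k) x) (at x)" "continuous_on UNIV (D m)" unfolding smooth_def by blast
  show "smooth (Suc m) f" unfolding smooth_def
    by (rule exI[of _ "case_nat f D"]) (use f' D in \<open>auto split: nat.split\<close>)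
qed

lemma smooth_Suc_imp: "smooth (Suc m) f \<Longrightarrow> smooth m f"
proof (induction m arbitrary: f)
  case 0
  then obtain f' where "\<forall>x. (f has_real_derivative f' x) (at x)" by (auto simp: smooth_Suc)
  then show ?case unfolding smooth_0 by (meson DERIV_isCont continuous_at_imp_continuous_on)
next
  case (Suc m)
  then show ?case using smooth_Suc[of "Suc m" f] smooth_Suc[of m f] by blast
qed

lemma smooth_add: "smooth m f \<Longrightarrow> smooth m g \<Longrightarrow> smooth m (\<lambda>x. f x + g x)"
proof (induction m arbitrary: f g)
  case 0
  then show ?case by (auto simp: smooth_0 intro: continuous_intros)
next
  case (Suc m)
  then obtain f' g' where "\<forall>x. (f has_real_derivative f' x) (at x)" "\<forall>x. (g has_real_derivative g' x) (at x)" "smooth m f'" "smooth m g'"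
    unfolding smooth_Suc by blast
  then show ?case unfolding smooth_Suc using Suc.IH
    by (intro exI[of _ "\<lambda>x. f' x + g' x"]) (auto intro: derivative_eq_intros)
qed

lemma smooth_mult: "smooth m f \<Longrightarrow> smooth m g \<Longrightarrow> smooth m (\<lambda>x. f x * g x)"
proof (induction m arbitrary: f g)
  case 0
  then show ?case by (auto simp: smooth_0 intro: continuous_intros)
next
  case (Suc m)
  then obtain f' g' where d: "\<forall>x. (f has_real_derivative f' x) (at x)" "\<forall>x. (g has_real_derivative g' x) (at x)" "smooth m f'" "smooth m g'"
    unfolding smooth_Suc by blast
  have "smooth m (\<lambda>x. f' x * g x + f x * g' x)"
    by (intro smooth_add Suc.IH d smooth_Suc_imp[OF Suc.prems(1)] smooth_Suc_imp[OF Suc.prems(2)])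
  moreover have "\<forall>x. ((\<lambda>x. f x * g x) has_real_derivative f' x * g x + f x * g' x) (at x)"
    using d(1,2) by (auto intro!: derivative_eq_intros)
  ultimately show ?case unfolding smooth_Suc by (intro exI[of _ "\<lambda>x. f' x * g x + f x * g' x"] conjI)
qed

lemma smooth_const: "smooth m (\<lambda>x. c)"
proof (induction m arbitrary: c)
  case (Suc m)
  then show ?case unfolding smooth_Suc by (intro exI[of _ "\<lambda>x. 0"]) auto
qed (simp add: smooth_0)

text \<open>The top derivative is constant on each outer ray and bounded on [-R, R] by
  compactness.\<close>

lemma smooth_imp_Cm:
  assumes "smooth m f" "m > 0" "\<And>x. x < - R \<Longrightarrow> f x = c" "\<And>x. x > R \<Longrightarrow> f x = c'"
  shows "Cm m f"
proof -
  obtain D :: "nat \<Rightarrow> real \<Rightarrow> real" where D: "D 0 = f" "\<forall>k<m. \<forall>x. (D k has_real_derivative D (Suc k) x) (at x)"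
    "continuous_on UNIV (D m)" using assms(1) unfolding smooth_def by blast
  have const: "\<exists>c. \<forall>x\<in>S. D k x = c" if S: "open S" "\<exists>c. \<forall>x\<in>S. f x = c" "k \<le> m" for S k
    using \<open>k \<le> m\<close>
  proof (induction k)
    case 0
    then show ?case using D(1) S(2) by simp
  next
    case (Suc k)
    then obtain c where c: "\<forall>x\<in>S. D k x = c" by auto
    have "D (Suc k) x = 0" if x: "x \<in> S" for x
    proof -
      have "(D k has_real_derivative 0) (at x)"
        by (rule has_field_derivative_transform_within_open[OF DERIV_const S(1) x]) (use c in auto)
      then show ?thesis using D(2) Suc.prems by (meson DERIV_unique Suc_le_lessD)
    qed
    then show ?case by blast
  qed
  obtain c1 where c1: "\<forall>x\<in>{..<-R}. D m x = c1" using const[of "{..<-R}" m] assms(3) by auto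
  obtain c2 where c2: "\<forall>x\<in>{R<..}. D m x = c2" using const[of "{R<..}" m] assms(4) by auto
  have "range (D m) \<subseteq> D m ` {-R..R} \<union> {c1, c2}"
  proof
    fix y assume "y \<in> range (D m)"
    then obtain x where "y = D m x" by auto
    then show "y \<in> D m ` {-R..R} \<union> {c1, c2}" using c1 c2 by (cases "x < -R"; cases "x > R") auto
  qed
  moreover have "bounded (D m ` {-R..R} \<union> {c1, c2})"
    using D(3) by (auto intro!: compact_imp_bounded compact_continuous_image intro: continuous_on_subset simp: bounded_Un)
  ultimately have "bounded (range (D m))" using bounded_subset by blast
  then show ?thesis unfolding Cm_def using D by blast
qed

lemma C1_abs_cont:
  assumes f: "\<And>x. (f has_real_derivative f' x) (at x)" "continuous_on UNIV f'"
  shows "abs_cont f"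
  unfolding abs_cont_def abs_cont_on_interval_def
proof (intro allI impI)
  fix s t \<epsilon> :: real assume "s \<le> t" and \<epsilon>: "0 < \<epsilon>"
  have "bounded (f' ` {s..t})"
    using f(2) by (intro compact_imp_bounded compact_continuous_image) (auto intro: continuous_on_subset)
  then obtain B where B: "B > 0" "\<And>x. x \<in> {s..t} \<Longrightarrow> \<bar>f' x\<bar> \<le> B" unfolding bounded_pos by auto
  have lip: "\<bar>f y - f x\<bar> \<le> B * (y - x)" if xy: "s \<le> x" "x \<le> y" "y \<le> t" for x y
  proof (cases "x = y")
    case False
    then have "x < y" using xy by simp
    then obtain z where z: "x < z" "z < y" "f y - f x = (y - x) * f' z" using MVT2[of x y f f'] f(1) by blast
    then have "\<bar>f y - f x\<bar> = (y - x) * \<bar>f' z\<bar>" by (simp add: abs_mult)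
    also have "\<dots> \<le> (y - x) * B" using B(2)[of z] z xy by (intro mult_left_mono) auto
    finally show ?thesis by (simp add: mult.commute)
  qed simp
  show "\<exists>\<delta>>0. \<forall>(n::nat) (a::nat \<Rightarrow> real) b.
          (\<forall>i<n. s \<le> a i \<and> a i \<le> b i \<and> b i \<le> t) \<and>
          (\<forall>i<n. \<forall>j<n. i \<noteq> j \<longrightarrow> b i \<le> a j \<or> b j \<le> a i) \<and>
          (\<Sum>i<n. b i - a i) < \<delta> \<longrightarrow> (\<Sum>i<n. \<bar>f (b i) - f (a i)\<bar>) < \<epsilon>"
  proof (intro exI[of _ "\<epsilon> / B"] conjI allI impI)
    fix n :: nat and a b :: "nat \<Rightarrow> real"
    assume *: "(\<forall>i<n. s \<le> a i \<and> a i \<le> b i \<and> b i \<le> t) \<and>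
          (\<forall>i<n. \<forall>j<n. i \<noteq> j \<longrightarrow> b i \<le> a j \<or> b j \<le> a i) \<and> (\<Sum>i<n. b i - a i) < \<epsilon> / B"
    have "(\<Sum>i<n. \<bar>f (b i) - f (a i)\<bar>) \<le> (\<Sum>i<n. B * (b i - a i))"
      using * lip by (intro sum_mono) auto
    also have "\<dots> = B * (\<Sum>i<n. b i - a i)" by (rule sum_distrib_left[symmetric])
    also have "\<dots> < \<epsilon>" using * B(1) by (simp add: field_simps)
    finally show "(\<Sum>i<n. \<bar>f (b i) - f (a i)\<bar>) < \<epsilon>" .
  qed (use \<epsilon> B in auto)
qed

text \<open>Small oscillation over short gaps gives continuity of the top derivative, from which one
  descends: \<open>gap_glue_deriv\<close> at order k needs order k + 1 to be continuous, and the
  resulting differentiability makes order k continuous.\<close>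

lemma glue_jets:
  fixes J :: "nat \<Rightarrow> real \<Rightarrow> real" and p :: "real \<Rightarrow> real \<Rightarrow> real poly"
  assumes cover: "\<And>y. y \<notin> L \<Longrightarrow> \<exists>a b. gap L a b \<and> a < y \<and> y < b"
    and J: "\<And>k x. k < m \<Longrightarrow> x \<in> L \<Longrightarrow> (J k has_real_derivative J (Suc k) x) (at x within L)" "continuous_on L (J m)"
    and ends: "\<And>a b k. gap L a b \<Longrightarrow> k \<le> m \<Longrightarrow> polyder k (p a b) a = J k a \<and> polyder k (p a b) b = J k b"
    and small: "\<And>e. e > 0 \<Longrightarrow> \<exists>d>0. \<forall>a b y. gap L a b \<longrightarrow> b - a < d \<longrightarrow> y \<in> {a..b} \<longrightarrow> \<bar>polyder m (p a b) y - J m a\<bar> \<le> e"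
  shows "\<exists>D. (\<forall>k<m. \<forall>x. (D k has_real_derivative D (Suc k) x) (at x)) \<and> (\<forall>k\<le>m. \<forall>x. isCont (D k) x) \<and>
     (\<forall>k\<le>m. \<forall>x\<in>L. D k x = J k x) \<and>
     (\<forall>a b k y. gap L a b \<longrightarrow> k \<le> m \<longrightarrow> y \<in> {a..b} \<longrightarrow> D k y = polyder k (p a b) y)"
proof -
  obtain l r where lr: "\<And>y. y \<notin> L \<Longrightarrow> gap L (l y) (r y) \<and> l y < y \<and> y < r y" using cover by metis
  define D where "D k y = (if y \<in> L then J k y else polyder k (p (l y) (r y)) y)" for k y
  have DL: "D k x = J k x" if "x \<in> L" for k x using that by (simp add: D_def)
  have Dgap: "D k y = polyder k (p a b) y" if g: "gap L a b" "k \<le> m" "y \<in> {a..b}" for a b k y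
  proof (cases "y \<in> L")
    case True
    then have "y = a \<or> y = b" using gap_no_interior[OF g(1)] g(3) by force
    then show ?thesis using ends[OF g(1,2)] True by (auto simp: D_def)
  next
    case False
    then have "y \<noteq> a" "y \<noteq> b" using g(1) by (auto simp: gap_def)
    then have "l y = a" "r y = b" using gap_unique[OF _ g(1), of "l y" "r y" y] lr[OF False] g(3) by auto
    then show ?thesis using False by (simp add: D_def)
  qed
  have top: "isCont (D m) x" for x
  proof (rule gap_glue_continuous[OF cover])
    show "continuous_on L (D m)" using J(2) by (rule continuous_on_eq) (simp add: DL)
    show "continuous_on {a..b} (D m)" if "gap L a b" for a b
      by (rule continuous_on_eq[of _ "polyder m (p a b)"]) (use Dgap[OF that] in \<open>auto intro: continuous_intros\<close>)
    show "\<exists>d>0. \<forall>a b y. gap L a b \<longrightarrow> b - a < d \<longrightarrow> y \<in> {a..b} \<longrightarrow> \<bar>D m y - D m a\<bar> \<le> e" if e0: "e > 0" for e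
    proof -
      obtain d where d: "d > 0" "\<forall>a b y. gap L a b \<longrightarrow> b - a < d \<longrightarrow> y \<in> {a..b} \<longrightarrow> \<bar>polyder m (p a b) y - J m a\<bar> \<le> e"
        using small[OF e0] by blast
      show ?thesis
      proof (intro exI[of _ d] conjI allI impI d(1))
        fix a b y assume g: "gap L a b" "b - a < d" "y \<in> {a..b}"
        then have "D m a = J m a" by (auto simp: gap_def DL)
        then show "\<bar>D m y - D m a\<bar> \<le> e" using d(2) g Dgap[OF g(1) order_refl g(3)] by auto
      qed
    qed
  qed
  have step: "(D k has_real_derivative D (Suc k) x) (at x)" if k: "k < m" and cont: "\<And>x. isCont (D (Suc k)) x" for k x
  proof (rule gap_glue_deriv[OF cover cont])
    fix a b y assume g: "gap L a b" "y \<in> {a..b}"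
    have "(polyder k (p a b) has_real_derivative D (Suc k) y) (at y within {a..b})"
      using Dgap[OF g(1) _ g(2), of "Suc k"] k by (auto intro: DERIV_subset[OF poly_DERIV])
    then show "(D k has_real_derivative D (Suc k) y) (at y within {a..b})"
      unfolding has_field_derivative_def
      by (rule has_derivative_transform[OF g(2), rotated]) (use Dgap[OF g(1), of k] k in auto)
  next
    fix y assume y: "y \<in> L"
    show "(D k has_real_derivative D (Suc k) y) (at y within L)"
      using J(1)[OF k y] unfolding has_field_derivative_def DL[OF y]
      by (rule has_derivative_transform[OF y, rotated]) (simp add: DL)
  qed auto
  have conts: "\<forall>x. isCont (D k) x" if "k \<le> m" for k
    using that
  proof (induction rule: inc_induct)
    case (step k)
    then show ?case using \<open>\<And>k x. k < m \<Longrightarrow> (\<And>x. isCont (D (Suc k)) x) \<Longrightarrow> (D k has_real_derivative D (Suc k) x) (at x)\<close>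
      by (meson DERIV_isCont)
  qed (simp add: top)
  show ?thesis
    by (rule exI[of _ D]) (use conts step DL Dgap in auto)
qed

text \<open>No single tolerance works for all gaps, so each gap receives an almost optimal filling.\<close>
lemma choose_fills:
  assumes fill: "\<And>e. e > 0 \<Longrightarrow> \<exists>d>0. \<forall>a b. gap L a b \<longrightarrow> b - a < d \<longrightarrow> (\<exists>F G. fills m J I h a b e F G)"
  obtains F G e where "\<And>a b. gap L a b \<Longrightarrow> fills m J I h a b (e a b) (F a b) (G a b)"
    "\<And>\<epsilon>. \<epsilon> > 0 \<Longrightarrow> \<exists>d>0. \<forall>a b. gap L a b \<longrightarrow> b - a < d \<longrightarrow> e a b \<le> \<epsilon>"
proof -
  define S where "S a b = {e. \<exists>F G. fills m J I h a b e F G}" for a b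
  \<comment> \<open>The infimum need not be attained. Adding the gap length gives a tolerance that
    is achieved and still tends to zero for short gaps.\<close>
  define e where "e a b = Inf (S a b) + (b - a)" for a b
  have ne: "S a b \<noteq> {}" if "gap L a b" for a b
    using fills_exists[of a b m J I h] that by (auto simp: S_def gap_def)
  have bdd: "bdd_below (S a b)" if "gap L a b" for a b
  proof (rule bdd_belowI)
    fix e assume "e \<in> S a b"
    then obtain F G where "fills m J I h a b e F G" by (auto simp: S_def)
    moreover have "a \<in> {a..b}" using that by (simp add: gap_def)
    ultimately have "\<bar>polyder m F a - J m a\<bar> \<le> e" unfolding fills_def by blast
    then show "0 \<le> e" by linarith
  qed
  have "\<exists>F G. fills m J I h a b (e a b) F G" if g: "gap L a b" for a b
  proof -
    have "Inf (S a b) < e a b" using g by (simp add: e_def gap_def)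
    then obtain e' where e': "e' \<in> S a b" "e' < e a b" using cInf_lessD[OF ne[OF g]] by blast
    then obtain F G where "fills m J I h a b e' F G" by (auto simp: S_def)
    then have "fills m J I h a b (e a b) F G" using e'(2) unfolding fills_def by force
    then show ?thesis by blast
  qed
  then obtain F G where FG: "\<And>a b. gap L a b \<Longrightarrow> fills m J I h a b (e a b) (F a b) (G a b)" by metis
  have "\<exists>d>0. \<forall>a b. gap L a b \<longrightarrow> b - a < d \<longrightarrow> e a b \<le> \<epsilon>" if "\<epsilon> > 0" for \<epsilon>
  proof -
    obtain d where d: "d > 0" "\<forall>a b. gap L a b \<longrightarrow> b - a < d \<longrightarrow> (\<exists>F G. fills m J I h a b (\<epsilon> / 2) F G)"
      using fill[of "\<epsilon> / 2"] \<open>\<epsilon> > 0\<close> by auto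
    show ?thesis
    proof (intro exI[of _ "min d (\<epsilon> / 2)"] conjI allI impI)
      fix a b assume g: "gap L a b" "b - a < min d (\<epsilon> / 2)"
      then have "\<epsilon> / 2 \<in> S a b" using d by (auto simp: S_def)
      then have "Inf (S a b) \<le> \<epsilon> / 2" using bdd[OF g(1)] by (rule cInf_lower)
      then show "e a b \<le> \<epsilon>" using g(2) by (simp add: e_def)
    qed (use d \<open>\<epsilon> > 0\<close> in auto)
  qed
  then show thesis using that FG by blast
qed

text \<open>H is an antiderivative of 2 (F' G - F G'). Along L the difference of an antiderivative
  and h has derivative zero, and it agrees at the two ends of each gap because the filling has the
  prescribed area. So it is constant on L, and the constant is fixed at R.\<close>

lemma horizontal_extension:
  fixes J I :: "nat \<Rightarrow> real \<Rightarrow> real"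
  assumes m: "m > 0"
    and cover: "\<And>y. y \<notin> L \<Longrightarrow> \<exists>a b. gap L a b \<and> a < y \<and> y < b"
    and rays: "\<And>x. x \<le> - R \<Longrightarrow> x \<in> L \<and> J 0 x = 0 \<and> I 0 x = 0 \<and> h x = 0" "\<And>x. x \<ge> R \<Longrightarrow> x \<in> L \<and> J 0 x = 0 \<and> I 0 x = 0 \<and> h x = 0"
    and J: "\<And>k x. k < m \<Longrightarrow> x \<in> L \<Longrightarrow> (J k has_real_derivative J (Suc k) x) (at x within L)" "continuous_on L (J m)"
    and I: "\<And>k x. k < m \<Longrightarrow> x \<in> L \<Longrightarrow> (I k has_real_derivative I (Suc k) x) (at x within L)" "continuous_on L (I m)"
    and h: "\<And>x. x \<in> L \<Longrightarrow> (h has_real_derivative 2 * (J 1 x * I 0 x - J 0 x * I 1 x)) (at x within L)"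
    and fill: "\<And>e. e > 0 \<Longrightarrow> \<exists>d>0. \<forall>a b. gap L a b \<longrightarrow> b - a < d \<longrightarrow> (\<exists>F G. fills m J I h a b e F G)"
  shows "\<exists>F G H. Cm m F \<and> Cm m G \<and> Cm m H \<and> horizontal F G H \<and> (\<forall>x\<in>L. F x = J 0 x \<and> G x = I 0 x \<and> H x = h x)"
proof -
  obtain pF pG e where p: "\<And>a b. gap L a b \<Longrightarrow> fills m J I h a b (e a b) (pF a b) (pG a b)"
    and e: "\<And>\<epsilon>. \<epsilon> > 0 \<Longrightarrow> \<exists>d>0. \<forall>a b. gap L a b \<longrightarrow> b - a < d \<longrightarrow> e a b \<le> \<epsilon>"
    by (rule choose_fills[of L m J I h], erule fill, rule that, assumption+)
  have small: "\<exists>d>0. \<forall>a b y. gap L a b \<longrightarrow> b - a < d \<longrightarrow> y \<in> {a..b} \<longrightarrow>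
      \<bar>polyder m (pF a b) y - J m a\<bar> \<le> \<epsilon> \<and> \<bar>polyder m (pG a b) y - I m a\<bar> \<le> \<epsilon>" if e0: "\<epsilon> > 0" for \<epsilon>
  proof -
    obtain d where "d > 0" "\<forall>a b. gap L a b \<longrightarrow> b - a < d \<longrightarrow> e a b \<le> \<epsilon>" using e[OF e0] by blast
    then show ?thesis using p unfolding fills_def by (intro exI[of _ d]) (meson order_trans)
  qed
  have "\<exists>D. (\<forall>k<m. \<forall>x. (D k has_real_derivative D (Suc k) x) (at x)) \<and> (\<forall>k\<le>m. \<forall>x. isCont (D k) x) \<and>
     (\<forall>k\<le>m. \<forall>x\<in>L. D k x = J k x) \<and>
     (\<forall>a b k y. gap L a b \<longrightarrow> k \<le> m \<longrightarrow> y \<in> {a..b} \<longrightarrow> D k y = polyder k (pF a b) y)"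
  proof (rule glue_jets[OF cover J])
    show "polyder k (pF a b) a = J k a \<and> polyder k (pF a b) b = J k b" if "gap L a b" "k \<le> m" for a b k
      using p[OF that(1)] that(2) by (simp add: fills_def)
    show "\<exists>d>0. \<forall>a b y. gap L a b \<longrightarrow> b - a < d \<longrightarrow> y \<in> {a..b} \<longrightarrow> \<bar>polyder m (pF a b) y - J m a\<bar> \<le> e" if "e > 0" for e
      using small[OF that] by meson
  qed auto
  then obtain DF where DF': "(\<forall>k<m. \<forall>x. (DF k has_real_derivative DF (Suc k) x) (at x)) \<and> (\<forall>k\<le>m. \<forall>x. isCont (DF k) x) \<and>
     (\<forall>k\<le>m. \<forall>x\<in>L. DF k x = J k x) \<and>
     (\<forall>a b k y. gap L a b \<longrightarrow> k \<le> m \<longrightarrow> y \<in> {a..b} \<longrightarrow> DF k y = polyder k (pF a b) y)" by (rule exE)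
  have DF: "(DF k has_real_derivative DF (Suc k) x) (at x)" if "k < m" for k x using DF' that by blast
  have DF2: "isCont (DF k) x" if "k \<le> m" for k x using DF' that by blast
  have DF3: "DF k x = J k x" if "k \<le> m" "x \<in> L" for k x using DF' that by blast
  have DF4: "DF k y = polyder k (pF a b) y" if "gap L a b" "k \<le> m" "y \<in> {a..b}" for a b k y
    using DF' that by blast
  have "\<exists>D. (\<forall>k<m. \<forall>x. (D k has_real_derivative D (Suc k) x) (at x)) \<and> (\<forall>k\<le>m. \<forall>x. isCont (D k) x) \<and>
     (\<forall>k\<le>m. \<forall>x\<in>L. D k x = I k x) \<and>
     (\<forall>a b k y. gap L a b \<longrightarrow> k \<le> m \<longrightarrow> y \<in> {a..b} \<longrightarrow> D k y = polyder k (pG a b) y)"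
  proof (rule glue_jets[OF cover I])
    show "polyder k (pG a b) a = I k a \<and> polyder k (pG a b) b = I k b" if "gap L a b" "k \<le> m" for a b k
      using p[OF that(1)] that(2) by (simp add: fills_def)
    show "\<exists>d>0. \<forall>a b y. gap L a b \<longrightarrow> b - a < d \<longrightarrow> y \<in> {a..b} \<longrightarrow> \<bar>polyder m (pG a b) y - I m a\<bar> \<le> e" if "e > 0" for e
      using small[OF that] by meson
  qed auto
  then obtain DG where DG': "(\<forall>k<m. \<forall>x. (DG k has_real_derivative DG (Suc k) x) (at x)) \<and> (\<forall>k\<le>m. \<forall>x. isCont (DG k) x) \<and>
     (\<forall>k\<le>m. \<forall>x\<in>L. DG k x = I k x) \<and>
     (\<forall>a b k y. gap L a b \<longrightarrow> k \<le> m \<longrightarrow> y \<in> {a..b} \<longrightarrow> DG k y = polyder k (pG a b) y)" by (rule exE)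
  have DG: "(DG k has_real_derivative DG (Suc k) x) (at x)" if "k < m" for k x using DG' that by blast
  have DG2: "isCont (DG k) x" if "k \<le> m" for k x using DG' that by blast
  have DG3: "DG k x = I k x" if "k \<le> m" "x \<in> L" for k x using DG' that by blast
  have DG4: "DG k y = polyder k (pG a b) y" if "gap L a b" "k \<le> m" "y \<in> {a..b}" for a b k y
    using DG' that by blast
  define H' where "H' x = 2 * (DF 1 x * DG 0 x - DF 0 x * DG 1 x)" for x
  have m1: "1 \<le> m" "0 \<le> m" using m by auto
  have cH': "isCont H' x" for x unfolding H'_def[abs_def] by (intro continuous_intros DF2 DG2 m1)
  obtain H0 where H0: "\<And>x. (H0 has_real_derivative H' x) (at x)"
  proof -
    \<comment> \<open>Taking the whole line as an extended interval gives one antiderivative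
      everywhere.\<close>
    have "\<exists>F. \<forall>x. -\<infinity> < ereal x \<longrightarrow> ereal x < \<infinity> \<longrightarrow> (F has_vector_derivative H' x) (at x)"
      by (rule einterval_antiderivative) (auto simp: cH')
    then show thesis using that by (auto simp: has_real_derivative_iff_has_vector_derivative)
  qed
  define c where "c = H0 R - h R"
  define H where "H x = H0 x - c" for x
  have dH: "(H has_real_derivative H' x) (at x)" for x unfolding H_def[abs_def] by (auto intro!: derivative_eq_intros H0)
  have const: "H0 x - h x = H0 y - h y" if "x \<in> L" "y \<in> L" for x y
  proof (rule gap_glue_constant[of L "\<lambda>x. H0 x - h x", OF cover])
    fix a b assume g: "gap L a b"
    then have ab: "a \<le> b" by (simp add: gap_def)
    have "(H' has_integral H0 b - H0 a) {a..b}"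
      using ab H0 by (intro fundamental_theorem_of_calculus)
        (auto simp flip: has_real_derivative_iff_has_vector_derivative intro: has_field_derivative_at_within)
    then have "H0 b - H0 a = integral {a..b} H'" by (simp add: integral_unique)
    also have "\<dots> = integral {a..b} (\<lambda>t. 2 * (poly (pderiv (pF a b)) t * poly (pG a b) t - poly (pderiv (pG a b)) t * poly (pF a b) t))"
    proof (rule integral_cong)
      fix t assume t: "t \<in> {a..b}"
      show "H' t = 2 * (poly (pderiv (pF a b)) t * poly (pG a b) t - poly (pderiv (pG a b)) t * poly (pF a b) t)"
        using DF4[OF g m1(1) t] DF4[OF g m1(2) t] DG4[OF g m1(1) t] DG4[OF g m1(2) t] by (simp add: H'_def)
    qed
    also have "\<dots> = 2 * area a b (pF a b) (pG a b)"
      by (rule integral_mult_right)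
    also have "\<dots> = h b - h a" using p[OF g] by (simp add: fills_def)
    finally show "H0 a - h a = H0 b - h b" by simp
  next
    fix x assume x: "x \<in> L"
    have "H' x = 2 * (J 1 x * I 0 x - J 0 x * I 1 x)"
      unfolding H'_def using DF3[OF m1(1) x] DF3[OF m1(2) x] DG3[OF m1(1) x] DG3[OF m1(2) x] by simp
    then have "(h has_real_derivative H' x) (at x within L)" using h[OF x] by simp
    then show "((\<lambda>x. H0 x - h x) has_real_derivative 0) (at x within L)"
      using has_field_derivative_at_within[OF H0] by (auto intro!: derivative_eq_intros)
  qed (use that in auto)
  have RL: "R \<in> L" using rays(2)[of R] by simp
  have HL: "H x = h x" if "x \<in> L" for x using const[OF that RL] by (simp add: H_def c_def)
  have sF: "smooth m (DF 0)" unfolding smooth_def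
    by (rule exI[of _ DF]) (use DF DF2 in \<open>auto intro: continuous_at_imp_continuous_on\<close>)
  have sG: "smooth m (DG 0)" unfolding smooth_def
    by (rule exI[of _ DG]) (use DG DG2 in \<open>auto intro: continuous_at_imp_continuous_on\<close>)
  have sH: "smooth m H"
  proof -
    \<comment> \<open>H' involves first derivatives of the components, so only m - 1 orders are
      available for it; integration restores the missing one.\<close>
    obtain n where n: "m = Suc n" using m by (cases m) auto
    have *: "smooth n (D 1)" if "\<And>k x. k < m \<Longrightarrow> (D k has_real_derivative D (Suc k) x) (at x)" "\<And>k x. k \<le> m \<Longrightarrow> isCont (D k) x"
      for D :: "nat \<Rightarrow> real \<Rightarrow> real" unfolding smooth_def
      by (rule exI[of _ "\<lambda>k. D (Suc k)"]) (use that n in \<open>auto intro: continuous_at_imp_continuous_on\<close>)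
    have s1: "smooth n (DF 1)" "smooth n (DG 1)" by (rule *; use DF DG DF2 DG2 in auto)+
    have s0: "smooth n (DF 0)" "smooth n (DG 0)" using sF sG unfolding n by (auto intro: smooth_Suc_imp)
    have "smooth n (\<lambda>x. 2 * (DF 1 x * DG 0 x) + (- 2) * (DF 0 x * DG 1 x))"
      by (intro smooth_add smooth_mult smooth_const s1 s0)
    moreover have "(\<lambda>x. 2 * (DF 1 x * DG 0 x) + (- 2) * (DF 0 x * DG 1 x)) = H'"
      by (rule ext) (simp add: H'_def)
    ultimately have "smooth n H'" by (simp only:)
    then show ?thesis unfolding n smooth_Suc using dH by (intro exI[of _ H'] conjI allI)
  qed
  have "Cm m (DF 0)" "Cm m (DG 0)" "Cm m H"
    by (rule smooth_imp_Cm[OF sF m, of R 0 0] smooth_imp_Cm[OF sG m, of R 0 0] smooth_imp_Cm[OF sH m, of R 0 0];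
        use rays DF3 DG3 HL in force)+
  moreover have "horizontal (DF 0) (DG 0) H"
  proof -
    have dF: "(DF 0 has_real_derivative DF 1 x) (at x)" and dG: "(DG 0 has_real_derivative DG 1 x) (at x)" for x
      using DF[of 0 x] DG[of 0 x] m by auto
    have "abs_cont (DF 0)" by (rule C1_abs_cont[OF dF]) (use DF2 m1 in \<open>auto intro!: continuous_at_imp_continuous_on\<close>)
    moreover have "abs_cont (DG 0)" by (rule C1_abs_cont[OF dG]) (use DG2 m1 in \<open>auto intro!: continuous_at_imp_continuous_on\<close>)
    moreover have "abs_cont H" by (rule C1_abs_cont[OF dH]) (use cH' in \<open>auto intro!: continuous_at_imp_continuous_on\<close>)
    moreover have "DF 0 differentiable (at x) \<and> DG 0 differentiable (at x) \<and> H differentiable (at x) \<and>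
        deriv H x = 2 * (deriv (DF 0) x * DG 0 x - DF 0 x * deriv (DG 0) x)" for x
      using dF[of x] dG[of x] dH[of x] unfolding H'_def
      by (auto simp: DERIV_imp_deriv real_differentiable_def)
    ultimately show ?thesis unfolding horizontal_def by simp
  qed
  ultimately show ?thesis using DF3 DG3 HL m1 by blast
qed

section \<open>Necessity\<close>

text \<open>Rolle's theorem between consecutive zeros; sorting them makes the new zeros
  distinct.\<close>

lemma zeros_of_deriv:
  fixes f f' :: "real \<Rightarrow> real"
  assumes "\<And>x. (f has_real_derivative f' x) (at x)"
    and Z: "finite Z" "card Z = Suc n" "Z \<subseteq> {l..r}" "\<And>z. z \<in> Z \<Longrightarrow> f z = 0"
  shows "\<exists>W. finite W \<and> card W = n \<and> W \<subseteq> {l..r} \<and> (\<forall>w\<in>W. f' w = 0)"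
proof -
  define xs where "xs = sorted_list_of_set Z"
  have xs: "length xs = Suc n" "set xs = Z" "sorted_wrt (<) xs"
    using Z by (simp_all add: xs_def)
  have lt: "xs ! i < xs ! j" if "i < j" "j \<le> n" for i j
    using xs that by (simp add: sorted_wrt_iff_nth_less)
  have inZ: "xs ! i \<in> Z" if "i \<le> n" for i using xs that by (metis le_imp_less_Suc nth_mem)
  have "\<exists>c. xs ! i < c \<and> c < xs ! Suc i \<and> f' c = 0" if i: "i < n" for i
  proof -
    have "f (xs ! i) = f (xs ! Suc i)" using Z(4)[OF inZ[of i]] Z(4)[OF inZ[of "Suc i"]] i by simp
    moreover have "continuous_on {xs ! i..xs ! Suc i} f" using assms(1) by (meson DERIV_isCont continuous_at_imp_continuous_on)
    moreover have "\<And>x. f differentiable (at x)" using assms(1) by (auto simp: real_differentiable_def)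
    ultimately obtain c where "xs ! i < c" "c < xs ! Suc i" "DERIV f c :> 0"
      using Rolle[of "xs ! i" "xs ! Suc i" f] lt[of i "Suc i"] i by auto
    then show ?thesis using DERIV_unique[OF assms(1)] by blast
  qed
  then obtain c where c: "\<And>i. i < n \<Longrightarrow> xs ! i < c i \<and> c i < xs ! Suc i \<and> f' (c i) = 0" by metis
  have clt: "c i < c j" if "i < j" "j < n" for i j
  proof -
    have "xs ! Suc i \<le> xs ! j" using lt[of "Suc i" j] that by (cases "Suc i = j") auto
    then show ?thesis using c[of i] c[of j] that by auto
  qed
  then have "inj_on c {..<n}" by (intro inj_onI) (metis lessThan_iff linorder_neqE_nat less_irrefl)
  then have "card (c ` {..<n}) = n" by (simp add: card_image)
  moreover have "c ` {..<n} \<subseteq> {l..r}"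
  proof
    fix y assume "y \<in> c ` {..<n}"
    then obtain i where i: "i < n" "y = c i" by auto
    have "xs ! i \<in> {l..r}" "xs ! Suc i \<in> {l..r}" using Z(3) inZ[of i] inZ[of "Suc i"] i by auto
    then show "y \<in> {l..r}" using c[OF i(1)] i by auto
  qed
  ultimately show ?thesis using c by (intro exI[of _ "c ` {..<n}"]) auto
qed

lemma zeros_of_higher_deriv:
  fixes E :: "nat \<Rightarrow> real \<Rightarrow> real"
  assumes "\<And>k x. k < m \<Longrightarrow> (E k has_real_derivative E (Suc k) x) (at x)"
    and Z: "finite Z" "card Z = Suc m" "Z \<subseteq> {l..r}" "\<And>z. z \<in> Z \<Longrightarrow> E 0 z = 0" and "k \<le> m"
  shows "\<exists>W. finite W \<and> card W = Suc (m - k) \<and> W \<subseteq> {l..r} \<and> (\<forall>w\<in>W. E k w = 0)"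
  using \<open>k \<le> m\<close>
proof (induction k)
  case 0
  then show ?case using Z by (intro exI[of _ Z]) auto
next
  case (Suc k)
  then obtain W where W: "finite W" "card W = Suc (m - k)" "W \<subseteq> {l..r}" "\<forall>w\<in>W. E k w = 0" by auto
  have "m - k = Suc (m - Suc k)" using Suc.prems by simp
  then show ?case using zeros_of_deriv[OF assms(1)[of k] W(1,2,3)] W(4) Suc.prems by auto
qed

text \<open>Rolle gives every error E k a zero in the hull. The m-th derivative of the interpolant
  is constant, so E m is bounded by the oscillation w of D m; each step down in k starts from a zero
  of E k and gains a factor r - l. The first conclusion is the mean value theorem for divided
  differences.\<close>

lemma interp_error:
  fixes D :: "nat \<Rightarrow> real \<Rightarrow> real"
  assumes D: "\<And>k x. k < m \<Longrightarrow> (D k has_real_derivative D (Suc k) x) (at x)"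
    and X: "finite X" "card X = Suc m" "X \<subseteq> {l..r}" "l \<in> X" "r \<in> X"
  shows interp_error_top: "\<exists>\<xi>\<in>{l..r}. D m \<xi> = fact m * divdiff_set (D 0) X"
    and interp_error_bound: "(\<And>s t. s \<in> {l..r} \<Longrightarrow> t \<in> {l..r} \<Longrightarrow> \<bar>D m s - D m t\<bar> \<le> w) \<Longrightarrow> k \<le> m \<Longrightarrow> t \<in> {l..r} \<Longrightarrow>
      \<bar>D k t - polyder k (interp X (D 0)) t\<bar> \<le> w * (r - l) ^ (m - k)"
proof -
  have Xne: "X \<noteq> {}" using X by auto
  define P where "P = interp X (D 0)"
  define E where "E k t = D k t - polyder k P t" for k t
  have dE: "(E k has_real_derivative E (Suc k) x) (at x)" if "k < m" for k x
    unfolding E_def[abs_def] by (auto intro!: derivative_eq_intros D that)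
  have E0: "E 0 z = 0" if "z \<in> X" for z using that by (simp add: E_def P_def poly_interp[OF X(1) Xne])
  have zero: "\<exists>z\<in>{l..r}. E k z = 0" if km: "k \<le> m" for k
  proof -
    obtain W where W: "finite W" "card W = Suc (m - k)" "W \<subseteq> {l..r}" "\<forall>w\<in>W. E k w = 0"
      using zeros_of_higher_deriv[OF dE X(1-3) E0 km] by auto
    then have "W \<noteq> {}" by auto
    then show ?thesis using W by blast
  qed
  have "degree P \<le> m" using degree_interp[OF X(1) Xne, of "D 0"] X(2) by (simp add: P_def)
  then have "degree ((pderiv ^^ m) P) = 0" by (simp add: degree_higher_pderiv)
  then obtain c where c: "(pderiv ^^ m) P = [:c:]" using degree_eq_zeroE by blast
  have "c = coeff ((pderiv ^^ m) P) 0" by (simp add: c)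
  also have "\<dots> = fact m * coeff P m" by (simp add: coeff_higher_pderiv pochhammer_fact[symmetric])
  also have "coeff P m = divdiff_set (D 0) X" using coeff_interp[OF X(1) Xne, of "D 0"] X(2) by (simp add: P_def)
  finally have c': "c = fact m * divdiff_set (D 0) X" .
  show "\<exists>\<xi>\<in>{l..r}. D m \<xi> = fact m * divdiff_set (D 0) X"
    using zero[of m] by (auto simp: E_def c c')
  assume w: "\<And>s t. s \<in> {l..r} \<Longrightarrow> t \<in> {l..r} \<Longrightarrow> \<bar>D m s - D m t\<bar> \<le> w" and "k \<le> m" "t \<in> {l..r}"
  have lr: "l \<le> r" using X(3,4) by auto
  have "\<forall>t\<in>{l..r}. \<bar>E k t\<bar> \<le> w * (r - l) ^ (m - k)"
    using \<open>k \<le> m\<close>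
  proof (induction rule: inc_induct)
    case base
    obtain z where z: "z \<in> {l..r}" "E m z = 0" using zero[of m] by auto
    then show ?case using w[OF _ z(1)] by (auto simp: E_def c)
  next
    case (step k)
    obtain z where z: "z \<in> {l..r}" "E k z = 0" using zero[of k] step.hyps by auto
    have mvt: "\<bar>E k y - E k x\<bar> \<le> (r - l) * (w * (r - l) ^ (m - Suc k))" if xy: "x < y" "x \<in> {l..r}" "y \<in> {l..r}" for x y
    proof -
      obtain \<xi> where \<xi>: "x < \<xi>" "\<xi> < y" "E k y - E k x = (y - x) * E (Suc k) \<xi>"
        using MVT2[OF xy(1), of "E k" "E (Suc k)"] dE[of k] step.hyps by auto
      have "\<bar>E k y - E k x\<bar> = (y - x) * \<bar>E (Suc k) \<xi>\<bar>" using \<xi> by (simp add: abs_mult)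
      also have "\<dots> \<le> (r - l) * (w * (r - l) ^ (m - Suc k))"
        using step.IH \<xi> xy by (intro mult_mono) auto
      finally show ?thesis .
    qed
    have "(r - l) * (w * (r - l) ^ (m - Suc k)) = w * (r - l) ^ (m - k)"
      using step.hyps by (simp add: Suc_diff_Suc[symmetric] mult_ac)
    note mvt = mvt[unfolded this]
    show ?case
    proof
      fix t assume t: "t \<in> {l..r}"
      have "0 \<le> w" using w[of l l] lr by auto
      then have "0 \<le> w * (r - l) ^ (m - k)" using lr by simp
      then show "\<bar>E k t\<bar> \<le> w * (r - l) ^ (m - k)"
        using mvt[of t z] mvt[of z t] t z by (cases t z rule: linorder_cases) auto
    qed
  qed
  then show "\<bar>D k t - polyder k (interp X (D 0)) t\<bar> \<le> w * (r - l) ^ (m - k)"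
    using \<open>t \<in> {l..r}\<close> by (simp add: E_def P_def)
qed

text \<open>The set where u and v differ is open and contained in a null set. For a C^m curve this
  turns almost-everywhere horizontality into an identity at every point.\<close>

lemma AE_eq_continuous_imp_eq:
  fixes u v :: "real \<Rightarrow> real"
  assumes "AE x in lborel. u x = v x" "continuous_on UNIV u" "continuous_on UNIV v"
  shows "u x = v x"
proof (rule ccontr)
  assume ne: "u x \<noteq> v x"
  define S where "S = {x. u x \<noteq> v x}"
  have "open S" unfolding S_def using assms(2,3) by (intro open_Collect_neq)
  moreover have "S \<noteq> {}" using ne by (auto simp: S_def)
  ultimately have "\<not> negligible S" by (rule open_not_negligible)
  moreover obtain N where N: "N \<in> null_sets lborel" "\<And>x. x \<in> space lborel - N \<Longrightarrow> u x = v x"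
    by (rule AE_E3[OF assms(1)]) (rule that)
  moreover have "S \<subseteq> N" using N(2) by (auto simp: S_def)
  moreover have "negligible N" using N(1) by (simp add: negligible_iff_null_sets null_sets_completionI)
  ultimately show False using negligible_subset by blast
qed

lemma compact_subset_Icc:
  assumes "compact (K :: real set)"
  obtains R where "R > 0" "K \<subseteq> {-R<..<R}"
proof -
  obtain B where B: "\<And>x. x \<in> K \<Longrightarrow> \<bar>x\<bar> \<le> B"
    using compact_imp_bounded[OF assms] by (auto simp: bounded_iff)
  have "K \<subseteq> {-(\<bar>B\<bar> + 1)<..<\<bar>B\<bar> + 1}" using B by force
  then show thesis by (intro that[of "\<bar>B\<bar> + 1"]) auto
qed

lemma finite_hull:
  assumes "finite (X :: real set)" "X \<noteq> {}"
  shows "X \<subseteq> {Min X..Max X}" "Min X \<in> X" "Max X \<in> X" "diameter X = Max X - Min X"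
proof -
  show 1: "X \<subseteq> {Min X..Max X}" "Min X \<in> X" "Max X \<in> X" using assms by auto
  have "diameter X \<le> Max X - Min X"
  proof (rule diameter_le)
    fix x y assume "x \<in> X" "y \<in> X"
    then have "x \<in> {Min X..Max X}" "y \<in> {Min X..Max X}" using 1 by blast+
    then show "norm (x - y) \<le> Max X - Min X" by auto
  qed (use assms in auto)
  moreover have "Max X - Min X \<le> diameter X" using abs_diff_le_diameter[OF assms(1) 1(3) 1(2)] by simp
  ultimately show "diameter X = Max X - Min X" by simp
qed

text \<open>Divided differences on X and Y are values of D m / m! at points of the hull of X
  \<union> Y, and D m is uniformly continuous on a compact interval.\<close>

lemma Cm_imp_dd_unif_conv:
  fixes D :: "nat \<Rightarrow> real \<Rightarrow> real"
  assumes K: "compact K" and D: "\<And>k x. k < m \<Longrightarrow> (D k has_real_derivative D (Suc k) x) (at x)" "continuous_on UNIV (D m)"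
    and eq: "\<And>x. x \<in> K \<Longrightarrow> D 0 x = f x"
  shows "dd_unif_conv m K f"
  unfolding dd_unif_conv_def
proof (intro allI impI)
  fix \<epsilon> :: real assume \<epsilon>: "\<epsilon> > 0"
  obtain R where R: "R > 0" "K \<subseteq> {-R<..<R}" using compact_subset_Icc[OF K] by blast
  have "uniformly_continuous_on {-R..R} (D m)"
    using D(2) by (intro compact_uniformly_continuous) (auto intro: continuous_on_subset)
  then obtain \<delta> where \<delta>: "\<delta> > 0" "\<And>s t. s \<in> {-R..R} \<Longrightarrow> t \<in> {-R..R} \<Longrightarrow> \<bar>s - t\<bar> < \<delta> \<Longrightarrow> \<bar>D m s - D m t\<bar> < \<epsilon>"
    using \<epsilon> unfolding uniformly_continuous_on_def dist_real_def by metis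
  show "\<exists>\<delta>>0. \<forall>X Y. X \<subseteq> K \<and> Y \<subseteq> K \<and> finite X \<and> finite Y \<and>
        card X = m + 1 \<and> card Y = m + 1 \<and> diameter (X \<union> Y) < \<delta>
        \<longrightarrow> \<bar>divdiff_set f X - divdiff_set f Y\<bar> < \<epsilon>"
  proof (intro exI[of _ \<delta>] conjI allI impI \<delta>(1))
    fix X Y assume XY: "X \<subseteq> K \<and> Y \<subseteq> K \<and> finite X \<and> finite Y \<and> card X = m + 1 \<and> card Y = m + 1 \<and> diameter (X \<union> Y) < \<delta>"
    then have ne: "X \<noteq> {}" "Y \<noteq> {}" "X \<union> Y \<noteq> {}" by auto
    have fin: "finite X" "finite Y" "finite (X \<union> Y)" using XY by auto
    have dd: "\<exists>\<xi>\<in>{Min (X \<union> Y)..Max (X \<union> Y)}. D m \<xi> = fact m * divdiff_set f Z" if Z: "Z \<subseteq> X \<union> Y" "finite Z" "card Z = m + 1" for Z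
    proof -
      have Zne: "Z \<noteq> {}" using Z by auto
      have "divdiff_set (D 0) Z = divdiff_set f Z"
        using interp_cong[OF Z(2) Zne, of "D 0" f] coeff_interp[OF Z(2) Zne] eq Z(1) XY by (metis UnE subsetD)
      moreover obtain \<xi> where "\<xi> \<in> {Min Z..Max Z}" "D m \<xi> = fact m * divdiff_set (D 0) Z"
        using interp_error_top[where m = m and D = D, OF D(1) Z(2) Z(3)[unfolded Suc_eq_plus1[symmetric]] finite_hull(1-3)[OF Z(2) Zne]] by blast
      moreover have "Min (X \<union> Y) \<le> Min Z" "Max Z \<le> Max (X \<union> Y)" using Z(1) Zne fin
        by (auto intro: Min_antimono Max_mono)
      ultimately show ?thesis by force
    qed
    obtain x where x: "x \<in> {Min (X \<union> Y)..Max (X \<union> Y)}" "D m x = fact m * divdiff_set f X" using dd[of X] XY by auto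
    obtain y where y: "y \<in> {Min (X \<union> Y)..Max (X \<union> Y)}" "D m y = fact m * divdiff_set f Y" using dd[of Y] XY by auto
    have "Min (X \<union> Y) \<in> K" "Max (X \<union> Y) \<in> K" using finite_hull(2,3)[OF fin(3) ne(3)] XY by blast+
    then have R': "-R < Min (X \<union> Y)" "Max (X \<union> Y) < R" using R by auto
    have "\<bar>x - y\<bar> < \<delta>" using x y finite_hull(4)[OF fin(3) ne(3)] XY by auto
    then have "\<bar>D m x - D m y\<bar> < \<epsilon>" using x y R' by (intro \<delta>(2)) auto
    then have "fact m * \<bar>divdiff_set f X - divdiff_set f Y\<bar> < \<epsilon>"
      unfolding x y by (simp add: abs_mult flip: right_diff_distrib)
    moreover have "1 * \<bar>divdiff_set f X - divdiff_set f Y\<bar> \<le> fact m * \<bar>divdiff_set f X - divdiff_set f Y\<bar>"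
      by (intro mult_right_mono fact_ge_1) auto
    ultimately show "\<bar>divdiff_set f X - divdiff_set f Y\<bar> < \<epsilon>" by simp
  qed
qed

text \<open>With d the diameter of X, \<open>area_diff_bound\<close> applies with error w d^m for
  the functions and w d^(m - 1) for their derivatives, and yields at most 2 w times
  \<open>V_disc\<close>.\<close>

lemma Cm_imp_discrete_AV:
  fixes DF DG :: "nat \<Rightarrow> real \<Rightarrow> real"
  assumes m: "m > 0" and K: "compact K"
    and DF: "\<And>k x. k < m \<Longrightarrow> (DF k has_real_derivative DF (Suc k) x) (at x)" "continuous_on UNIV (DF m)"
    and DG: "\<And>k x. k < m \<Longrightarrow> (DG k has_real_derivative DG (Suc k) x) (at x)" "continuous_on UNIV (DG m)"
    and H: "\<And>x. (H has_real_derivative 2 * (DF 1 x * DG 0 x - DF 0 x * DG 1 x)) (at x)"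
    and eq: "\<And>x. x \<in> K \<Longrightarrow> DF 0 x = f x" "\<And>x. x \<in> K \<Longrightarrow> DG 0 x = g x" "\<And>x. x \<in> K \<Longrightarrow> H x = h x"
  shows "discrete_AV m K f g h"
  unfolding discrete_AV_def
proof (intro allI impI)
  fix \<epsilon> :: real assume \<epsilon>: "\<epsilon> > 0"
  \<comment> \<open>The outcome is |A| <= 4 w V, so \<epsilon> / 8 leaves a strict inequality; w <=
    1 bounds w * w by w.\<close>
  define w where "w = min 1 (\<epsilon> / 8)"
  have w: "w > 0" "w \<le> 1" "w \<le> \<epsilon> / 8" using \<epsilon> by (auto simp: w_def)
  obtain R where R: "R > 0" "K \<subseteq> {-R<..<R}" using compact_subset_Icc[OF K] by blast
  have uc: "\<exists>\<delta>>0. \<forall>s\<in>{-R..R}. \<forall>t\<in>{-R..R}. \<bar>s - t\<bar> < \<delta> \<longrightarrow> \<bar>D s - D t\<bar> < w" if "continuous_on UNIV D" for D :: "real \<Rightarrow> real"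
  proof -
    have "uniformly_continuous_on {-R..R} D"
      using that by (intro compact_uniformly_continuous) (auto intro: continuous_on_subset)
    then show ?thesis using w(1) unfolding uniformly_continuous_on_def dist_real_def by metis
  qed
  obtain \<delta>1 \<delta>2 where \<delta>1: "\<delta>1 > 0" "\<forall>s\<in>{-R..R}. \<forall>t\<in>{-R..R}. \<bar>s - t\<bar> < \<delta>1 \<longrightarrow> \<bar>DF m s - DF m t\<bar> < w"
    and \<delta>2: "\<delta>2 > 0" "\<forall>s\<in>{-R..R}. \<forall>t\<in>{-R..R}. \<bar>s - t\<bar> < \<delta>2 \<longrightarrow> \<bar>DG m s - DG m t\<bar> < w"
    using uc[OF DF(2)] uc[OF DG(2)] by blast
  show "\<exists>\<delta>>0. \<forall>X a b. X \<subseteq> K \<and> finite X \<and> card X = m + 1 \<and> a \<in> X \<and> b \<in> X \<and> a < b \<and>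
        diameter X < \<delta> \<longrightarrow> \<bar>A_disc X f g h a b / V_disc m X f g a b\<bar> < \<epsilon>"
  proof (intro exI[of _ "min \<delta>1 \<delta>2"] conjI allI impI)
    fix X a b assume X: "X \<subseteq> K \<and> finite X \<and> card X = m + 1 \<and> a \<in> X \<and> b \<in> X \<and> a < b \<and> diameter X < min \<delta>1 \<delta>2"
    have fin: "finite X" and Xne: "X \<noteq> {}" using X by auto
    define l where "l = Min X"
    define r where "r = Max X"
    note hull = finite_hull[OF fin Xne, folded l_def r_def]
    have lr: "-R < l" "r < R" using R(2) X hull by auto
    define d where "d = diameter X"
    have d: "d > 0" "d = r - l" using diameter_pos[OF fin, of m] X m hull by (auto simp: d_def)
    have cX: "card X = Suc m" using X by simp
    define P where "P = interp X f"
    define Q where "Q = interp X g"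
    have PQ: "P = interp X (DF 0)" "Q = interp X (DG 0)" unfolding P_def Q_def
      using eq X by (auto intro!: interp_cong[OF fin Xne])
    have "\<bar>DF m s - DF m t\<bar> \<le> w" if "s \<in> {l..r}" "t \<in> {l..r}" for s t
      using \<delta>1(2)[rule_format, of s t] that lr X d by (force simp: d_def)
    from interp_error_bound[OF DF(1) fin cX hull(1-3) this]
    have eF: "\<bar>DF k t - polyder k P t\<bar> \<le> w * d ^ (m - k)" if "k \<le> m" "t \<in> {l..r}" for k t
      using that d(2) by (simp add: PQ)
    have "\<bar>DG m s - DG m t\<bar> \<le> w" if "s \<in> {l..r}" "t \<in> {l..r}" for s t
      using \<delta>2(2)[rule_format, of s t] that lr X d by (force simp: d_def)
    from interp_error_bound[OF DG(1) fin cX hull(1-3) this]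
    have eG: "\<bar>DG k t - polyder k Q t\<bar> \<le> w * d ^ (m - k)" if "k \<le> m" "t \<in> {l..r}" for k t
      using that d(2) by (simp add: PQ)
    have ab: "a \<in> {l..r}" "b \<in> {l..r}" "a < b" "{a..b} \<subseteq> {l..r}" using X hull(1) by auto
    have bad: "b - a \<le> d" using ab d by auto
    \<comment> \<open>For m = 1 order 1 is the top order, continuous by assumption; otherwise it is
      differentiable.\<close>
    have cont: "continuous_on UNIV (DF 1)" "continuous_on UNIV (DG 1)"
    proof -
      have "continuous_on UNIV (D 1)"
        if "\<And>k x. k < m \<Longrightarrow> (D k has_real_derivative D (Suc k) x) (at x)" "continuous_on UNIV (D m)"
        for D :: "nat \<Rightarrow> real \<Rightarrow> real"
      proof (cases "m = 1")
        case False
        then show ?thesis using m that(1)[of 1]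
          by (intro continuous_at_imp_continuous_on ballI DERIV_isCont) auto
      qed (use that in simp)
      note c1 = this
      show "continuous_on UNIV (DF 1)" by (rule c1[of DF]) (use DF in auto)
      show "continuous_on UNIV (DG 1)" by (rule c1[of DG]) (use DG in auto)
    qed
    define I where "I = variation a b P Q"
    have I0: "0 \<le> I" unfolding I_def by (intro integral_nonneg integrable_continuous_real continuous_intros) auto
    have endsF: "DF 0 x = poly P x" "DG 0 x = poly Q x" if "x \<in> X" for x
      using that X eq by (auto simp: P_def Q_def poly_interp[OF fin Xne])
    have dif0: "\<bar>integral {a..b} (\<lambda>t. DF 1 t * DG 0 t - DG 1 t * DF 0 t) -
          area a b P Q\<bar>
       \<le> 2 * (w * d ^ m) * I + 2 * (w * d ^ m) * (w * d ^ (m - 1)) * (b - a)"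
      unfolding I_def
    proof (rule area_diff_bound)
      fix t assume "t \<in> {a..b}"
      then have t: "t \<in> {l..r}" using ab by auto
      show "\<bar>DF 0 t - poly P t\<bar> \<le> w * d ^ m" "\<bar>DG 0 t - poly Q t\<bar> \<le> w * d ^ m"
        "\<bar>DF 1 t - poly (pderiv P) t\<bar> \<le> w * d ^ (m - 1)" "\<bar>DG 1 t - poly (pderiv Q) t\<bar> \<le> w * d ^ (m - 1)"
        using eF[of 0 t] eG[of 0 t] eF[of 1 t] eG[of 1 t] t m by auto
      show "(DF 0 has_real_derivative DF 1 t) (at t within {a..b})" "(DG 0 has_real_derivative DG 1 t) (at t within {a..b})"
        using DF(1)[of 0 t] DG(1)[of 0 t] m by (auto intro: has_field_derivative_at_within)
    qed (use ab cont endsF X in \<open>auto intro!: DERIV_subset[OF poly_DERIV] continuous_intros intro: continuous_on_subset\<close>)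
    have dm: "d ^ (m - 1) * d = d ^ m" using m by (metis power_minus_mult)
    have "2 * (w * d ^ m) * (w * d ^ (m - 1)) * (b - a) \<le> 2 * (w * d ^ m) * (w * d ^ (m - 1)) * d"
      using w d bad by (intro mult_left_mono) auto
    also have "\<dots> = 2 * (w * w) * (d ^ m * (d ^ (m - 1) * d))" by simp
    also have "\<dots> \<le> 2 * (w * 1) * (d ^ m * d ^ m)"
      unfolding dm using w d by (intro mult_left_mono mult_right_mono) auto
    finally have "2 * (w * d ^ m) * (w * d ^ (m - 1)) * (b - a) \<le> 2 * w * (d ^ m * d ^ m)" by simp
    moreover have "2 * (w * d ^ m) * I + 2 * w * (d ^ m * d ^ m) = 2 * w * (d ^ (2 * m) + d ^ m * I)"
    proof -
      have "d ^ (2 * m) = d ^ m * d ^ m" by (simp only: mult_2 power_add)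
      then show ?thesis by (simp add: algebra_simps)
    qed
    ultimately have dif: "\<bar>integral {a..b} (\<lambda>t. DF 1 t * DG 0 t - DG 1 t * DF 0 t) -
          area a b P Q\<bar> \<le> 2 * w * (d ^ (2 * m) + d ^ m * I)"
      using dif0 by linarith
    have V: "V_disc m X f g a b = d ^ (2 * m) + d ^ m * I" by (simp add: V_disc_interp d_def I_def P_def Q_def)
    have Vpos: "V_disc m X f g a b > 0" by (rule V_disc_pos) (use X m in auto)
    have "((\<lambda>t. 2 * (DF 1 t * DG 0 t - DF 0 t * DG 1 t)) has_integral H b - H a) {a..b}"
      using ab H by (intro fundamental_theorem_of_calculus)
        (auto simp flip: has_real_derivative_iff_has_vector_derivative intro: has_field_derivative_at_within)
    then have "h b - h a = integral {a..b} (\<lambda>t. 2 * (DF 1 t * DG 0 t - DG 1 t * DF 0 t))"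
      using eq(3) X by (auto simp: integral_unique mult.commute subset_iff)
    also have "\<dots> = 2 * integral {a..b} (\<lambda>t. DF 1 t * DG 0 t - DG 1 t * DF 0 t)" by (rule integral_mult_right)
    finally have hh: "h b - h a = 2 * integral {a..b} (\<lambda>t. DF 1 t * DG 0 t - DG 1 t * DF 0 t)" .
    have "\<bar>A_disc X f g h a b\<bar> = 2 * \<bar>integral {a..b} (\<lambda>t. DF 1 t * DG 0 t - DG 1 t * DF 0 t) -
          area a b P Q\<bar>"
    proof -
      have *: "\<bar>2 * x - 2 * y\<bar> = 2 * \<bar>x - y\<bar>" for x y :: real
        unfolding right_diff_distrib[symmetric] abs_mult by simp
      show ?thesis unfolding A_disc_interp hh P_def[symmetric] Q_def[symmetric] by (rule *)
    qed
    also have "\<dots> \<le> 4 * w * V_disc m X f g a b" using dif unfolding V by simp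
    also have "\<dots> \<le> 4 * (\<epsilon> / 8) * V_disc m X f g a b" using w Vpos by (intro mult_right_mono) auto
    also have "\<dots> < \<epsilon> * V_disc m X f g a b" using \<epsilon> Vpos by simp
    finally show "\<bar>A_disc X f g h a b / V_disc m X f g a b\<bar> < \<epsilon>" using Vpos by (simp add: pos_divide_less_eq)
  qed (use \<delta>1 \<delta>2 in auto)
qed

lemma CmH_necessary:
  assumes m: "m > 0" and K: "compact K" and ext: "CmH m K f g h"
  shows "dd_unif_conv m K f" "dd_unif_conv m K g" "dd_unif_conv m K h" "discrete_AV m K f g h"
proof -
  obtain F G H where FGH: "Cm m F" "Cm m G" "Cm m H" "horizontal F G H" "\<And>x. x \<in> K \<Longrightarrow> F x = f x \<and> G x = g x \<and> H x = h x"
    using ext unfolding CmH_def by blast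
  obtain DF :: "nat \<Rightarrow> real \<Rightarrow> real" where DF: "DF 0 = F" "\<And>k x. k < m \<Longrightarrow> (DF k has_real_derivative DF (Suc k) x) (at x)" "continuous_on UNIV (DF m)"
    using FGH(1) unfolding Cm_def by blast
  obtain DG :: "nat \<Rightarrow> real \<Rightarrow> real" where DG: "DG 0 = G" "\<And>k x. k < m \<Longrightarrow> (DG k has_real_derivative DG (Suc k) x) (at x)" "continuous_on UNIV (DG m)"
    using FGH(2) unfolding Cm_def by blast
  obtain DH :: "nat \<Rightarrow> real \<Rightarrow> real" where DH: "DH 0 = H" "\<And>k x. k < m \<Longrightarrow> (DH k has_real_derivative DH (Suc k) x) (at x)" "continuous_on UNIV (DH m)"
    using FGH(3) unfolding Cm_def by blast
  have cont: "continuous_on UNIV (D k)" if "\<And>k x. k < m \<Longrightarrow> (D k has_real_derivative D (Suc k) x) (at x)" "continuous_on UNIV (D m)" "k \<le> m"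
    for D :: "nat \<Rightarrow> real \<Rightarrow> real" and k
  proof (cases "k = m")
    case False
    then have "k < m" using that(3) by simp
    then show ?thesis using that(1) by (meson DERIV_isCont continuous_at_imp_continuous_on)
  qed (use that(2) in simp)
  show "dd_unif_conv m K f" by (rule Cm_imp_dd_unif_conv[where D = DF]) (use K DF FGH(5) in auto)
  show "dd_unif_conv m K g" by (rule Cm_imp_dd_unif_conv[where D = DG]) (use K DG FGH(5) in auto)
  show "dd_unif_conv m K h" by (rule Cm_imp_dd_unif_conv[where D = DH]) (use K DH FGH(5) in auto)
  have dF: "(F has_real_derivative DF 1 x) (at x)" and dG: "(G has_real_derivative DG 1 x) (at x)"
    and dH: "(H has_real_derivative DH 1 x) (at x)" for x
    using DF(2)[of 0 x] DG(2)[of 0 x] DH(2)[of 0 x] m DF(1) DG(1) DH(1) by auto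
  note der = DERIV_imp_deriv[OF dF] DERIV_imp_deriv[OF dG] DERIV_imp_deriv[OF dH]
  have "AE x in lborel. F differentiable (at x) \<and> G differentiable (at x) \<and> H differentiable (at x) \<and>
      deriv H x = 2 * (deriv F x * G x - F x * deriv G x)"
    using FGH(4) unfolding horizontal_def by blast
  then have "AE x in lborel. DH 1 x = 2 * (DF 1 x * DG 0 x - DF 0 x * DG 1 x)"
    unfolding der DF(1) DG(1) by (rule eventually_mono) blast
  moreover have "continuous_on UNIV (DH 1)" by (rule cont[of DH, OF DH(2,3)]) (use m in auto)
  moreover have "continuous_on UNIV (\<lambda>x. 2 * (DF 1 x * DG 0 x - DF 0 x * DG 1 x))"
    by (intro continuous_intros cont[of DF, OF DF(2,3)] cont[of DG, OF DG(2,3)]) (use m in auto)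
  ultimately have "DH 1 x = 2 * (DF 1 x * DG 0 x - DF 0 x * DG 1 x)" for x by (rule AE_eq_continuous_imp_eq)
  then have "(H has_real_derivative 2 * (DF 1 x * DG 0 x - DF 0 x * DG 1 x)) (at x)" for x using dH[of x] by simp
  then show "discrete_AV m K f g h"
    by (intro Cm_imp_discrete_AV[where DF = DF and DG = DG and H = H] m K DF(2,3) DG(2,3)) (use FGH(5) DF(1) DG(1) in auto)
qed

section \<open>Sufficiency\<close>

text \<open>Compare through the interpolant on a node set containing both x and y. At y its k-th
  derivative is close to that of the Taylor polynomial based at y, which is J k y, and to that of
  the Taylor polynomial based at x.\<close>

lemma jet_whitney:
  assumes m: "m > 0" and lim: "\<And>x. x \<in> N \<Longrightarrow> x islimpt N" and J: "jet_of m N f J" and e: "e > 0"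
  shows "\<exists>\<delta>>0. \<forall>x\<in>N. \<forall>y\<in>N. \<forall>k\<le>m. \<bar>y - x\<bar> < \<delta> \<longrightarrow>
     \<bar>J k y - polyder k (taylor_poly m J x) y\<bar> \<le> e * \<bar>y - x\<bar> ^ (m - k)"
proof -
  \<comment> \<open>Two comparisons, each on a node set of diameter at most 4 |y - x|.\<close>
  define s where "s = e / (2 * 4 ^ m)"
  have s: "s > 0" using e by (simp add: s_def)
  obtain \<delta> where \<delta>: "\<delta> > 0" and J': "jet_close m N f J s \<delta>"
    using conjunct2[OF J[unfolded jet_of_def], THEN spec, THEN mp, OF s] by (elim exE conjE) (rule that)
  show ?thesis
  proof (intro exI[of _ "\<delta> / 4"] conjI ballI allI impI)
    fix x y k assume x: "x \<in> N" and y: "y \<in> N" and k: "k \<le> m" and xy: "\<bar>y - x\<bar> < \<delta> / 4"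
    show "\<bar>J k y - polyder k (taylor_poly m J x) y\<bar> \<le> e * \<bar>y - x\<bar> ^ (m - k)"
    proof (cases "x = y")
      case True
      then show ?thesis using e k by (simp add: poly_higher_pderiv_taylor_poly)
    next
      case False
      obtain X where X: "X \<subseteq> N" "finite X" "card X = Suc m" "x \<in> X" "y \<in> X" "\<bar>x - y\<bar> \<le> diameter X" "diameter X \<le> 4 * \<bar>x - y\<bar>"
        by (rule common_nodes[OF m lim x y False])
      define d where "d = \<bar>y - x\<bar>"
      have D: "0 \<le> diameter X" "diameter X < \<delta>" "diameter X \<le> 4 * d" "\<bar>y - x\<bar> \<le> diameter X"
        using X(6,7) xy by (auto simp: d_def abs_minus_commute)
      have "\<bar>polyder k (interp X f) y - J k y\<bar> \<le> s * diameter X ^ (m - k)"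
        using J'[rule_format, of X y k y] X D k by (simp add: poly_higher_pderiv_taylor_poly)
      moreover have "\<bar>polyder k (interp X f) y - polyder k (taylor_poly m J x) y\<bar> \<le> s * diameter X ^ (m - k)"
        using J'[rule_format, of X x k y] X D k by simp
      ultimately have "\<bar>J k y - polyder k (taylor_poly m J x) y\<bar> \<le> 2 * s * diameter X ^ (m - k)"
        by linarith
      also have "\<dots> \<le> 2 * s * (4 ^ m * d ^ (m - k))"
      proof (rule mult_left_mono)
        have "diameter X ^ (m - k) \<le> (4 * d) ^ (m - k)" using D by (intro power_mono) auto
        also have "\<dots> = 4 ^ (m - k) * d ^ (m - k)" by (rule power_mult_distrib)
        also have "\<dots> \<le> 4 ^ m * d ^ (m - k)" by (intro mult_right_mono power_increasing) (auto simp: d_def)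
        finally show "diameter X ^ (m - k) \<le> 4 ^ m * d ^ (m - k)" .
      qed (use s in auto)
      also have "\<dots> = e * \<bar>y - x\<bar> ^ (m - k)" by (simp add: s_def d_def)
      finally show ?thesis .
    qed
  qed (use \<delta> in auto)
qed

lemma jet_continuous_on:
  assumes m: "m > 0" and lim: "\<And>x. x \<in> N \<Longrightarrow> x islimpt N" and J: "jet_of m N f J"
  shows "continuous_on N (J m)"
  unfolding continuous_on_iff dist_real_def
proof (intro ballI allI impI)
  fix x e :: real assume x: "x \<in> N" and e: "e > 0"
  have "\<exists>\<delta>>0. \<forall>x\<in>N. \<forall>y\<in>N. \<forall>k\<le>m. \<bar>y - x\<bar> < \<delta> \<longrightarrow>
     \<bar>J k y - polyder k (taylor_poly m J x) y\<bar> \<le> e / 2 * \<bar>y - x\<bar> ^ (m - k)"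
    by (rule jet_whitney[OF m lim J]) (use e in auto)
  then obtain \<delta> where \<delta>: "\<delta> > 0" and w: "\<forall>x\<in>N. \<forall>y\<in>N. \<forall>k\<le>m. \<bar>y - x\<bar> < \<delta> \<longrightarrow>
     \<bar>J k y - polyder k (taylor_poly m J x) y\<bar> \<le> e / 2 * \<bar>y - x\<bar> ^ (m - k)" by (elim exE conjE) (rule that)
  show "\<exists>d>0. \<forall>x'\<in>N. \<bar>x' - x\<bar> < d \<longrightarrow> \<bar>J m x' - J m x\<bar> < e"
  proof (intro exI[of _ \<delta>] conjI ballI impI \<delta>)
    fix y assume "y \<in> N" "\<bar>y - x\<bar> < \<delta>"
    then have "\<bar>J m y - J m x\<bar> \<le> e / 2" using w[rule_format, OF x, of y m] by (simp add: top_pderiv_taylor_poly)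
    then show "\<bar>J m y - J m x\<bar> < e" using e by linarith
  qed
qed

text \<open>For k < m the exponent m - k is at least 1, so Whitney's remainder is o(|y - x|) and the
  Taylor polynomial at x supplies the derivative.\<close>

lemma jet_has_derivative:
  assumes m: "m > 0" and lim: "\<And>x. x \<in> N \<Longrightarrow> x islimpt N" and J: "jet_of m N f J" and x: "x \<in> N" and k: "k < m"
  shows "(J k has_real_derivative J (Suc k) x) (at x within N)"
  unfolding has_real_derivative_within_alt
proof (intro allI impI)
  fix e :: real assume e: "e > 0"
  let ?T = "(pderiv ^^ k) (taylor_poly m J x)"
  have "\<exists>\<delta>>0. \<forall>x\<in>N. \<forall>y\<in>N. \<forall>k\<le>m. \<bar>y - x\<bar> < \<delta> \<longrightarrow>
     \<bar>J k y - polyder k (taylor_poly m J x) y\<bar> \<le> e / 2 * \<bar>y - x\<bar> ^ (m - k)"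
    by (rule jet_whitney[OF m lim J]) (use e in auto)
  then obtain \<delta> where \<delta>: "\<delta> > 0" and w: "\<forall>x\<in>N. \<forall>y\<in>N. \<forall>k\<le>m. \<bar>y - x\<bar> < \<delta> \<longrightarrow>
     \<bar>J k y - polyder k (taylor_poly m J x) y\<bar> \<le> e / 2 * \<bar>y - x\<bar> ^ (m - k)" by (elim exE conjE) (rule that)
  have at_x: "poly ?T x = J k x" "poly (pderiv ?T) x = J (Suc k) x"
    using poly_higher_pderiv_taylor_poly[of k m J x] poly_higher_pderiv_taylor_poly[of "Suc k" m J x] k by auto
  have "(poly ?T has_real_derivative J (Suc k) x) (at x)" unfolding at_x(2)[symmetric] by (rule poly_DERIV)
  then obtain d where d: "d > 0" "\<And>y. \<bar>y - x\<bar> < d \<Longrightarrow> \<bar>poly ?T y - poly ?T x - J (Suc k) x * (y - x)\<bar> \<le> e / 2 * \<bar>y - x\<bar>"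
    unfolding has_real_derivative_within_alt using half_gt_zero[OF e] by (metis UNIV_I)
  show "\<exists>d>0. \<forall>y\<in>N. \<bar>y - x\<bar> < d \<longrightarrow> \<bar>J k y - J k x - J (Suc k) x * (y - x)\<bar> \<le> e * \<bar>y - x\<bar>"
  proof (intro exI[of _ "min 1 (min d \<delta>)"] conjI ballI impI)
    fix y assume y: "y \<in> N" "\<bar>y - x\<bar> < min 1 (min d \<delta>)"
    obtain j where j: "m - k = Suc j" using k by (metis Suc_diff_Suc)
    have "\<bar>y - x\<bar> ^ (m - k) \<le> \<bar>y - x\<bar> * 1" unfolding j power_Suc using y
      by (intro mult_left_mono power_le_one) auto
    then have "e / 2 * \<bar>y - x\<bar> ^ (m - k) \<le> e / 2 * \<bar>y - x\<bar>" using e by (intro mult_left_mono) auto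
    then have 1: "\<bar>J k y - poly ?T y\<bar> \<le> e / 2 * \<bar>y - x\<bar>"
      using w[rule_format, OF x y(1), of k] y(2) k by simp
    have 2: "\<bar>poly ?T y - J k x - J (Suc k) x * (y - x)\<bar> \<le> e / 2 * \<bar>y - x\<bar>" using d(2)[of y] y(2) at_x by simp
    have "\<bar>J k y - J k x - J (Suc k) x * (y - x)\<bar> \<le> e / 2 * \<bar>y - x\<bar> + e / 2 * \<bar>y - x\<bar>"
      using 1 2 by linarith
    then show "\<bar>J k y - J k x - J (Suc k) x * (y - x)\<bar> \<le> e * \<bar>y - x\<bar>" by simp
  qed (use d \<delta> in auto)
qed

text \<open>The orders 0 and 1 are those in the area integrand; near x the Taylor polynomial and its
  derivative are almost constant.\<close>

lemma interp_near_jet: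
  assumes m: "m > 0" and J: "jet_of m N f J" and x: "x \<in> N" and e: "e > 0"
  shows "\<exists>\<delta>>0. \<forall>X t. X \<subseteq> N \<and> finite X \<and> card X = Suc m \<and> diameter X < \<delta> \<and> x \<in> X \<and> \<bar>t - x\<bar> \<le> diameter X \<longrightarrow>
     \<bar>poly (interp X f) t - J 0 x\<bar> \<le> e \<and> \<bar>poly (pderiv (interp X f)) t - J 1 x\<bar> \<le> e"
proof -
  have e2: "e / 2 > 0" using e by simp
  obtain \<delta> where \<delta>: "\<delta> > 0" and J': "jet_close m N f J (e / 2) \<delta>"
    using conjunct2[OF J[unfolded jet_of_def], THEN spec, THEN mp, OF e2] by (elim exE conjE) (rule that)
  let ?T = "taylor_poly m J x"
  have at_x: "poly ?T x = J 0 x" "poly (pderiv ?T) x = J 1 x"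
    using poly_higher_pderiv_taylor_poly[of 0 m J x] poly_higher_pderiv_taylor_poly[of 1 m J x] m by auto
  have "isCont (poly ?T) x" "isCont (poly (pderiv ?T)) x" by (rule poly_isCont)+
  then obtain d1 d2 where d1: "d1 > 0" "\<And>t. \<bar>t - x\<bar> < d1 \<Longrightarrow> \<bar>poly ?T t - J 0 x\<bar> < e / 2"
    and d2: "d2 > 0" "\<And>t. \<bar>t - x\<bar> < d2 \<Longrightarrow> \<bar>poly (pderiv ?T) t - J 1 x\<bar> < e / 2"
    unfolding continuous_at_eps_delta dist_real_def at_x using e2 by metis
  show ?thesis
  proof (rule exI[of _ "min 1 (min \<delta> (min d1 d2))"], intro conjI allI impI)
    fix X t
    assume X: "X \<subseteq> N \<and> finite X \<and> card X = Suc m \<and> diameter X < min 1 (min \<delta> (min d1 d2)) \<and> x \<in> X \<and> \<bar>t - x\<bar> \<le> diameter X"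
    have D: "0 \<le> diameter X" using X by linarith
    have pw: "e / 2 * diameter X ^ j \<le> e / 2" for j
      using X D e power_le_one[of "diameter X" j] by (simp add: mult_left_le)
    have "\<bar>poly (interp X f) t - poly ?T t\<bar> \<le> e / 2"
      using J'[rule_format, of X x 0 t] X pw[of m] by auto
    moreover have "\<bar>poly ?T t - J 0 x\<bar> < e / 2" using d1(2)[of t] X by auto
    ultimately show "\<bar>poly (interp X f) t - J 0 x\<bar> \<le> e" by linarith
    have "\<bar>poly (pderiv (interp X f)) t - poly (pderiv ?T) t\<bar> \<le> e / 2"
      using J'[rule_format, of X x 1 t] X pw[of "m - 1"] m by auto
    moreover have "\<bar>poly (pderiv ?T) t - J 1 x\<bar> < e / 2" using d2(2)[of t] X by auto
    ultimately show "\<bar>poly (pderiv (interp X f)) t - J 1 x\<bar> \<le> e" by linarith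
  qed (use \<delta> d1 d2 in auto)
qed

text \<open>By the A/V condition h b - h a is twice the area of the interpolants up to s * V, and V
  is O(b - a) near x. The area integrand is uniformly close to its value c0 at the jet of x, so the
  difference quotient tends to 2 c0.\<close>

lemma height_has_derivative:
  assumes m: "m > 0" and lim: "\<And>x. x \<in> N \<Longrightarrow> x islimpt N"
    and J: "jet_of m N f J" and I: "jet_of m N g I" and AV: "discrete_AV m N f g h" and x: "x \<in> N"
  shows "(h has_real_derivative 2 * (J 1 x * I 0 x - J 0 x * I 1 x)) (at x within N)"
  unfolding has_real_derivative_within_alt
proof (intro allI impI)
  fix e :: real assume e: "e > 0"
  define M where "M = 1 + \<bar>J 0 x\<bar> + \<bar>J 1 x\<bar> + \<bar>I 0 x\<bar> + \<bar>I 1 x\<bar>"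
  have M: "M \<ge> 1" "\<bar>J 0 x\<bar> \<le> M" "\<bar>J 1 x\<bar> \<le> M" "\<bar>I 0 x\<bar> \<le> M" "\<bar>I 1 x\<bar> \<le> M" by (auto simp: M_def)
  \<comment> \<open>The A/V condition contributes 6 M s (b - a) and the area twice that amount;
    together they must fit below e (b - a).\<close>
  define s where "s = min 1 (e / (24 * M))"
  have s: "s > 0" "s \<le> 1" "24 * M * s \<le> e" using e M
    by (auto simp: s_def min_def field_simps)
  obtain \<delta>1 where \<delta>1: "\<delta>1 > 0" and J': "\<forall>X t. X \<subseteq> N \<and> finite X \<and> card X = Suc m \<and> diameter X < \<delta>1 \<and> x \<in> X \<and> \<bar>t - x\<bar> \<le> diameter X \<longrightarrow>
     \<bar>poly (interp X f) t - J 0 x\<bar> \<le> s \<and> \<bar>poly (pderiv (interp X f)) t - J 1 x\<bar> \<le> s"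
    using interp_near_jet[OF m J x s(1)] by (elim exE conjE) (rule that)
  obtain \<delta>2 where \<delta>2: "\<delta>2 > 0" and I': "\<forall>X t. X \<subseteq> N \<and> finite X \<and> card X = Suc m \<and> diameter X < \<delta>2 \<and> x \<in> X \<and> \<bar>t - x\<bar> \<le> diameter X \<longrightarrow>
     \<bar>poly (interp X g) t - I 0 x\<bar> \<le> s \<and> \<bar>poly (pderiv (interp X g)) t - I 1 x\<bar> \<le> s"
    using interp_near_jet[OF m I x s(1)] by (elim exE conjE) (rule that)
  obtain \<delta>3 where \<delta>3: "\<delta>3 > 0" and AV': "\<forall>X a b. X \<subseteq> N \<and> finite X \<and> card X = m + 1 \<and> a \<in> X \<and> b \<in> X \<and> a < b \<and>
        diameter X < \<delta>3 \<longrightarrow> \<bar>A_disc X f g h a b / V_disc m X f g a b\<bar> < s"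
    using AV[unfolded discrete_AV_def, THEN spec, THEN mp, OF s(1)] by (elim exE conjE) (rule that)
  define c0 where "c0 = J 1 x * I 0 x - I 1 x * J 0 x"
  define \<delta> where "\<delta> = min 1 (min \<delta>1 (min \<delta>2 \<delta>3)) / 4"
  \<comment> \<open>Allowing x to be either end covers both one-sided difference quotients.\<close>
  have key: "\<bar>h b - h a - 2 * c0 * (b - a)\<bar> \<le> e * (b - a)"
    if ab: "a \<in> N" "b \<in> N" "a < b" "b - a < \<delta>" "x = a \<or> x = b" for a b
  proof -
    define d where "d = b - a"
    have d: "d > 0" using ab by (simp add: d_def)
    have ne: "a \<noteq> b" using ab by simp
    obtain X where X: "X \<subseteq> N" "finite X" "card X = Suc m" "a \<in> X" "b \<in> X" "\<bar>a - b\<bar> \<le> diameter X" "diameter X \<le> 4 * \<bar>a - b\<bar>"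
      by (rule common_nodes[OF m lim ab(1,2) ne])
    define D where "D = diameter X"
    have D: "d \<le> D" "D \<le> 4 * d" "D < \<delta>1" "D < \<delta>2" "D < \<delta>3" "D \<le> 1" "0 < D"
      using X(6,7) ab d by (auto simp: D_def d_def \<delta>_def)
    have xX: "x \<in> X" using ab(5) X by auto
    define P where "P = interp X f"
    define Q where "Q = interp X g"
    have near: "\<bar>poly P t - J 0 x\<bar> \<le> s" "\<bar>poly (pderiv P) t - J 1 x\<bar> \<le> s" "\<bar>poly Q t - I 0 x\<bar> \<le> s" "\<bar>poly (pderiv Q) t - I 1 x\<bar> \<le> s"
      if t: "t \<in> {a..b}" for t
    proof -
      have "\<bar>t - x\<bar> \<le> diameter X" using t ab(5) D(1) by (auto simp: D_def d_def)
      then show "\<bar>poly P t - J 0 x\<bar> \<le> s" "\<bar>poly (pderiv P) t - J 1 x\<bar> \<le> s" "\<bar>poly Q t - I 0 x\<bar> \<le> s" "\<bar>poly (pderiv Q) t - I 1 x\<bar> \<le> s"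
        using J'[rule_format, of X t] I'[rule_format, of X t] X xX D by (auto simp: P_def Q_def D_def)
    qed
    have prod: "\<bar>u * v - u0 * v0\<bar> \<le> 3 * M * s"
      if "\<bar>u - u0\<bar> \<le> s" "\<bar>v - v0\<bar> \<le> s" "\<bar>u0\<bar> \<le> M" "\<bar>v0\<bar> \<le> M" for u v u0 v0
    proof -
      have "u * v - u0 * v0 = (u - u0) * v + u0 * (v - v0)" by (simp add: algebra_simps)
      then have "\<bar>u * v - u0 * v0\<bar> \<le> \<bar>u - u0\<bar> * \<bar>v\<bar> + \<bar>u0\<bar> * \<bar>v - v0\<bar>"
        by (metis abs_mult abs_triangle_ineq)
      also have "\<dots> \<le> s * (2 * M) + M * s"
        using that s M by (intro add_mono mult_mono) auto
      finally show ?thesis by (simp add: algebra_simps)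
    qed
    have cl: "\<bar>(poly (pderiv P) t * poly Q t - poly (pderiv Q) t * poly P t) - c0\<bar> \<le> 6 * M * s" if t: "t \<in> {a..b}" for t
      using prod[OF near(2)[OF t] near(3)[OF t] M(3) M(4)] prod[OF near(4)[OF t] near(1)[OF t] M(5) M(2)]
      unfolding c0_def by linarith
    define A0 where "A0 = area a b P Q"
    have "A0 - c0 * (b - a) = integral {a..b} (\<lambda>t. (poly (pderiv P) t * poly Q t - poly (pderiv Q) t * poly P t) - c0)"
      unfolding A0_def using ab by (subst integral_diff) (auto intro!: integrable_continuous_real continuous_intros)
    also have "\<bar>\<dots>\<bar> \<le> integral {a..b} (\<lambda>t. 6 * M * s)"
      using cl integral_norm_bound_integral[of "\<lambda>t. (poly (pderiv P) t * poly Q t - poly (pderiv Q) t * poly P t) - c0" "{a..b}" "\<lambda>t. 6 * M * s"]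
      by (simp add: integrable_continuous_real continuous_intros)
    also have "\<dots> = 6 * M * s * d" using ab by (simp add: d_def)
    finally have A0: "\<bar>A0 - c0 * (b - a)\<bar> \<le> 6 * M * s * d" .
    define IP where "IP = variation a b P Q"
    have "IP \<le> integral {a..b} (\<lambda>t. 2 * M)" unfolding IP_def
    proof (intro integral_le integrable_continuous_real continuous_intros)
      fix t assume t: "t \<in> {a..b}"
      have "\<bar>poly (pderiv P) t\<bar> \<le> \<bar>J 1 x\<bar> + 1" using near(2)[OF t] s(2) by linarith
      moreover have "\<bar>poly (pderiv Q) t\<bar> \<le> \<bar>I 1 x\<bar> + 1" using near(4)[OF t] s(2) by linarith
      moreover have "\<bar>J 1 x\<bar> + \<bar>I 1 x\<bar> + 1 \<le> M" by (simp add: M_def)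
      ultimately have "\<bar>poly (pderiv P) t\<bar> + \<bar>poly (pderiv Q) t\<bar> \<le> M + 1" by arith
      then show "\<bar>poly (pderiv P) t\<bar> + \<bar>poly (pderiv Q) t\<bar> \<le> 2 * M" using M(1) by simp
    qed
    also have "\<dots> = 2 * M * d" using ab by (simp add: d_def mult.commute)
    finally have IP: "IP \<le> 2 * M * d" .
    \<comment> \<open>Here m > 0 matters: D^(2m) <= D for D <= 1, so the first summand is linear in
      d, as the variation is.\<close>
    have V: "V_disc m X f g a b \<le> 6 * M * d"
    proof -
      have "D ^ (2 * m) \<le> D ^ 1" using D m by (intro power_decreasing) auto
      then have 1: "D ^ (2 * m) \<le> 4 * d" using D(2) by simp
      have "0 \<le> IP" unfolding IP_def by (intro integral_nonneg integrable_continuous_real continuous_intros) auto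
      moreover have "D ^ m \<le> 1" using D by (intro power_le_one) auto
      ultimately have 2: "D ^ m * IP \<le> 1 * (2 * M * d)" using IP D by (intro mult_mono) auto
      have "4 * d \<le> 4 * M * d" using M d by simp
      then show ?thesis using 1 2 by (simp add: V_disc_interp D_def IP_def P_def Q_def)
    qed
    have Vpos: "V_disc m X f g a b > 0" by (rule V_disc_pos) (use X m ab in auto)
    have "\<bar>A_disc X f g h a b / V_disc m X f g a b\<bar> < s" using AV'[rule_format, of X a b] X ab D by (auto simp: D_def)
    then have "\<bar>A_disc X f g h a b\<bar> \<le> s * V_disc m X f g a b" using Vpos by (simp add: pos_divide_less_eq)
    also have "\<dots> \<le> s * (6 * M * d)" using V s by (intro mult_left_mono) auto
    finally have A: "\<bar>h b - h a - 2 * A0\<bar> \<le> 6 * M * s * d" by (simp add: A_disc_interp A0_def P_def Q_def mult_ac)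
    have *: "\<bar>u - 2 * w\<bar> \<le> E + 2 * E" if "\<bar>u - 2 * v\<bar> \<le> E" "\<bar>v - w\<bar> \<le> E" for u v w E :: real
      using that by linarith
    have "\<bar>h b - h a - 2 * (c0 * (b - a))\<bar> \<le> 6 * M * s * d + 2 * (6 * M * s * d)" by (rule *[OF A A0])
    also have "\<dots> = 18 * M * s * d" by simp
    also have "\<dots> \<le> 24 * M * s * d" using M s d by (intro mult_right_mono) auto
    also have "\<dots> \<le> e * d" using s d by (intro mult_right_mono) auto
    finally show ?thesis by (simp add: d_def mult.assoc)
  qed
  show "\<exists>d>0. \<forall>y\<in>N. \<bar>y - x\<bar> < d \<longrightarrow> \<bar>h y - h x - 2 * (J 1 x * I 0 x - J 0 x * I 1 x) * (y - x)\<bar> \<le> e * \<bar>y - x\<bar>"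
  proof (intro exI[of _ \<delta>] conjI ballI impI)
    fix y assume y: "y \<in> N" "\<bar>y - x\<bar> < \<delta>"
    have c: "2 * (J 1 x * I 0 x - J 0 x * I 1 x) = 2 * c0" by (simp add: c0_def mult.commute)
    consider "x < y" | "y < x" | "x = y" by linarith
    then show "\<bar>h y - h x - 2 * (J 1 x * I 0 x - J 0 x * I 1 x) * (y - x)\<bar> \<le> e * \<bar>y - x\<bar>"
    proof cases
      case 1
      then show ?thesis using key[of x y] x y unfolding c by simp
    next
      case 2
      have "\<bar>h y - h x - 2 * c0 * (y - x)\<bar> = \<bar>h x - h y - 2 * c0 * (x - y)\<bar>"
        by (subst abs_minus_cancel[symmetric]) (simp add: algebra_simps)
      then show ?thesis using key[of y x] x y 2 unfolding c by simp
    qed simp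
  qed (use \<delta>1 \<delta>2 \<delta>3 in \<open>auto simp: \<delta>_def\<close>)
qed

lemma dd_unif_conv_subset:
  assumes "dd_unif_conv m K f" "N \<subseteq> K"
  shows "dd_unif_conv m N f"
  using assms(1) unfolding dd_unif_conv_def
  by (elim all_forward imp_forward ex_forward conj_forward) (use assms(2) in auto)

lemma discrete_AV_subset:
  assumes "discrete_AV m K f g h" "N \<subseteq> K"
  shows "discrete_AV m N f g h"
  using assms(1) unfolding discrete_AV_def
  by (elim all_forward imp_forward ex_forward conj_forward) (use assms(2) in auto)

lemma has_derivative_within_local:
  assumes "(u has_real_derivative D) (at x within N)" "\<delta> > 0" "u x = v x"
    and "\<And>y. y \<in> L \<Longrightarrow> \<bar>y - x\<bar> < \<delta> \<Longrightarrow> y \<in> N \<and> u y = v y"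
  shows "(v has_real_derivative D) (at x within L)"
  unfolding has_real_derivative_within_alt
proof (intro allI impI)
  fix e :: real assume "e > 0"
  then obtain d where d: "d > 0" "\<And>y. y \<in> N \<Longrightarrow> \<bar>y - x\<bar> < d \<Longrightarrow> \<bar>u y - u x - D * (y - x)\<bar> \<le> e * \<bar>y - x\<bar>"
    using assms(1) unfolding has_real_derivative_within_alt by blast
  show "\<exists>d>0. \<forall>y\<in>L. \<bar>y - x\<bar> < d \<longrightarrow> \<bar>v y - v x - D * (y - x)\<bar> \<le> e * \<bar>y - x\<bar>"
  proof (intro exI[of _ "min d \<delta>"] conjI ballI impI)
    fix y assume "y \<in> L" "\<bar>y - x\<bar> < min d \<delta>"
    then show "\<bar>v y - v x - D * (y - x)\<bar> \<le> e * \<bar>y - x\<bar>"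
      using d(2)[of y] assms(3) assms(4)[of y] by auto
  qed (use d(1) assms(2) in auto)
qed

text \<open>Isolated points may carry arbitrary jets. Adjoining two rays with zero jets makes every
  complementary interval a bounded gap and the extension constant near infinity.\<close>
lemma CmH_sufficient:
  assumes m: "m > 0" and K: "compact K" and iso: "finite {x \<in> K. x isolated_in K}"
    and dd: "dd_unif_conv m K f" "dd_unif_conv m K g" and AV: "discrete_AV m K f g h"
  shows "CmH m K f g h"
proof -
  define N where "N = {x \<in> K. x islimpt K}"
  define S where "S = {x \<in> K. x isolated_in K}"
  have KNS: "K = N \<union> S" "N \<inter> S = {}" by (auto simp: N_def S_def isolated_in_islimpt_iff)
  have NK: "N \<subseteq> K" by (auto simp: N_def)
  \<comment> \<open>Removing finitely many points from K does not destroy limit points, so N has no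
    isolated points.\<close>
  have lim: "x islimpt N" if "x \<in> N" for x
  proof -
    have "x islimpt N \<union> S" by (subst KNS(1)[symmetric]) (use that in \<open>simp add: N_def\<close>)
    then show ?thesis using iso by (simp add: islimpt_Un islimpt_finite S_def)
  qed
  obtain J0 where J0: "jet_of m N f J0" by (rule jet_of_exists[OF m lim dd_unif_conv_subset[OF dd(1) NK]])
  obtain I0 where I0: "jet_of m N g I0" by (rule jet_of_exists[OF m lim dd_unif_conv_subset[OF dd(2) NK]])
  have AVN: "discrete_AV m N f g h" by (rule discrete_AV_subset[OF AV NK])
  obtain R0 where R0: "R0 > 0" "K \<subseteq> {-R0<..<R0}" using compact_subset_Icc[OF K] by blast
  \<comment> \<open>A margin of 1 between K and the rays; since \<delta> <= 1, no \<delta>-close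
    pair of points has one in K and one on a ray.\<close>
  define R where "R = R0 + 1"
  have KR: "-R + 1 < x" "x < R - 1" if "x \<in> K" for x using R0(2) that by (auto simp: R_def)
  have R1: "R > 1" using R0 by (simp add: R_def)
  define L where "L = K \<union> {..-R} \<union> {R..}"
  have clL: "closed L" unfolding L_def using compact_imp_closed[OF K] by (intro closed_Un closed_atMost closed_atLeast)
  \<comment> \<open>One isolation radius for all of S exists because S is finite. The inserted 1
    covers an empty S.\<close>
  obtain r where r: "r > 0" "\<And>s y. s \<in> S \<Longrightarrow> y \<in> K \<Longrightarrow> \<bar>y - s\<bar> < r \<Longrightarrow> y = s"
  proof -
    have "\<exists>e>0. \<forall>y\<in>K. dist s y < e \<longrightarrow> y = s" if "s \<in> S" for s
      using that by (auto simp: S_def isolated_in_dist_Ex_iff)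
    then obtain e where e: "\<And>s. s \<in> S \<Longrightarrow> e s > 0" "\<And>s y. s \<in> S \<Longrightarrow> y \<in> K \<Longrightarrow> dist s y < e s \<Longrightarrow> y = s" by metis
    define r where "r = Min (insert 1 (e ` S))"
    have fin: "finite (insert 1 (e ` S))" using iso by (simp add: S_def)
    have "r > 0" unfolding r_def using fin e(1) by (subst Min_gr_iff) auto
    moreover have "r \<le> e s" if "s \<in> S" for s unfolding r_def using fin that by (intro Min_le) auto
    ultimately show thesis using e(2) by (intro that[of r]) (force simp: dist_real_def abs_minus_commute)+
  qed
  define \<delta> where "\<delta> = min 1 r"
  have \<delta>: "\<delta> > 0" "\<delta> \<le> 1" "\<delta> \<le> r" using r by (auto simp: \<delta>_def)
  have nearN: "y \<in> N" if "x \<in> N" "y \<in> L" "\<bar>y - x\<bar> < \<delta>" for x y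
  proof -
    have xK: "x \<in> K" using that NK by blast
    then have "y \<in> K" using that(2,3) KR[OF xK] \<delta> by (auto simp: L_def)
    moreover have "y \<notin> S" using r(2)[of y x] xK that KNS \<delta> abs_minus_commute[of x y] by auto
    ultimately show ?thesis using KNS by blast
  qed
  have nearS: "y = x" if "x \<in> S" "y \<in> L" "\<bar>y - x\<bar> < \<delta>" for x y
  proof -
    have xK: "x \<in> K" using that KNS by blast
    then have "y \<in> K" using that(2,3) KR[OF xK] \<delta> by (auto simp: L_def)
    then show ?thesis using r(2)[of x y] that \<delta> by auto
  qed
  have nearl: "y \<le> -R" if "x \<le> -R" "y \<in> L" "\<bar>y - x\<bar> < \<delta>" for x y
    using that KR[of y] \<delta> R1 by (auto simp: L_def)
  have nearr: "R \<le> y" if "R \<le> x" "y \<in> L" "\<bar>y - x\<bar> < \<delta>" for x y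
    using that KR[of y] \<delta> R1 by (auto simp: L_def)
  have KnR: "x \<notin> K" if "x \<le> -R \<or> R \<le> x" for x using that KR[of x] by auto
  have Lcases: "x \<in> N \<or> x \<in> S \<or> x \<le> -R \<or> R \<le> x" if "x \<in> L" for x using that KNS by (auto simp: L_def)
  define ext where "ext J u k x = (if x \<in> N then J k x else if k = 0 \<and> x \<in> K then u x else 0)"
    for J :: "nat \<Rightarrow> real \<Rightarrow> real" and u :: "real \<Rightarrow> real" and k x
  define J where "J = ext J0 f"
  define I where "I = ext I0 g"
  define h' where "h' x = (if x \<in> K then h x else 0)" for x
  have ext_N: "ext J u k x = J k x" if "x \<in> N" for J u k x using that by (simp add: ext_def)
  have ext_R: "ext J u k x = 0" if "x \<le> -R \<or> R \<le> x" for J u k x using KnR[OF that] NK by (auto simp: ext_def)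
  have ext_S: "ext J u (Suc k) x = 0" if "x \<in> S" for J u k x using that KNS by (auto simp: ext_def)
  have ext_K: "ext J u 0 x = u x" if "jet_of m N u J" "x \<in> K" for J u x using that by (auto simp: ext_def jet_of_def)
  \<comment> \<open>Near each of its points L is part of N, a single point or a ray, so derivatives
    within L reduce to derivatives within these pieces.\<close>
  have local: "(v has_real_derivative D x) (at x within L)"
    if x: "x \<in> L" and vN: "x \<in> N \<Longrightarrow> (v has_real_derivative D x) (at x within N)"
      and D0: "x \<notin> N \<Longrightarrow> D x = 0" and vR: "\<And>y. y \<le> -R \<or> R \<le> y \<Longrightarrow> v y = 0" for v D x
    using Lcases[OF x]
  proof (elim disjE)
    assume "x \<in> N"
    show ?thesis by (rule has_derivative_within_local[OF vN[OF \<open>x \<in> N\<close>] \<delta>(1)]) (use nearN \<open>x \<in> N\<close> in auto)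
  next
    assume s: "x \<in> S"
    have "(v has_real_derivative 0) (at x within {x})" unfolding has_real_derivative_within_alt by (auto intro: exI[of _ 1])
    then have "(v has_real_derivative 0) (at x within L)"
      by (rule has_derivative_within_local[OF _ \<delta>(1)]) (use nearS s in auto)
    moreover have "x \<notin> N" using s KNS(2) by blast
    ultimately show ?thesis using D0 by simp
  next
    assume s: "x \<le> -R"
    have "((\<lambda>_. 0) has_real_derivative 0) (at x within {..-R})" by simp
    then have "(v has_real_derivative 0) (at x within L)"
      by (rule has_derivative_within_local[OF _ \<delta>(1)]) (use nearl s vR in auto)
    moreover have "x \<notin> N" using KnR[of x] s NK by blast
    ultimately show ?thesis using D0 by simp
  next
    assume s: "R \<le> x"
    have "((\<lambda>_. 0) has_real_derivative 0) (at x within {R..})" by simp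
    then have "(v has_real_derivative 0) (at x within L)"
      by (rule has_derivative_within_local[OF _ \<delta>(1)]) (use nearr s vR in auto)
    moreover have "x \<notin> N" using KnR[of x] s NK by blast
    ultimately show ?thesis using D0 by simp
  qed
  have extN: "(ext J u k has_real_derivative ext J u (Suc k) x) (at x within N)"
    if "jet_of m N u J" "k < m" "x \<in> N" for J u k x
  proof -
    have "(J k has_real_derivative J (Suc k) x) (at x within N)" by (rule jet_has_derivative[OF m lim that(1,3,2)])
    then have "(ext J u k has_real_derivative J (Suc k) x) (at x within N)"
      by (rule has_derivative_within_local[of _ _ _ _ 1]) (use that(3) ext_N in auto)
    then show ?thesis using that(3) by (simp add: ext_N)
  qed
  have ext_deriv: "(ext J u k has_real_derivative ext J u (Suc k) x) (at x within L)"
    if jt: "jet_of m N u J" "k < m" "x \<in> L" for J u k x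
  proof (rule local[where D = "ext J u (Suc k)", OF jt(3) extN[OF jt(1,2)]])
    show "ext J u (Suc k) x = 0" if "x \<notin> N" using that by (simp add: ext_def)
  qed (simp_all add: ext_R)
  have ext_cont: "continuous_on L (ext J u m)" if jt: "jet_of m N u J" for J u
    unfolding continuous_on_iff dist_real_def
  proof (intro ballI allI impI)
    fix x e :: real assume x: "x \<in> L" and e: "e > 0"
    show "\<exists>d>0. \<forall>y\<in>L. \<bar>y - x\<bar> < d \<longrightarrow> \<bar>ext J u m y - ext J u m x\<bar> < e"
      using Lcases[OF x]
    proof (elim disjE)
      assume xN: "x \<in> N"
      obtain d where d: "d > 0" "\<And>y. y \<in> N \<Longrightarrow> \<bar>y - x\<bar> < d \<Longrightarrow> \<bar>J m y - J m x\<bar> < e"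
        using jet_continuous_on[OF m lim jt] xN e unfolding continuous_on_iff dist_real_def by metis
      show ?thesis
        by (rule exI[of _ "min d \<delta>"]) (use d \<delta>(1) nearN[OF xN] xN ext_N in auto)
    next
      assume xS: "x \<in> S"
      have "\<bar>ext J u m y - ext J u m x\<bar> < e" if "y \<in> L" "\<bar>y - x\<bar> < \<delta>" for y
        using nearS[OF xS that] e by simp
      then show ?thesis using \<delta>(1) by blast
    next
      assume xR: "x \<le> -R"
      have "\<bar>ext J u m y - ext J u m x\<bar> < e" if "y \<in> L" "\<bar>y - x\<bar> < \<delta>" for y
        using nearl[OF xR that] xR e by (simp add: ext_R)
      then show ?thesis using \<delta>(1) by blast
    next
      assume xR: "R \<le> x"
      have "\<bar>ext J u m y - ext J u m x\<bar> < e" if "y \<in> L" "\<bar>y - x\<bar> < \<delta>" for y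
        using nearr[OF xR that] xR e by (simp add: ext_R)
      then show ?thesis using \<delta>(1) by blast
    qed
  qed
  have h'R: "h' y = 0" if "y \<le> -R \<or> R \<le> y" for y using KnR[OF that] by (simp add: h'_def)
  have h'_deriv: "(h' has_real_derivative 2 * (J 1 x * I 0 x - J 0 x * I 1 x)) (at x within L)" if "x \<in> L" for x
  proof (rule local[OF that _ _ h'R])
    assume xN: "x \<in> N"
    have "(h has_real_derivative 2 * (J0 1 x * I0 0 x - J0 0 x * I0 1 x)) (at x within N)"
      by (rule height_has_derivative[OF m lim J0 I0 AVN xN])
    then have "(h' has_real_derivative 2 * (J0 1 x * I0 0 x - J0 0 x * I0 1 x)) (at x within N)"
      by (rule has_derivative_within_local[of _ _ _ _ 1]) (use NK xN in \<open>auto simp: h'_def\<close>)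
    then show "(h' has_real_derivative 2 * (J 1 x * I 0 x - J 0 x * I 1 x)) (at x within N)"
      using xN by (simp add: J_def I_def ext_N)
  next
    assume "x \<notin> N"
    then show "2 * (J 1 x * I 0 x - J 0 x * I 1 x) = 0" by (simp add: J_def I_def ext_def)
  qed
  have fill: "\<exists>d>0. \<forall>a b. gap L a b \<longrightarrow> b - a < d \<longrightarrow> (\<exists>F G. fills m J I h' a b e F G)" if e: "e > 0" for e
  proof -
    have "\<exists>\<delta>>0. \<forall>a\<in>N. \<forall>b\<in>N. a < b \<longrightarrow> b - a < \<delta> \<longrightarrow> (\<exists>F G. fills m J0 I0 h a b e F G)"
      by (rule fills_small[OF m lim J0 I0 AVN e])
    then obtain d where d: "d > 0" and dfill: "\<forall>a\<in>N. \<forall>b\<in>N. a < b \<longrightarrow> b - a < d \<longrightarrow> (\<exists>F G. fills m J0 I0 h a b e F G)" by blast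
    show ?thesis
    proof (intro exI[of _ "min d \<delta>"] conjI allI impI)
      fix a b assume g: "gap L a b" and ba: "b - a < min d \<delta>"
      have ab: "a \<in> L" "b \<in> L" "a < b" using g by (auto simp: gap_def)
      have mid: "(a + b) / 2 \<notin> L"
      proof
        assume "(a + b) / 2 \<in> L"
        from gap_no_interior[OF g this] show False using ab(3) by auto
      qed
      \<comment> \<open>A gap shorter than \<delta> cannot start at an isolated point, whose
        distance to the rest of L is at least \<delta>, nor on a ray, since its midpoint would then
        lie in L.\<close>
      have aN: "a \<in> N"
        using Lcases[OF ab(1)]
      proof (elim disjE)
        assume "a \<in> S"
        then show ?thesis using nearS[of a b] ab ba by auto
      next
        assume "a \<le> -R"
        then have "b \<le> -R" using nearl[of a b] ab ba by auto
        then show ?thesis using mid \<open>a \<le> -R\<close> by (auto simp: L_def)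
      next
        assume "R \<le> a"
        then show ?thesis using mid ab(3) by (auto simp: L_def)
      qed
      then have bN: "b \<in> N" using nearN[of a b] ab ba by auto
      have "b - a < d" using ba by simp
      then obtain F G where "fills m J0 I0 h a b e F G" using dfill aN bN ab(3) by blast
      then have "fills m J I h' a b e F G" using aN bN NK unfolding fills_def
        by (auto simp: J_def I_def ext_N h'_def subset_iff)
      then show "\<exists>F G. fills m J I h' a b e F G" by blast
    qed (use d \<delta> in auto)
  qed
  have cover: "\<exists>a b. gap L a b \<and> a < y \<and> y < b" if "y \<notin> L" for y
  proof -
    have "-R \<in> L" "R \<in> L" "-R < y" "y < R" using that by (auto simp: L_def)
    then show ?thesis using gap_exists[OF clL that, of "-R" R] by blast
  qed
  have "\<exists>F G H. Cm m F \<and> Cm m G \<and> Cm m H \<and> horizontal F G H \<and> (\<forall>x\<in>L. F x = J 0 x \<and> G x = I 0 x \<and> H x = h' x)"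
  proof (rule horizontal_extension[OF m cover, where R = R])
    show "x \<in> L \<and> J 0 x = 0 \<and> I 0 x = 0 \<and> h' x = 0" if "x \<le> - R" for x
      using that ext_R h'R by (auto simp: L_def J_def I_def)
    show "x \<in> L \<and> J 0 x = 0 \<and> I 0 x = 0 \<and> h' x = 0" if "x \<ge> R" for x
      using that ext_R h'R by (auto simp: L_def J_def I_def)
  qed (use ext_deriv[OF J0] ext_deriv[OF I0] ext_cont[OF J0] ext_cont[OF I0] h'_deriv fill in \<open>auto simp: J_def I_def\<close>)
  then obtain F G H where FGH: "Cm m F" "Cm m G" "Cm m H" "horizontal F G H" "\<forall>x\<in>L. F x = J 0 x \<and> G x = I 0 x \<and> H x = h' x"
    by blast
  have "F x = f x \<and> G x = g x \<and> H x = h x" if "x \<in> K" for x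
    using FGH(5) that ext_K[OF J0 that] ext_K[OF I0 that] by (auto simp: L_def J_def I_def h'_def)
  then show ?thesis unfolding CmH_def using FGH by blast
qed

theorem theorem1p5:
  fixes m :: nat and K :: "real set" and f g h :: "real \<Rightarrow> real"
  assumes "m > 0"
    and "compact K"
    and "finite {x \<in> K. x isolated_in K}"
    and "continuous_on K f" and "continuous_on K g" and "continuous_on K h"
  shows "CmH m K f g h \<longleftrightarrow>
           (dd_unif_conv m K f \<and> dd_unif_conv m K g \<and> dd_unif_conv m K h) \<and>
           discrete_AV m K f g h"
  using CmH_necessary[OF assms(1,2)] CmH_sufficient[OF assms(1-3)] by blast

end
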